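(* Let $\beta\in(0,1)$ and $s\in(\frac12,1)$ be such that $2s+\beta$ is not an integer, and let $T>0$. There is a constant $C>0$, independent of $u$, $f$ and $u_T$, such that if $f\in\mathcal{C}^{\beta,\frac{\beta}{2}}(Q_T)$, $u_T\in\mathcal{C}^{2s+\beta}(\mathbb{T}^d)$, and $u$ is a solution of $$\begin{cases}-\partial_t u+(-\Delta)^s u+f(x,t)=0 & \text{in } Q_T,\\ u(x,T)=u_T(x) & \text{in } \mathbb{T}^d,\end{cases}$$ then $$\|\partial_tu\|_{\mathcal{C}^{\beta,\frac{\beta}{2}}(Q_T)}+\|(-\Delta)^su\|_{\mathcal{C}^{\beta,\frac{\beta}{2}}(Q_T)}\le C\left(\|u_T\|_{\mathcal{C}^{2s+\beta}(\mathbb{T}^d)}+\|f\|_{\mathcal{C}^{\beta,\frac{\beta}{2}}(Q_T)}\right).$$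
   Context: $\mathbb{T}^d=\mathbb{R}^d/\mathbb{Z}^d$, $Q_T=\mathbb{T}^d\times[0,T]$. The fractional Laplacian is $(-\Delta)^s u(x)=(2\pi)^{2s}\sum_{k\in\mathbb{Z}^d}|k|^{2s}\widehat u(k)e^{2\pi i k\cdot x}$, $\widehat u(k)=\int_{\mathbb{T}^d}u(x)e^{-2\pi i k\cdot x}dx$. For $k\ge0$ an integer and $\beta\in(0,1]$, $\mathcal{C}^{k+\beta}(\mathbb{T}^d)$ is the space of $\mathcal{C}^k$ functions whose derivatives of order $k$ are $\beta$-H\"older, with the usual norm. For $\alpha,\gamma\in(0,1)$, $\mathcal{C}^{\alpha,\gamma}(Q_T)$ is the space of continuous functions with finite seminorm $\sup_t[v(\cdot,t)]_{\mathcal{C}^\alpha}+\sup_x[v(x,\cdot)]_{\mathcal{C}^\gamma}$; its norm is the sup norm plus this seminorm. *)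

theory Defs
  imports "HOL-Analysis.Analysis"
begin

text \<open>
  Functions on the torus are 1-periodic functions on \<open>real ^ 'n\<close>, with \<open>d = CARD('n)\<close>.  Functions on
  \<open>Q\<^sub>T\<close> have type \<open>real ^ 'n \<Rightarrow> real \<Rightarrow> real\<close>; their values at times outside \<open>{0..T}\<close> are irrelevant.
  Norms and seminorms take values in \<open>ennreal\<close>, so that an inequality between norms with a finite
  right-hand side includes the finiteness of its left-hand side.
\<close>

definition periodic :: "(real ^ 'n \<Rightarrow> 'a) \<Rightarrow> bool" where
  "periodic v \<longleftrightarrow> (\<forall>x i. v (x + axis i 1) = v x)"


subsection \<open>Hoelder spaces\<close>

definition sup_norm :: "'a set \<Rightarrow> ('a \<Rightarrow> real) \<Rightarrow> ennreal" where
  "sup_norm S v = (SUP x\<in>S. ennreal \<bar>v x\<bar>)"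

text \<open>
  For periodic \<open>v\<close> and \<open>S = UNIV\<close> this is the seminorm with respect to the quotient distance of the
  torus, since that distance is the minimum of \<open>dist x y\<close> over all representatives.
\<close>

definition holder_seminorm :: "real \<Rightarrow> 'a::metric_space set \<Rightarrow> ('a \<Rightarrow> real) \<Rightarrow> ennreal" where
  "holder_seminorm \<alpha> S v = (SUP x\<in>S. SUP y\<in>S - {x}. ennreal (\<bar>v x - v y\<bar> / dist x y powr \<alpha>))"

definition partial :: "'n::finite \<Rightarrow> (real ^ 'n \<Rightarrow> real) \<Rightarrow> real ^ 'n \<Rightarrow> real" where
  "partial i v x = frechet_derivative v (at x) (axis i 1)"

text \<open>Derivatives of order \<open>j\<close> are indexed by the lists \<open>is\<close> of coordinate indices of length \<open>j\<close>.\<close>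

definition partials :: "'n::finite list \<Rightarrow> (real ^ 'n \<Rightarrow> real) \<Rightarrow> real ^ 'n \<Rightarrow> real" where
  "partials is v = foldr partial is v"

primrec Ck :: "nat \<Rightarrow> (real ^ 'n::finite \<Rightarrow> real) \<Rightarrow> bool" where
  "Ck 0 v \<longleftrightarrow> continuous_on UNIV v"
| "Ck (Suc k) v \<longleftrightarrow> v differentiable_on UNIV \<and> (\<forall>i. Ck k (partial i v))"

definition holder_space :: "nat \<Rightarrow> real \<Rightarrow> (real ^ 'n::finite \<Rightarrow> real) set" where
  "holder_space k \<alpha> = {v. periodic v \<and> Ck k v \<and>
     (\<forall>is. length is = k \<longrightarrow> holder_seminorm \<alpha> UNIV (partials is v) < \<infinity>)}"

definition holder_norm :: "nat \<Rightarrow> real \<Rightarrow> (real ^ 'n::finite \<Rightarrow> real) \<Rightarrow> ennreal" where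
  "holder_norm k \<alpha> v =
     (\<Sum>j\<le>k. SUP is\<in>{is. length is = j}. sup_norm UNIV (partials is v)) +
     (SUP is\<in>{is. length is = k}. holder_seminorm \<alpha> UNIV (partials is v))"

definition par_holder_seminorm ::
    "real \<Rightarrow> real \<Rightarrow> real \<Rightarrow> (real ^ 'n::finite \<Rightarrow> real \<Rightarrow> real) \<Rightarrow> ennreal" where
  "par_holder_seminorm \<alpha> \<gamma> T v =
     (SUP t\<in>{0..T}. holder_seminorm \<alpha> UNIV (\<lambda>x. v x t)) + (SUP x. holder_seminorm \<gamma> {0..T} (v x))"

definition cont_QT :: "real \<Rightarrow> (real ^ 'n::finite \<Rightarrow> real \<Rightarrow> real) \<Rightarrow> bool" where
  "cont_QT T v \<longleftrightarrow>
     (\<forall>t\<in>{0..T}. periodic (\<lambda>x. v x t)) \<and> continuous_on (UNIV \<times> {0..T}) (\<lambda>(x, t). v x t)"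

definition par_holder_space ::
    "real \<Rightarrow> real \<Rightarrow> real \<Rightarrow> (real ^ 'n::finite \<Rightarrow> real \<Rightarrow> real) set" where
  "par_holder_space \<alpha> \<gamma> T = {v. cont_QT T v \<and> par_holder_seminorm \<alpha> \<gamma> T v < \<infinity>}"

definition par_holder_norm ::
    "real \<Rightarrow> real \<Rightarrow> real \<Rightarrow> (real ^ 'n::finite \<Rightarrow> real \<Rightarrow> real) \<Rightarrow> ennreal" where
  "par_holder_norm \<alpha> \<gamma> T v =
     sup_norm (UNIV \<times> {0..T}) (\<lambda>(x, t). v x t) + par_holder_seminorm \<alpha> \<gamma> T v"


subsection \<open>The fractional Laplacian\<close>

definition freq :: "int ^ 'n \<Rightarrow> real ^ 'n" where
  "freq k = (\<chi> i. of_int (k $ i))"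

definition fourier_coeff :: "(real ^ 'n::finite \<Rightarrow> real) \<Rightarrow> int ^ 'n \<Rightarrow> complex" where
  "fourier_coeff v k =
     integral (cbox 0 1) (\<lambda>x. complex_of_real (v x) * exp (- 2 * pi * \<i> * (freq k \<bullet> x)))"

definition frac_laplacian_sum ::
    "real \<Rightarrow> (real ^ 'n::finite \<Rightarrow> real) \<Rightarrow> (int ^ 'n) set \<Rightarrow> real ^ 'n \<Rightarrow> complex" where
  "frac_laplacian_sum s v F x = complex_of_real ((2 * pi) powr (2 * s)) *
     (\<Sum>k\<in>F. complex_of_real (norm (freq k) powr (2 * s)) * fourier_coeff v k *
             exp (2 * pi * \<i> * (freq k \<bullet> x)))"

text \<open>
  For \<open>v\<close> of class \<open>C\<^bsup>2s+\<beta>\<^esup>\<close> the series need not converge absolutely, so it is summed (over all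
  finite sets of frequencies) in the square mean over the torus.  The sum is required to be a
  continuous function, which makes it unique.
\<close>

definition has_frac_laplacian ::
    "real \<Rightarrow> (real ^ 'n::finite \<Rightarrow> real) \<Rightarrow> (real ^ 'n \<Rightarrow> real) \<Rightarrow> bool" where
  "has_frac_laplacian s v g \<longleftrightarrow> periodic g \<and> continuous_on UNIV g \<and>
     ((\<lambda>F. integral (cbox 0 1) (\<lambda>x. (cmod (frac_laplacian_sum s v F x - complex_of_real (g x)))\<^sup>2))
       \<longlongrightarrow> 0) (finite_subsets_at_top UNIV)"

definition frac_laplacian :: "real \<Rightarrow> (real ^ 'n::finite \<Rightarrow> real) \<Rightarrow> real ^ 'n \<Rightarrow> real" where
  "frac_laplacian s v = (THE g. has_frac_laplacian s v g)"

lemma periodic_shift_nat: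
  assumes "periodic v" shows "v (x + real m *\<^sub>R axis i 1) = v x"
proof (induction m)
  case (Suc m)
  have "x + real (Suc m) *\<^sub>R axis i 1 = (x + real m *\<^sub>R axis i 1) + axis i 1"
    by (simp add: algebra_simps)
  then show ?case using assms Suc unfolding periodic_def by metis
qed simp

lemma periodic_shift_int:
  assumes "periodic v" shows "v (x + real_of_int m *\<^sub>R axis i 1) = v x"
proof (cases "m \<ge> 0")
  case True
  then show ?thesis using periodic_shift_nat[OF assms, of x "nat m" i] by simp
next
  case False
  then show ?thesis
    using periodic_shift_nat[OF assms, of "x + real_of_int m *\<^sub>R axis i 1" "nat (- m)" i] by simp
qed

lemma periodic_shift_freq:
  assumes "periodic v" shows "v (x + freq k) = v x"
proof -
  have *: "v (x + (\<Sum>i\<in>A. real_of_int (k $ i) *\<^sub>R axis i 1)) = v x" if "finite A" for A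
    using that
  proof (induction A)
    case (insert j A)
    then show ?case
      using periodic_shift_int[OF assms, of "x + (\<Sum>i\<in>A. real_of_int (k $ i) *\<^sub>R axis i 1)" "k $ j" j]
      by (simp add: algebra_simps)
  qed simp
  have "freq k = (\<Sum>i\<in>UNIV. real_of_int (k $ i) *\<^sub>R axis i 1)"
    using basis_expansion[of "freq k"] by (simp add: freq_def scalar_mult_eq_scaleR)
  then show ?thesis using *[of UNIV] by simp
qed

lemma has_frac_laplacian_unique:
  fixes v g h :: "real ^ 'n::finite \<Rightarrow> real"
  assumes "has_frac_laplacian s v g" "has_frac_laplacian s v h"
  shows "g = h"
proof -
  let ?Q = "cbox 0 1 :: (real ^ 'n) set"
  let ?S = "frac_laplacian_sum s v"
  let ?I = "\<lambda>F g. integral ?Q (\<lambda>x. (cmod (?S F x - complex_of_real (g x)))\<^sup>2)"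
  have g: "continuous_on UNIV g" "periodic g" "((\<lambda>F. ?I F g) \<longlongrightarrow> 0) (finite_subsets_at_top UNIV)"
   and h: "continuous_on UNIV h" "periodic h" "((\<lambda>F. ?I F h) \<longlongrightarrow> 0) (finite_subsets_at_top UNIV)"
    using assms unfolding has_frac_laplacian_def by auto
  have cS: "continuous_on ?Q (?S F)" for F
    unfolding frac_laplacian_sum_def by (intro continuous_intros)
  have cg: "continuous_on ?Q g" "continuous_on ?Q h"
    using g(1) h(1) continuous_on_subset by blast+
  have ii: "(\<lambda>x. (cmod (?S F x - complex_of_real (w x)))\<^sup>2) integrable_on ?Q"
    if "continuous_on ?Q w" for F w
    using that cS by (intro integrable_continuous continuous_intros)
  have cd: "continuous_on ?Q (\<lambda>x. (g x - h x)\<^sup>2)"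
    using cg by (intro continuous_intros)
  have bound: "integral ?Q (\<lambda>x. (g x - h x)\<^sup>2) \<le> 2 * ?I F g + 2 * ?I F h" for F
  proof -
    have "(g x - h x)\<^sup>2 \<le> 2 * (cmod (?S F x - complex_of_real (g x)))\<^sup>2 +
        2 * (cmod (?S F x - complex_of_real (h x)))\<^sup>2" for x
    proof -
      let ?a = "cmod (?S F x - complex_of_real (g x))" and ?b = "cmod (?S F x - complex_of_real (h x))"
      have "\<bar>g x - h x\<bar> = cmod ((?S F x - complex_of_real (h x)) - (?S F x - complex_of_real (g x)))"
        by (simp flip: of_real_diff)
      also have "\<dots> \<le> ?a + ?b"
        using norm_triangle_ineq4 by (metis add.commute)
      finally have "(g x - h x)\<^sup>2 \<le> (?a + ?b)\<^sup>2"
        by (metis abs_ge_zero power2_abs power_mono)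
      also have "\<dots> \<le> 2 * ?a\<^sup>2 + 2 * ?b\<^sup>2"
        using sum_squares_ge_zero[of "?a - ?b" 0] by (simp add: power2_eq_square algebra_simps)
      finally show ?thesis .
    qed
    then have "integral ?Q (\<lambda>x. (g x - h x)\<^sup>2) \<le>
        integral ?Q (\<lambda>x. 2 * (cmod (?S F x - complex_of_real (g x)))\<^sup>2 +
          2 * (cmod (?S F x - complex_of_real (h x)))\<^sup>2)"
      by (intro integral_le integrable_add integrable_on_mult_right ii cg integrable_continuous[OF cd])
    also have "\<dots> = 2 * ?I F g + 2 * ?I F h"
      using ii cg by (subst integral_add) (auto intro!: integrable_on_mult_right)
    finally show ?thesis .
  qed
  have "((\<lambda>F. 2 * ?I F g + 2 * ?I F h) \<longlongrightarrow> 2 * 0 + 2 * 0) (finite_subsets_at_top UNIV)"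
    by (intro tendsto_intros g h)
  then have "integral ?Q (\<lambda>x. (g x - h x)\<^sup>2) \<le> 0"
    using tendsto_lowerbound[OF _ always_eventually, of _ 0] bound by force
  moreover have "integral ?Q (\<lambda>x. (g x - h x)\<^sup>2) \<ge> 0"
    by (intro integral_nonneg integrable_continuous cd) auto
  ultimately have z: "integral ?Q (\<lambda>x. (g x - h x)\<^sup>2) = 0" by simp
  have box: "box 0 (1 :: real ^ 'n) \<noteq> {}"
    by (auto simp: box_ne_empty Basis_vec_def inner_axis)
  have on_cube: "g x = h x" if "x \<in> ?Q" for x
    using integral_cbox_eq_0_iff[OF cd box] z that by auto
  show ?thesis
  proof
    fix x :: "real ^ 'n"
    define k :: "int ^ 'n" where "k = (\<chi> i. - \<lfloor>x $ i\<rfloor>)"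
    have "x + freq k \<in> ?Q"
      by (simp add: mem_box_cart k_def freq_def) linarith
    then show "g x = h x"
      using on_cube periodic_shift_freq g(2) h(2) by metis
  qed
qed

lemma frac_laplacian_eq: "has_frac_laplacian s v g \<Longrightarrow> frac_laplacian s v = g"
  unfolding frac_laplacian_def using has_frac_laplacian_unique by blast


subsection \<open>Solutions of the backward problem\<close>

definition time_deriv :: "real \<Rightarrow> (real ^ 'n \<Rightarrow> real \<Rightarrow> real) \<Rightarrow> real ^ 'n \<Rightarrow> real \<Rightarrow> real" where
  "time_deriv T u x t = vector_derivative (u x) (at t within {0..T})"

definition frac_laplacian_x ::
    "real \<Rightarrow> (real ^ 'n::finite \<Rightarrow> real \<Rightarrow> real) \<Rightarrow> real ^ 'n \<Rightarrow> real \<Rightarrow> real" where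
  "frac_laplacian_x s u x t = frac_laplacian s (\<lambda>y. u y t) x"

text \<open>
  Solutions are classical: \<open>\<partial>\<^sub>tu\<close> (one-sided at the two end times) and the fractional Laplacian of \<open>u\<close> exist
  and are continuous on the closed cylinder, and the equation holds at every point of it.
\<close>

definition is_solution ::
    "real \<Rightarrow> real \<Rightarrow> (real ^ 'n::finite \<Rightarrow> real \<Rightarrow> real) \<Rightarrow> (real ^ 'n \<Rightarrow> real) \<Rightarrow>
     (real ^ 'n \<Rightarrow> real \<Rightarrow> real) \<Rightarrow> bool" where
  "is_solution s T f u\<^sub>T u \<longleftrightarrow>
     cont_QT T u \<and>
     (\<forall>x. \<forall>t\<in>{0..T}. u x differentiable (at t within {0..T})) \<and>
     cont_QT T (time_deriv T u) \<and>
     (\<forall>t\<in>{0..T}. \<exists>g. has_frac_laplacian s (\<lambda>x. u x t) g) \<and>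
     cont_QT T (frac_laplacian_x s u) \<and>
     (\<forall>x. \<forall>t\<in>{0..T}. - time_deriv T u x t + frac_laplacian_x s u x t + f x t = 0) \<and>
     (\<forall>x. u x T = u\<^sub>T x)"

end

theory Submission
  imports Defs "HOL-Probability.Characteristic_Functions"
begin

text \<open>
  Write \<open>A = (-\<Delta>)\<^sup>s\<close> and \<open>z = A u\<close>.  The proof uses no formula for \<open>u\<close> and no kernel of the semigroup of
  \<open>A\<close>; it tests the equation with the ordinary heat semigroup \<open>G\<^sub>r = exp (r\<Delta>)\<close> and applies the maximum
  principle to the smoothed function \<open>y\<^sub>r = \<Delta>\<^sup>2 G\<^sub>r u\<close> (\<open>bilap r u\<close> below).

  Hoelder regularity is read off from the decay of heat derivatives: \<open>h \<in> C\<^sup>\<beta>\<close> is equivalent to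
  \<open>|\<Delta> G\<^sub>r h| \<le> C r powr (\<beta>/2 - 1)\<close> for all \<open>r > 0\<close> (\<open>heat_lap_holder_bound\<close>, \<open>holder_from_heat_decay\<close>), and
  \<open>u \<in> C\<^bsup>2s+\<beta>\<^esup>\<close> implies \<open>|y\<^sub>r| \<le> C r powr (-\<kappa>)\<close> with \<open>\<kappa> = 2 - s - \<beta>/2\<close> (\<open>bilap_decay_holder_space\<close>).  The
  fourth order of \<open>\<Delta>\<^sup>2\<close> is what makes \<open>\<kappa>\<close> positive for all admissible \<open>s\<close> and \<open>\<beta>\<close>.

  The fractional Laplacian enters through subordination,
  \<open>c A = \<integral> \<sigma> powr (-1-s) (1 - G\<^sub>\<sigma>) d\<sigma>\<close> with \<open>c > 0\<close> (\<open>heat_frac_levy\<close>).  Let \<open>m(r)\<close> be the maximum of \<open>|y\<^sub>r|\<close> over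
  the cylinder, attained at a point \<open>p\<close>, and multiply \<open>y\<^sub>r\<close> by a phase so that it is positive at \<open>p\<close>.  If \<open>p\<close> does not lie
  on the terminal slice, the right time derivative of \<open>y\<^sub>r\<close> is nonpositive there, so that the equation bounds
  \<open>A y\<^sub>r\<close> by the decay of \<open>\<Delta>\<^sup>2 G\<^sub>r f\<close>.  Since \<open>G\<^sub>\<sigma> y\<^sub>r = y\<^bsub>r+\<sigma>\<^esub>\<close>, subordination gives
  \<open>c A y\<^sub>r \<ge> \<integral> (m(r) - m(r+\<sigma>)) \<sigma> powr (-1-s) d\<sigma>\<close> over \<open>\<sigma> \<ge> r\<close> at the point \<open>p\<close>.  With \<open>M = sup (r powr \<kappa> * m(r))\<close> this reads
  \<open>M \<le> 2 powr (-\<kappa>) M + C\<close>, a strict contraction, and therefore bounds \<open>M\<close> (\<open>bilap_a_priori\<close>).  The supremum is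
  taken over \<open>r \<ge> \<epsilon>\<close>, where it is finite a priori; the argument only looks at larger parameters, so the
  bound is uniform in \<open>\<epsilon>\<close>.

  The second subordination formula \<open>c' A = - \<integral> \<sigma> powr (-s) \<Delta> G\<^sub>\<sigma> d\<sigma>\<close> (\<open>heat_frac_gamma\<close>) converts the decay of
  \<open>y\<^sub>r\<close> into the decay of \<open>\<Delta> G\<^sub>r z\<close>, hence into the spatial Hoelder bound for \<open>z\<close>.  The bound for \<open>|z|\<close> follows because
  \<open>z\<close> has mean zero, and the bound in time by comparing \<open>z\<close> with \<open>G\<^sub>r z\<close> for \<open>r = |t - t'|\<close>.
  The equation then yields all bounds for \<open>\<partial>\<^sub>t u\<close>.

  Every identity between operators is proved on the characters of the torus and extended by density of
  trigonometric polynomials (\<open>bl_functional_eqI\<close>).  Functions are complex valued so that the characters are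
  admissible.
\<close>

section \<open>Trigonometric polynomials and density\<close>

definition cont_periodic :: "(real ^ 'n::finite \<Rightarrow> complex) \<Rightarrow> bool" where
  "cont_periodic h \<longleftrightarrow> periodic h \<and> continuous_on UNIV h"

definition chr :: "int ^ 'n::finite \<Rightarrow> real ^ 'n \<Rightarrow> complex" where
  "chr k x = cis (2 * pi * (freq k \<bullet> x))"

lemma freq_zero [simp]: "freq 0 = 0"
  by (simp add: freq_def vec_eq_iff)

lemma freq_add: "freq (k + l) = freq k + freq l"
  by (simp add: freq_def vec_eq_iff)

lemma chr_0 [simp]: "chr 0 = (\<lambda>x. 1)"
  by (simp add: chr_def fun_eq_iff)

lemma chr_mult: "chr (k + l) x = chr k x * chr l x"
  by (simp add: chr_def freq_add inner_add_left cis_mult distrib_left)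

lemma chr_add: "chr k (x + y) = chr k x * chr k y"
  by (simp add: chr_def inner_add_right cis_mult distrib_left)

lemma norm_chr [simp]: "norm (chr k x) = 1"
  by (simp add: chr_def)

lemma continuous_on_chr [continuous_intros]:
  "continuous_on S f \<Longrightarrow> continuous_on S (\<lambda>x. chr k (f x))"
  unfolding chr_def cis_conv_exp by (intro continuous_intros)

lemma cont_periodic_chr: "cont_periodic (chr k)"
proof -
  have "chr k (axis i 1) = 1" for i
  proof -
    have "freq k \<bullet> axis i 1 = real_of_int (k $ i)"
      by (simp add: inner_axis freq_def)
    then show ?thesis
      using cis_multiple_2pi[of "real_of_int (k $ i)"] by (simp add: chr_def)
  qed
  then show ?thesis
    unfolding cont_periodic_def periodic_def by (auto simp: chr_add intro: continuous_intros)
qed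

lemma cont_periodic_add: "cont_periodic f \<Longrightarrow> cont_periodic g \<Longrightarrow> cont_periodic (\<lambda>x. f x + g x)"
  unfolding cont_periodic_def periodic_def by (auto intro: continuous_intros)

lemma cont_periodic_diff: "cont_periodic f \<Longrightarrow> cont_periodic g \<Longrightarrow> cont_periodic (\<lambda>x. f x - g x)"
  unfolding cont_periodic_def periodic_def by (auto intro: continuous_intros)

lemma cont_periodic_cmult: "cont_periodic f \<Longrightarrow> cont_periodic (\<lambda>x. c * f x)"
  unfolding cont_periodic_def periodic_def by (auto intro: continuous_intros)

lemma cont_periodic_shift: "cont_periodic f \<Longrightarrow> cont_periodic (\<lambda>x. f (x + h))"
  unfolding cont_periodic_def periodic_def
  by (auto intro!: continuous_on_compose2[of UNIV f] continuous_intros simp flip: add.assoc)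
     (metis add.assoc add.commute)

lemma cube_representative:
  obtains k :: "int ^ 'n::finite" where "x + freq k \<in> cbox 0 1"
proof
  show "x + freq (\<chi> i. - \<lfloor>x $ i\<rfloor>) \<in> cbox 0 1"
    by (simp add: mem_box_cart freq_def) linarith
qed

lemma cont_periodic_bounded:
  assumes "cont_periodic h" obtains B where "B \<ge> 0" "\<And>x. norm (h x) \<le> B"
proof -
  have "compact (h ` cbox 0 1)"
    using assms unfolding cont_periodic_def
    by (intro compact_continuous_image) (auto intro: continuous_on_subset)
  then obtain B where B: "\<And>x. x \<in> cbox 0 1 \<Longrightarrow> norm (h x) \<le> B"
    by (meson bounded_iff compact_imp_bounded imageI)
  show ?thesis
  proof
    show "norm (h x) \<le> max 0 B" for x
    proof -
      obtain k where "x + freq k \<in> cbox 0 1" by (rule cube_representative)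
      then show ?thesis
        using B[of "x + freq k"] assms periodic_shift_freq[of h x k]
        unfolding cont_periodic_def by auto
    qed
  qed simp
qed

inductive trig_poly :: "(real ^ 'n::finite \<Rightarrow> complex) \<Rightarrow> bool" where
  chr: "trig_poly (chr k)"
| add: "trig_poly p \<Longrightarrow> trig_poly q \<Longrightarrow> trig_poly (\<lambda>x. p x + q x)"
| cmult: "trig_poly p \<Longrightarrow> trig_poly (\<lambda>x. c * p x)"

lemma trig_poly_cont_periodic: "trig_poly p \<Longrightarrow> cont_periodic p"
  by (induction rule: trig_poly.induct)
     (auto intro: cont_periodic_chr cont_periodic_add cont_periodic_cmult)

lemma trig_poly_const: "trig_poly (\<lambda>x. c)"
  using trig_poly.cmult[OF trig_poly.chr[of 0], of c] by simp

lemma trig_poly_mult: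
  assumes "trig_poly p" "trig_poly q" shows "trig_poly (\<lambda>x. p x * q x)"
  using assms(1)
proof (induction rule: trig_poly.induct)
  case (chr k)
  show ?case using assms(2)
  proof (induction rule: trig_poly.induct)
    case (chr l)
    show ?case using trig_poly.chr[of "k + l"] by (simp add: chr_mult[abs_def])
  next
    case (add p q)
    then show ?case using trig_poly.add by (fastforce simp: distrib_left)
  next
    case (cmult p c)
    then show ?case using trig_poly.cmult[of _ c] by (fastforce simp: mult.left_commute)
  qed
next
  case (add p q)
  then show ?case using trig_poly.add by (fastforce simp: distrib_right)
next
  case (cmult p c)
  then show ?case using trig_poly.cmult[of _ c] by (fastforce simp: mult.assoc)
qed

lemma trig_poly_sum: "(\<And>i. i \<in> A \<Longrightarrow> trig_poly (p i)) \<Longrightarrow> trig_poly (\<lambda>x. \<Sum>i\<in>A. p i x)"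
proof (induction A rule: infinite_finite_induct)
  case (insert a A)
  then show ?case using trig_poly.add[of "p a"] by simp
qed (auto intro: trig_poly_const)

text \<open>
  The Weierstrass theorem needs a compact set on which continuous functions separate points; the
  cube does not serve, because periodic functions identify its faces.  This map sends the torus
  homeomorphically onto a compact subset of \<open>complex ^ 'n\<close>.
\<close>

definition torus_embed :: "real ^ 'n::finite \<Rightarrow> complex ^ 'n" where
  "torus_embed x = (\<chi> i. cis (2 * pi * x $ i))"

lemma continuous_on_torus_embed: "continuous_on S torus_embed"
  unfolding torus_embed_def cis_conv_exp
  by (intro continuous_intros)

lemma torus_embed_eq:
  fixes x y :: "real ^ 'n::finite"
  assumes "torus_embed x = torus_embed y" obtains k where "y = x + freq k"
proof -
  have "\<exists>n::int. y $ i = x $ i + of_int n" for i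
  proof -
    have "cis (2 * pi * (y $ i)) = cis (2 * pi * (x $ i))"
      using assms by (simp add: torus_embed_def vec_eq_iff)
    then have "sin (2 * pi * (y $ i)) = sin (2 * pi * (x $ i)) \<and>
        cos (2 * pi * (y $ i)) = cos (2 * pi * (x $ i))"
      by (simp add: cis.code)
    then obtain n :: int where "2 * pi * (y $ i) = 2 * pi * (x $ i) + 2 * pi * n"
      using sin_cos_eq_iff by auto
    then have "2 * pi * (y $ i) = 2 * pi * (x $ i + n)" by (simp add: algebra_simps)
    then show ?thesis by auto
  qed
  then obtain n :: "'n \<Rightarrow> int" where "\<And>i. y $ i = x $ i + of_int (n i)" by metis
  then have "y = x + freq (\<chi> i. n i)" by (simp add: freq_def vec_eq_iff)
  then show ?thesis using that by blast
qed

lemma trig_poly_torus_embed: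
  fixes p :: "complex ^ 'n::finite \<Rightarrow> real"
  assumes "real_polynomial_function p"
  shows "trig_poly (\<lambda>x. complex_of_real (p (torus_embed x)))"
  using assms
proof (induction rule: real_polynomial_function.induct)
  case (linear f)
  interpret bounded_linear f by fact
  have cos_sin: "trig_poly (\<lambda>x. complex_of_real (cos (2 * pi * x $ i)))"
    "trig_poly (\<lambda>x. complex_of_real (sin (2 * pi * x $ i)))" for i :: 'n
  proof -
    define k :: "int ^ 'n" where "k = axis i 1"
    have k: "chr k x = cis (2 * pi * x $ i)" "chr (- k) x = cis (- (2 * pi * x $ i))" for x
    proof -
      have *: "freq k = axis i 1" "freq (-k) = - axis i 1"
        by (auto simp: freq_def k_def axis_def vec_eq_iff)
      show "chr k x = cis (2 * pi * x $ i)" "chr (- k) x = cis (- (2 * pi * x $ i))"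
        unfolding chr_def * by (simp_all add: inner_axis' )
    qed
    have "trig_poly (\<lambda>x. 1/2 * chr k x + 1/2 * chr (-k) x)"
      "trig_poly (\<lambda>x. (-\<i>/2) * chr k x + (\<i>/2) * chr (-k) x)"
      by (intro trig_poly.add trig_poly.cmult trig_poly.chr)+
    moreover have "1/2 * chr k x + 1/2 * chr (-k) x = complex_of_real (cos (2 * pi * x $ i))"
      "(-\<i>/2) * chr k x + (\<i>/2) * chr (-k) x = complex_of_real (sin (2 * pi * x $ i))" for x
      by (simp_all add: k complex_eq_iff)
    ultimately show "trig_poly (\<lambda>x. complex_of_real (cos (2 * pi * x $ i)))"
      "trig_poly (\<lambda>x. complex_of_real (sin (2 * pi * x $ i)))" by simp_all
  qed
  have "complex_of_real (f (torus_embed x)) = (\<Sum>i\<in>UNIV.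
      complex_of_real (f (axis i 1)) * complex_of_real (cos (2 * pi * x $ i)) +
      complex_of_real (f (axis i \<i>)) * complex_of_real (sin (2 * pi * x $ i)))" for x
  proof -
    have "torus_embed x = (\<Sum>i\<in>UNIV. cos (2 * pi * x $ i) *\<^sub>R axis i 1 + sin (2 * pi * x $ i) *\<^sub>R axis i \<i>)"
      by (auto simp: torus_embed_def vec_eq_iff axis_def complex_eq_iff sum.delta if_distrib
          if_distribR cong: if_cong)
    then show ?thesis
      by (simp add: sum add scaleR mult.commute)
  qed
  then show ?case
    by (simp only:) (intro trig_poly_sum trig_poly.add trig_poly.cmult cos_sin)
qed (auto intro: trig_poly_const trig_poly.add trig_poly_mult)

text \<open>
  A periodic function descends to a function \<open>W\<close> on the embedded torus.  The graph of \<open>W\<close> is the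
  continuous image of the cube, hence closed, which makes \<open>W\<close> continuous.  A polynomial close to \<open>W\<close>
  pulls back to a trigonometric polynomial.
\<close>

theorem trig_poly_dense:
  assumes h: "cont_periodic h" and e: "e > 0"
  obtains p where "trig_poly p" "\<And>x. norm (h x - p x) < e"
proof -
  let ?Q = "cbox 0 1 :: (real ^ 'a) set"
  define K where "K = torus_embed ` ?Q"
  have ex: "\<exists>x. x \<in> ?Q \<and> torus_embed x = z" if "z \<in> K" for z
    using that K_def by auto
  define W where "W z = h (SOME x. x \<in> ?Q \<and> torus_embed x = z)" for z
  have W: "W (torus_embed x) = h x" if "x \<in> ?Q" for x
  proof -
    have "(SOME y. y \<in> ?Q \<and> torus_embed y = torus_embed x) \<in> ?Q \<and>
      torus_embed (SOME y. y \<in> ?Q \<and> torus_embed y = torus_embed x) = torus_embed x"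
      by (rule someI[of _ x]) (use that in auto)
    then show ?thesis unfolding W_def
      using torus_embed_eq h periodic_shift_freq unfolding cont_periodic_def by metis
  qed
  have ch: "continuous_on ?Q h"
    using h unfolding cont_periodic_def by (auto intro: continuous_on_subset)
  have cK: "compact K"
    unfolding K_def by (intro compact_continuous_image continuous_on_torus_embed compact_cbox)
  have cW: "continuous_on K W"
  proof (rule continuous_from_closed_graph)
    show "compact (h ` ?Q)" by (intro compact_continuous_image ch compact_cbox)
    show "W \<in> K \<rightarrow> h ` ?Q" using W by (auto simp: K_def)
    have "(\<lambda>z. (z, W z)) ` K = (\<lambda>x. (torus_embed x, h x)) ` ?Q"
      using W by (auto simp: K_def image_iff)
    moreover have "compact ((\<lambda>x. (torus_embed x, h x)) ` ?Q)"
      by (intro compact_continuous_image continuous_on_Pair continuous_on_torus_embed ch compact_cbox)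
    ultimately show "closed ((\<lambda>z. (z, W z)) ` K)" by (simp add: compact_imp_closed)
  qed
  from Stone_Weierstrass_polynomial_function[OF cK cW e]
  obtain g where g: "polynomial_function g" "\<And>z. z \<in> K \<Longrightarrow> norm (W z - g z) < e"
    by (elim exE conjE) simp
  have re: "real_polynomial_function (\<lambda>z. Re (g z))" "real_polynomial_function (\<lambda>z. Im (g z))"
    using g(1)[unfolded polynomial_function_def, rule_format, OF bounded_linear_Re]
      g(1)[unfolded polynomial_function_def, rule_format, OF bounded_linear_Im]
    by (simp_all add: o_def)
  define p where "p x = g (torus_embed x)" for x
  have pp: "p x = complex_of_real (Re (g (torus_embed x))) + \<i> * complex_of_real (Im (g (torus_embed x)))" for x
    by (simp add: p_def complex_eq_iff)
  have "trig_poly p"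
    unfolding pp[abs_def]
    by (intro trig_poly.add trig_poly.cmult trig_poly_torus_embed re)
  moreover have "norm (h x - p x) < e" for x
  proof -
    obtain k where k: "x + freq k \<in> ?Q" by (rule cube_representative)
    have "h x - p x = h (x + freq k) - p (x + freq k)"
      using h trig_poly_cont_periodic[OF \<open>trig_poly p\<close>] periodic_shift_freq
      unfolding cont_periodic_def by metis
    also have "\<dots> = W (torus_embed (x + freq k)) - g (torus_embed (x + freq k))"
      using W[OF k] by (simp add: p_def)
    finally show ?thesis using g(2) k K_def by auto
  qed
  ultimately show ?thesis using that by blast
qed

text \<open>
  Bounded linear functionals on continuous periodic functions with the supremum norm.  They are kept as
  predicates on plain functions, so that all operators below can be applied without coercions.
\<close>

definition bl_functional :: "((real ^ 'n::finite \<Rightarrow> complex) \<Rightarrow> complex) \<Rightarrow> bool" where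
  "bl_functional \<Lambda> \<longleftrightarrow>
     (\<forall>f g. cont_periodic f \<longrightarrow> cont_periodic g \<longrightarrow> \<Lambda> (\<lambda>x. f x + g x) = \<Lambda> f + \<Lambda> g) \<and>
     (\<forall>c f. cont_periodic f \<longrightarrow> \<Lambda> (\<lambda>x. c * f x) = c * \<Lambda> f) \<and>
     (\<exists>B\<ge>0. \<forall>f b. cont_periodic f \<longrightarrow> (\<forall>x. norm (f x) \<le> b) \<longrightarrow> norm (\<Lambda> f) \<le> B * b)"

lemma bl_functionalI:
  assumes "\<And>f g. cont_periodic f \<Longrightarrow> cont_periodic g \<Longrightarrow> \<Lambda> (\<lambda>x. f x + g x) = \<Lambda> f + \<Lambda> g"
    and "\<And>c f. cont_periodic f \<Longrightarrow> \<Lambda> (\<lambda>x. c * f x) = c * \<Lambda> f"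
    and "\<And>f b. cont_periodic f \<Longrightarrow> (\<And>x. norm (f x) \<le> b) \<Longrightarrow> b \<ge> 0 \<Longrightarrow> norm (\<Lambda> f) \<le> B * b"
    and "B \<ge> 0"
  shows "bl_functional \<Lambda>"
proof -
  have "norm (\<Lambda> f) \<le> B * b" if "cont_periodic f" "\<forall>x. norm (f x) \<le> b" for f b
    using assms(3)[OF that(1)] that(2) norm_ge_zero order_trans by blast
  then show ?thesis unfolding bl_functional_def using assms(1,2,4) by blast
qed

lemma bl_functional_add:
  "bl_functional \<Lambda> \<Longrightarrow> cont_periodic f \<Longrightarrow> cont_periodic g \<Longrightarrow> \<Lambda> (\<lambda>x. f x + g x) = \<Lambda> f + \<Lambda> g"
  unfolding bl_functional_def by blast

lemma bl_functional_cmult: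
  "bl_functional \<Lambda> \<Longrightarrow> cont_periodic f \<Longrightarrow> \<Lambda> (\<lambda>x. c * f x) = c * \<Lambda> f"
  unfolding bl_functional_def by blast

lemma bl_functional_diff:
  assumes "bl_functional \<Lambda>" "cont_periodic f" "cont_periodic g"
  shows "\<Lambda> (\<lambda>x. f x - g x) = \<Lambda> f - \<Lambda> g"
  using bl_functional_add[OF assms(1,2) cont_periodic_cmult[OF assms(3), of "-1"]]
    bl_functional_cmult[OF assms(1,3), of "-1"] by simp

lemma bl_functional_bound:
  assumes "bl_functional \<Lambda>"
  obtains B where "B \<ge> 0" "\<And>f b. cont_periodic f \<Longrightarrow> (\<And>x. norm (f x) \<le> b) \<Longrightarrow> norm (\<Lambda> f) \<le> B * b"
  using assms unfolding bl_functional_def by blast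

lemma bl_functional_minus:
  assumes "bl_functional \<Lambda>" "bl_functional \<Lambda>'"
  shows "bl_functional (\<lambda>f. \<Lambda> f - \<Lambda>' f)"
proof -
  obtain B where B: "B \<ge> 0" "\<And>f b. cont_periodic f \<Longrightarrow> (\<And>x. norm (f x) \<le> b) \<Longrightarrow> norm (\<Lambda> f) \<le> B * b"
    using bl_functional_bound[OF assms(1)] by blast
  obtain B' where B': "B' \<ge> 0" "\<And>f b. cont_periodic f \<Longrightarrow> (\<And>x. norm (f x) \<le> b) \<Longrightarrow> norm (\<Lambda>' f) \<le> B' * b"
    using bl_functional_bound[OF assms(2)] by blast
  show ?thesis
  proof (rule bl_functionalI[where B = "B + B'"])
    show "norm (\<Lambda> f - \<Lambda>' f) \<le> (B + B') * b" if "cont_periodic f" "\<And>x. norm (f x) \<le> b" for f b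
      using B(2)[OF that] B'(2)[OF that] norm_triangle_ineq4[of "\<Lambda> f" "\<Lambda>' f"]
      by (simp add: distrib_right)
  qed (use B B' bl_functional_add[OF assms(1)] bl_functional_add[OF assms(2)]
      bl_functional_cmult[OF assms(1)] bl_functional_cmult[OF assms(2)]
      in \<open>auto simp: algebra_simps\<close>)
qed

text \<open>
  This is the principle behind every operator identity of this development: by density of
  trigonometric polynomials a bounded functional is determined by its values on the characters.
\<close>

lemma bl_functional_eqI:
  assumes L: "bl_functional \<Lambda>" "bl_functional \<Lambda>'" and chr: "\<And>k. \<Lambda> (chr k) = \<Lambda>' (chr k)"
    and h: "cont_periodic h"
  shows "\<Lambda> h = \<Lambda>' h"
proof -
  let ?D = "\<lambda>f. \<Lambda> f - \<Lambda>' f"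
  have D: "bl_functional ?D" by (rule bl_functional_minus[OF L])
  have tp: "?D p = 0" if "trig_poly p" for p
    using that
  proof (induction rule: trig_poly.induct)
    case (add p q)
    then show ?case
      using bl_functional_add[OF D, of p q] by (simp add: trig_poly_cont_periodic)
  next
    case (cmult p c)
    then show ?case
      using bl_functional_cmult[OF D, of p c] by (simp add: trig_poly_cont_periodic)
  qed (simp add: chr)
  obtain B where B: "B \<ge> 0" "\<And>f b. cont_periodic f \<Longrightarrow> (\<And>x. norm (f x) \<le> b) \<Longrightarrow> norm (?D f) \<le> B * b"
    using bl_functional_bound[OF D] by blast
  have "norm (?D h) \<le> B * e" if "e > 0" for e
  proof -
    obtain p where p: "trig_poly p" "\<And>x. norm (h x - p x) < e"
      using trig_poly_dense[OF h \<open>e > 0\<close>] by metis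
    have cp: "cont_periodic p" by (rule trig_poly_cont_periodic[OF p(1)])
    have "?D (\<lambda>x. h x - p x) = ?D h"
      using bl_functional_diff[OF D h cp] tp[OF p(1)] by simp
    then show ?thesis
      using B(2)[OF cont_periodic_diff[OF h cp], of e] p(2) less_imp_le by metis
  qed
  note * = this
  have "norm (?D h) \<le> 0 + e" if "e > 0" for e
  proof -
    have "norm (?D h) \<le> B * (e / (B + 1))" by (rule *) (use B(1) that in auto)
    also have "\<dots> \<le> e" using B(1) that by (simp add: field_simps)
    finally show ?thesis by simp
  qed
  then have "norm (?D h) \<le> 0" by (rule field_le_epsilon)
  then show ?thesis by simp
qed

section \<open>Fourier coefficients\<close>

text \<open>
  The eigenvalue of \<open>-\<Delta>\<close> on the character \<open>chr k\<close>.
\<close>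

definition eig :: "int ^ 'n::finite \<Rightarrow> real" where
  "eig k = (2 * pi)\<^sup>2 * (norm (freq k))\<^sup>2"

definition fcoeff :: "(real ^ 'n::finite \<Rightarrow> complex) \<Rightarrow> int ^ 'n \<Rightarrow> complex" where
  "fcoeff h k = integral (cbox 0 1) (\<lambda>x. h x * chr (- k) x)"

lemma eig_nonneg [simp]: "eig k \<ge> 0"
  by (simp add: eig_def)

lemma eig_0 [simp]: "eig 0 = 0"
  by (simp add: eig_def)

lemma fourier_coeff_eq: "fourier_coeff v k = fcoeff (\<lambda>x. complex_of_real (v x)) k"
proof -
  have "freq (- k) = - freq k" by (simp add: freq_def vec_eq_iff)
  then show ?thesis
    unfolding fourier_coeff_def fcoeff_def chr_def cis_conv_exp
    by (simp add: algebra_simps)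
qed

lemma integrable_chr_mult:
  assumes "continuous_on (cbox 0 1) h"
  shows "(\<lambda>x. h x * chr k x) integrable_on cbox 0 1"
  by (intro integrable_continuous continuous_intros assms)

lemma integral_cis_period:
  fixes m :: int
  shows "(LINT t|lborel. indicator {0..1} t *\<^sub>R cis (2 * pi * m * t)) = (if m = 0 then 1 else 0)"
proof -
  have int: "set_integrable lborel {0..1} (\<lambda>t. cis (2 * pi * m * t))"
    unfolding cis_conv_exp by (intro borel_integrable_atLeastAtMost' continuous_intros)
  have eq: "(LINT t|lborel. indicator {0..1} t *\<^sub>R cis (2 * pi * m * t)) = integral {0..1} (\<lambda>t. cis (2 * pi * m * t))"
    using set_borel_integral_eq_integral(2)[OF int] by (simp add: set_lebesgue_integral_def)
  show ?thesis
  proof (cases "m = 0")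
    case False
    let ?F = "\<lambda>t. cis (2 * pi * m * t) / (2 * pi * m * \<i>)"
    have "((\<lambda>t. cis (2 * pi * m * t)) has_integral (?F 1 - ?F 0)) {0..1}"
    proof (rule fundamental_theorem_of_calculus)
      fix t :: real
      define c where "c = 2 * pi * m * \<i>"
      have c: "c \<noteq> 0" "cis (2 * pi * m * t) = exp (c * of_real t)" for t
        using False by (auto simp: c_def cis_conv_exp mult.commute mult.left_commute)
      have "((\<lambda>z. exp (c * z) / c) has_field_derivative exp (c * of_real t)) (at (of_real t))"
        using c(1) by (auto intro!: derivative_eq_intros)
      then have "((\<lambda>t. exp (c * of_real t) / c) has_vector_derivative exp (c * of_real t)) (at t within {0..1})"
        by (rule has_vector_derivative_real_field)
      then show "(?F has_vector_derivative cis (2 * pi * m * t)) (at t within {0..1})"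
        unfolding c c_def .
    qed simp
    moreover have "?F 1 - ?F 0 = 0"
      using cis_multiple_2pi[of "real_of_int m"] by simp
    ultimately show ?thesis using False eq by (simp add: integral_unique)
  qed (simp add: eq)
qed

text \<open>
  Orthogonality reduces to one dimension, since the character and the indicator of the cube are products
  over the coordinates and Lebesgue measure is a product measure.
\<close>

lemma integral_chr: "integral (cbox 0 1) (chr k) = (if k = 0 then 1 else 0)"
proof -
  let ?B = "Basis :: (real ^ 'a) set"
  interpret I: product_sigma_finite "\<lambda>b :: real ^ 'a. interval_measure (\<lambda>x. x)"
    by (rule product_sigma_finite.intro) (auto intro: sigma_finite_interval_measure)
  have one: "(1 :: real ^ 'a) \<bullet> b = 1" if "b \<in> ?B" for b
    using that by (auto simp: Basis_vec_def inner_axis)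
  have meas: "chr k \<in> borel_measurable borel"
    by (intro borel_measurable_continuous_onI continuous_intros)
  have int: "set_integrable lborel (cbox 0 1) (chr k)"
    unfolding set_integrable_def by (intro borel_integrable_compact continuous_intros) auto
  have "integral (cbox 0 1) (chr k) = (LINT x|lborel. indicator (cbox 0 1) x *\<^sub>R chr k x)"
    using set_borel_integral_eq_integral(2)[OF int] by (simp add: set_lebesgue_integral_def)
  also have "\<dots> = (LINT f|(\<Pi>\<^sub>M b\<in>?B. interval_measure (\<lambda>x. x)).
      indicator (cbox 0 1) (\<Sum>b\<in>?B. f b *\<^sub>R b) *\<^sub>R chr k (\<Sum>b\<in>?B. f b *\<^sub>R b))"
    unfolding lborel_def using meas by (subst integral_distr) auto
  also have "\<dots> = (LINT f|(\<Pi>\<^sub>M b\<in>?B. interval_measure (\<lambda>x. x)).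
      (\<Prod>b\<in>?B. indicator {0..1} (f b) *\<^sub>R cis (2 * pi * \<lfloor>freq k \<bullet> b\<rfloor> * f b)))"
  proof (rule Bochner_Integration.integral_cong[OF refl])
    fix f :: "real ^ 'a \<Rightarrow> real"
    have fl: "freq k \<bullet> b = \<lfloor>freq k \<bullet> b\<rfloor>" if "b \<in> ?B" for b
      using that by (auto simp: Basis_vec_def inner_axis freq_def)
    have "chr k (\<Sum>b\<in>?B. f b *\<^sub>R b) = cis (\<Sum>b\<in>?B. 2 * pi * \<lfloor>freq k \<bullet> b\<rfloor> * f b)"
      unfolding chr_def inner_sum_right sum_distrib_left
      by (intro arg_cong[where f = cis] sum.cong refl) (use fl in \<open>simp add: mult.commute mult.left_commute\<close>)
    also have "\<dots> = (\<Prod>b\<in>?B. cis (2 * pi * \<lfloor>freq k \<bullet> b\<rfloor> * f b))"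
      unfolding cis_conv_exp by (simp add: exp_sum sum_distrib_left)
    finally have c: "chr k (\<Sum>b\<in>?B. f b *\<^sub>R b) = (\<Prod>b\<in>?B. cis (2 * pi * \<lfloor>freq k \<bullet> b\<rfloor> * f b))" .
    have "(\<Sum>b\<in>?B. f b *\<^sub>R b) \<in> cbox 0 1 \<longleftrightarrow> (\<forall>b\<in>?B. f b \<in> {0..1})"
      by (simp add: mem_box one)
    then have "indicator (cbox 0 1) (\<Sum>b\<in>?B. f b *\<^sub>R b) = (\<Prod>b\<in>?B. indicator {0..1} (f b) :: real)"
      by (auto simp: indicator_def prod_zero_iff)
    then show "indicator (cbox 0 1) (\<Sum>b\<in>?B. f b *\<^sub>R b) *\<^sub>R chr k (\<Sum>b\<in>?B. f b *\<^sub>R b) =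
        (\<Prod>b\<in>?B. indicator {0..1} (f b) *\<^sub>R cis (2 * pi * \<lfloor>freq k \<bullet> b\<rfloor> * f b))"
      by (simp only: c scaleR_conv_of_real[where 'a = complex] prod.distrib of_real_prod)
  qed
  also have "\<dots> = (\<Prod>b\<in>?B. (LINT t|interval_measure (\<lambda>x. x). indicator {0..1} t *\<^sub>R cis (2 * pi * \<lfloor>freq k \<bullet> b\<rfloor> * t)))"
  proof (rule I.product_integral_prod)
    fix b :: "real ^ 'a"
    have "set_integrable lborel {0..1} (\<lambda>t. cis (2 * pi * \<lfloor>freq k \<bullet> b\<rfloor> * t))"
      unfolding cis_conv_exp by (intro borel_integrable_atLeastAtMost' continuous_intros)
    then show "integrable (interval_measure (\<lambda>x. x)) (\<lambda>t. indicator {0..1} t *\<^sub>R cis (2 * pi * \<lfloor>freq k \<bullet> b\<rfloor> * t))"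
      by (simp add: set_integrable_def lborel_eq_real)
  qed simp
  also have "\<dots> = (\<Prod>b\<in>?B. if \<lfloor>freq k \<bullet> b\<rfloor> = 0 then 1 else 0)"
    using integral_cis_period by (simp add: lborel_eq_real)
  also have "\<dots> = (if \<forall>b\<in>?B. \<lfloor>freq k \<bullet> b\<rfloor> = 0 then 1 else 0)"
    by (auto simp: prod_zero_iff intro: prod.neutral)
  also have "(\<forall>b\<in>?B. \<lfloor>freq k \<bullet> b\<rfloor> = 0) \<longleftrightarrow> k = 0"
    by (auto simp: Basis_vec_def inner_axis freq_def vec_eq_iff)
  finally show ?thesis .
qed

lemma fcoeff_chr: "fcoeff (chr j) k = (if j = k then 1 else 0)"
proof -
  have "(\<lambda>x. chr j x * chr (- k) x) = chr (j - k)"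
    using chr_mult[of j "-k"] by (simp add: fun_eq_iff)
  then show ?thesis by (simp add: fcoeff_def integral_chr)
qed

lemma cont_periodic_on_cube: "cont_periodic h \<Longrightarrow> continuous_on (cbox 0 1) h"
  unfolding cont_periodic_def by (auto intro: continuous_on_subset)

lemma content_unit_cube: "measure lborel (cbox 0 1 :: (real ^ 'n::finite) set) = 1"
  by (subst content_cbox_cart) (auto simp: interval_eq_empty_cart)

lemma norm_fcoeff_le:
  assumes "cont_periodic h" "\<And>x. norm (h x) \<le> b"
  shows "norm (fcoeff h k) \<le> b"
proof -
  have "norm (fcoeff h k) \<le> b * measure lborel (cbox 0 1 :: (real ^ 'a) set)"
    unfolding fcoeff_def
  proof (intro integrable_bound integrable_chr_mult cont_periodic_on_cube assms(1))
    show "0 \<le> b" using assms(2)[of 0] norm_ge_zero order_trans by blast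
  qed (simp add: norm_mult assms(2))
  then show ?thesis by (simp add: content_unit_cube)
qed

lemma fcoeff_add:
  assumes "cont_periodic f" "cont_periodic g"
  shows "fcoeff (\<lambda>x. f x + g x) k = fcoeff f k + fcoeff g k"
  unfolding fcoeff_def distrib_right
  by (intro Henstock_Kurzweil_Integration.integral_add integrable_chr_mult cont_periodic_on_cube assms)

lemma fcoeff_cmult: "fcoeff (\<lambda>x. c * f x) k = c * fcoeff f k"
  unfolding fcoeff_def mult.assoc by (rule integral_mult_right)

text \<open>
  Both sides are bounded functionals of \<open>h\<close> that agree on characters.  In particular no convergence of
  the Fourier series of \<open>h\<close> itself is needed.
\<close>

theorem bl_functional_series:
  assumes L: "bl_functional \<Lambda>" and sm: "(\<lambda>k. norm (\<Lambda> (chr k))) summable_on UNIV"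
    and h: "cont_periodic h"
  shows "\<Lambda> h = (\<Sum>\<^sub>\<infinity>k. fcoeff h k * \<Lambda> (chr k))"
proof (rule bl_functional_eqI[OF L _ _ h])
  have sb: "(\<lambda>k. norm (fcoeff f k * \<Lambda> (chr k))) summable_on UNIV"
    "norm (\<Sum>\<^sub>\<infinity>k. fcoeff f k * \<Lambda> (chr k)) \<le> infsum (\<lambda>k. norm (\<Lambda> (chr k))) UNIV * b"
    if f: "cont_periodic f" "\<And>x. norm (f x) \<le> b" for f b
  proof -
    have bb: "norm (fcoeff f k * \<Lambda> (chr k)) \<le> b * norm (\<Lambda> (chr k))" for k
      using norm_fcoeff_le[OF f, of k] by (simp add: norm_mult mult_right_mono)
    have s': "(\<lambda>k. b * norm (\<Lambda> (chr k))) summable_on UNIV"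
      using sm by (intro summable_on_cmult_right)
    show 1: "(\<lambda>k. norm (fcoeff f k * \<Lambda> (chr k))) summable_on UNIV"
      by (rule Infinite_Sum.abs_summable_on_comparison_test'[OF s']) (use bb in simp)
    have "norm (\<Sum>\<^sub>\<infinity>k. fcoeff f k * \<Lambda> (chr k)) \<le> (\<Sum>\<^sub>\<infinity>k. norm (fcoeff f k * \<Lambda> (chr k)))"
      using 1 by (rule norm_infsum_bound)
    also have "\<dots> \<le> (\<Sum>\<^sub>\<infinity>k. b * norm (\<Lambda> (chr k)))"
      by (rule infsum_mono[OF 1 s']) (use bb in simp)
    also have "\<dots> = infsum (\<lambda>k. norm (\<Lambda> (chr k))) UNIV * b"
      using infsum_cmult_right[of b "\<lambda>k. norm (\<Lambda> (chr k))" UNIV] sm by simp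
    finally show "norm (\<Sum>\<^sub>\<infinity>k. fcoeff f k * \<Lambda> (chr k)) \<le> infsum (\<lambda>k. norm (\<Lambda> (chr k))) UNIV * b" .
  qed
  have sb': "(\<lambda>k. fcoeff f k * \<Lambda> (chr k)) summable_on UNIV" if f: "cont_periodic f" for f
  proof -
    obtain B where B: "B \<ge> 0" "\<And>x. norm (f x) \<le> B" using cont_periodic_bounded[OF f] by blast
    show ?thesis by (rule abs_summable_summable[OF sb(1)[OF f B(2)]])
  qed
  show "bl_functional (\<lambda>h. \<Sum>\<^sub>\<infinity>k. fcoeff h k * \<Lambda> (chr k))"
  proof (rule bl_functionalI[OF _ _ sb(2)])
    show "0 \<le> infsum (\<lambda>k. norm (\<Lambda> (chr k))) UNIV" by (intro infsum_nonneg) simp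
  qed (auto simp: fcoeff_add fcoeff_cmult distrib_right mult.assoc infsum_add sb' infsum_cmult_right')
  show "\<Lambda> (chr j) = (\<Sum>\<^sub>\<infinity>k. fcoeff (chr j) k * \<Lambda> (chr k))" for j
  proof -
    have "(\<Sum>\<^sub>\<infinity>k. fcoeff (chr j) k * \<Lambda> (chr k)) = infsum (\<lambda>k. \<Lambda> (chr j)) {j}"
      by (rule infsum_cong_neutral) (auto simp: fcoeff_chr)
    then show ?thesis by simp
  qed
qed

text \<open>
  The mean square convergence controls each single Fourier coefficient: once the finite set of
  frequencies contains \<open>k\<close>, the \<open>k\<close>-th coefficient of the partial sum is exactly the right-hand side.
\<close>

lemma fcoeff_frac_laplacian:
  assumes v: "has_frac_laplacian s v g"
  shows "fourier_coeff g k = complex_of_real (eig k powr s) * fourier_coeff v k"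
proof -
  let ?Q = "cbox 0 1 :: (real ^ 'a) set"
  let ?S = "frac_laplacian_sum s v"
  let ?g = "\<lambda>x. complex_of_real (g x)"
  let ?c = "complex_of_real (eig k powr s) * fourier_coeff v k"
  define I where "I F = integral ?Q (\<lambda>x. (cmod (?S F x - complex_of_real (g x)))\<^sup>2)" for F
  have I0: "(I \<longlongrightarrow> 0) (finite_subsets_at_top UNIV)" and cg: "continuous_on ?Q g"
  proof -
    show "(I \<longlongrightarrow> 0) (finite_subsets_at_top UNIV)"
      using v unfolding has_frac_laplacian_def I_def[abs_def] by (elim conjE)
    have "continuous_on UNIV g"
      using v unfolding has_frac_laplacian_def by (elim conjE)
    then show "continuous_on ?Q g" by (rule continuous_on_subset) simp
  qed
  have S: "?S F x = (\<Sum>j\<in>F. complex_of_real (eig j powr s) * fourier_coeff v j * chr j x)" for F x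
  proof -
    have e: "exp (complex_of_real 2 * complex_of_real pi * \<i> * complex_of_real (freq j \<bullet> x)) = chr j x" for j
      by (simp add: chr_def cis_conv_exp mult.commute mult.left_commute)
    have m: "(2 * pi) powr (2 * s) * norm (freq j) powr (2 * s) = eig j powr s" for j :: "int ^ 'a"
    proof -
      have "y powr (2 * s) = (y\<^sup>2) powr s" if "y \<ge> 0" for y :: real
        using that powr_powr[of y 2 s] by (simp add: powr_numeral)
      then show ?thesis by (simp add: eig_def powr_mult)
    qed
    show ?thesis
      unfolding frac_laplacian_sum_def sum_distrib_left e m[symmetric] of_real_mult
      by (simp only: mult.assoc)
  qed
  have cS: "continuous_on ?Q (?S F)" for F
    unfolding S[abs_def] by (intro continuous_intros)
  have coeff: "fcoeff (?S F) k = ?c" if "finite F" "k \<in> F" for F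
  proof -
    have "fcoeff (?S F) k = (\<Sum>j\<in>F. complex_of_real (eig j powr s) * fourier_coeff v j * fcoeff (chr j) k)"
      unfolding S[abs_def] fcoeff_def sum_distrib_right
      by (subst Henstock_Kurzweil_Integration.integral_sum)
         (auto intro!: that integrable_continuous continuous_intros simp: mult.assoc)
    also have "\<dots> = (\<Sum>j\<in>F. if j = k then ?c else 0)"
      by (intro sum.cong) (auto simp: fcoeff_chr)
    also have "\<dots> = ?c" using that by simp
    finally show ?thesis .
  qed
  have bound: "norm (fourier_coeff g k - ?c) \<le> \<eta> / 2 + I F / (2 * \<eta>)"
    if F: "finite F" "k \<in> F" and \<eta>: "\<eta> > 0" for F \<eta>
  proof -
    have "?c - fourier_coeff g k = fcoeff (?S F) k - fcoeff ?g k"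
      by (simp add: coeff[OF F] fourier_coeff_eq)
    also have "\<dots> = integral ?Q (\<lambda>x. (?S F x - ?g x) * chr (- k) x)"
      unfolding fcoeff_def left_diff_distrib
      by (intro Henstock_Kurzweil_Integration.integral_diff[symmetric] integrable_chr_mult cS
          continuous_intros cg)
    also have "norm \<dots> \<le> integral ?Q (\<lambda>x. \<eta> / 2 + (cmod (?S F x - ?g x))\<^sup>2 / (2 * \<eta>))"
    proof (rule Henstock_Kurzweil_Integration.integral_norm_bound_integral)
      show "(\<lambda>x. (?S F x - ?g x) * chr (- k) x) integrable_on ?Q"
        by (intro integrable_chr_mult continuous_intros cS cg)
      show "(\<lambda>x. \<eta> / 2 + (cmod (?S F x - ?g x))\<^sup>2 / (2 * \<eta>)) integrable_on ?Q"
        by (intro integrable_continuous continuous_intros cS cg) (use \<eta> in simp)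
      fix x
      have "0 \<le> (\<eta> - cmod (?S F x - ?g x))\<^sup>2" by simp
      then show "norm ((?S F x - ?g x) * chr (- k) x) \<le> \<eta> / 2 + (cmod (?S F x - ?g x))\<^sup>2 / (2 * \<eta>)"
        unfolding norm_mult norm_chr using \<eta> by (simp add: field_simps power2_eq_square)
    qed
    also have "\<dots> = \<eta> / 2 + I F / (2 * \<eta>)"
    proof -
      have i: "(\<lambda>x. (cmod (?S F x - ?g x))\<^sup>2 / (2 * \<eta>)) integrable_on ?Q"
        by (intro integrable_continuous continuous_intros cS cg) (use \<eta> in simp)
      have "integral ?Q (\<lambda>x. (cmod (?S F x - ?g x))\<^sup>2 / (2 * \<eta>)) = I F / (2 * \<eta>)"
        unfolding I_def divide_inverse by (rule integral_mult_left)
      moreover have "integral ?Q (\<lambda>x. \<eta> / 2) = \<eta> / 2"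
        by (simp add: content_unit_cube)
      moreover have "(\<lambda>x. \<eta> / 2) integrable_on ?Q" by (rule integrable_const)
      ultimately show ?thesis
        using Henstock_Kurzweil_Integration.integral_add[OF _ i, of "\<lambda>x. \<eta> / 2"] by metis
    qed
    finally show ?thesis by (subst norm_minus_commute)
  qed
  have "norm (fourier_coeff g k - ?c) \<le> 0 + \<eta>" if \<eta>: "\<eta> > 0" for \<eta>
  proof -
    have "((\<lambda>F. \<eta> / 2 + I F / (2 * \<eta>)) \<longlongrightarrow> \<eta> / 2 + 0 / (2 * \<eta>)) (finite_subsets_at_top UNIV)"
      by (intro tendsto_intros I0) (use \<eta> in simp)
    moreover have "\<forall>\<^sub>F F in finite_subsets_at_top UNIV. norm (fourier_coeff g k - ?c) \<le> \<eta> / 2 + I F / (2 * \<eta>)"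
      unfolding eventually_finite_subsets_at_top using bound \<eta>
      by (intro exI[of _ "{k}"]) auto
    ultimately have "norm (fourier_coeff g k - ?c) \<le> \<eta> / 2 + 0 / (2 * \<eta>)"
      by (intro tendsto_lowerbound) auto
    then show ?thesis using \<eta> by simp
  qed
  then have "norm (fourier_coeff g k - ?c) \<le> 0" by (rule field_le_epsilon)
  then show ?thesis by simp
qed

text \<open>
  On finite sets the sum is dominated by a product of \<open>CARD('n)\<close> one-dimensional sums, each of which is bounded
  by two geometric series because \<open>m\<^sup>2 \<ge> |m|\<close>.
\<close>

lemma summable_exp_eig:
  assumes r: "r > 0"
  shows "(\<lambda>k :: int ^ 'n::finite. exp (- r * eig k)) summable_on UNIV"
proof (rule nonneg_bdd_above_summable_on)
  define c where "c = r * (2 * pi)\<^sup>2"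
  have c: "c > 0" using r by (simp add: c_def)
  define q where "q m = exp (- c * (real_of_int m)\<^sup>2)" for m :: int
  define S where "S = 2 / (1 - exp (- c))"
  have S0: "S \<ge> 0" using c by (simp add: S_def)
  have one: "(\<Sum>m\<in>{-int N..int N}. q m) \<le> S" for N
  proof -
    have ge: "(\<Sum>j\<le>N. exp (- c) ^ j) \<le> 1 / (1 - exp (- c))"
    proof -
      have "(\<Sum>j\<le>N. exp (- c) ^ j) \<le> (\<Sum>j. exp (- c) ^ j)"
        by (rule sum_le_suminf) (use c in \<open>auto intro: summable_geometric\<close>)
      also have "\<dots> = 1 / (1 - exp (- c))" by (rule suminf_geometric) (use c in simp)
      finally show ?thesis .
    qed
    have q: "q (int j) \<le> exp (- c) ^ j" "q (- int j) \<le> exp (- c) ^ j" for j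
    proof -
      have "real j \<le> (real j)\<^sup>2"
        by (cases j) (auto simp: power2_eq_square)
      then have "exp (- c * (real j)\<^sup>2) \<le> exp (real j * (- c))"
        using c by (simp add: mult.commute)
      then show "q (int j) \<le> exp (- c) ^ j" "q (- int j) \<le> exp (- c) ^ j"
        unfolding q_def exp_of_nat_mult[symmetric] by simp_all
    qed
    have eq: "{-int N..int N} = int ` {..N} \<union> (\<lambda>j. - int j) ` {..N}"
    proof (auto simp: image_iff)
      fix m assume "- int N \<le> m" "m \<le> int N" "\<forall>x\<in>{..N}. m \<noteq> - int x"
      then show "\<exists>x\<in>{..N}. m = int x"
        by (cases "m \<ge> 0") (auto intro!: bexI[of _ "nat m"] dest: bspec[of _ _ "nat (-m)"])
    qed
    have "(\<Sum>m\<in>{-int N..int N}. q m) \<le> (\<Sum>m\<in>int ` {..N}. q m) + (\<Sum>m\<in>(\<lambda>j. - int j) ` {..N}. q m)"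
      unfolding eq by (subst sum_Un) (auto simp: q_def intro!: sum_nonneg)
    also have "\<dots> = (\<Sum>j\<le>N. q (int j)) + (\<Sum>j\<le>N. q (- int j))"
      by (subst (1 2) sum.reindex) (auto simp: inj_on_def)
    also have "\<dots> \<le> (\<Sum>j\<le>N. exp (- c) ^ j) + (\<Sum>j\<le>N. exp (- c) ^ j)"
      by (intro add_mono sum_mono q)
    also have "\<dots> \<le> S" using ge by (simp add: S_def)
    finally show ?thesis .
  qed
  have ex: "exp (- r * eig k) = (\<Prod>i\<in>UNIV. q (k $ i))" for k :: "int ^ 'n"
  proof -
    have "eig k = (2 * pi)\<^sup>2 * (\<Sum>i\<in>UNIV. (real_of_int (k $ i))\<^sup>2)"
      unfolding eig_def norm_vec_def L2_set_def freq_def by (simp add: sum_nonneg)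
    then show ?thesis
      unfolding q_def by (simp add: c_def exp_sum[symmetric] sum_distrib_left mult.assoc sum_negf)
  qed
  have "(\<Sum>k\<in>F. exp (- r * eig k)) \<le> S ^ CARD('n)" if F: "finite F" for F :: "(int ^ 'n) set"
  proof -
    obtain N where N: "\<And>k i. k \<in> F \<Longrightarrow> \<bar>k $ i\<bar> \<le> int N"
    proof -
      define A where "A = (\<lambda>(k, i). nat \<bar>k $ i\<bar>) ` (F \<times> (UNIV :: 'n set))"
      have "finite A" using F by (simp add: A_def)
      have "\<bar>k $ i\<bar> \<le> int (Max A)" if "k \<in> F" for k i
      proof -
        have "nat \<bar>k $ i\<bar> \<in> A" unfolding A_def using that by force
        then show ?thesis using Max_ge[OF \<open>finite A\<close>] by fastforce
      qed
      then show ?thesis using that by blast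
    qed
    have inj: "inj_on (\<lambda>k. (\<lambda>i. k $ i)) F" by (auto simp: inj_on_def vec_eq_iff fun_eq_iff)
    have "(\<Sum>k\<in>F. exp (- r * eig k)) = (\<Sum>g\<in>(\<lambda>k. (\<lambda>i. k $ i)) ` F. \<Prod>i\<in>UNIV. q (g i))"
      by (subst sum.reindex[OF inj]) (simp only: o_def ex)
    also have "\<dots> \<le> (\<Sum>g\<in>PiE (UNIV :: 'n set) (\<lambda>_. {-int N..int N}). \<Prod>i\<in>UNIV. q (g i))"
    proof (rule sum_mono2)
      show "finite (PiE (UNIV :: 'n set) (\<lambda>_. {-int N..int N}))" by (intro finite_PiE) auto
      show "($) ` F \<subseteq> PiE UNIV (\<lambda>_. {-int N..int N})"
        using N by (auto simp: abs_le_iff) (metis minus_le_iff)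
      show "0 \<le> (\<Prod>i\<in>UNIV. q (g i))" for g by (auto simp: q_def intro!: prod_nonneg)
    qed
    also have "\<dots> = (\<Prod>i\<in>(UNIV :: 'n set). \<Sum>m\<in>{-int N..int N}. q m)"
      by (rule prod_sum_PiE[symmetric]) auto
    also have "\<dots> \<le> (\<Prod>i\<in>(UNIV :: 'n set). S)"
      by (intro prod_mono conjI one sum_nonneg) (simp add: q_def)
    finally show ?thesis by simp
  qed
  then show "bdd_above (sum (\<lambda>k :: int ^ 'n. exp (- r * eig k)) ` {F. F \<subseteq> UNIV \<and> finite F})"
    by (auto simp: bdd_above_def)
qed simp

lemma powr_exp_bound:
  fixes a r x :: real
  assumes r: "r > 0" and a: "0 \<le> a" "a \<le> 3" and x: "x \<ge> 0"
  shows "x powr a * exp (- r * x) \<le> (1 + 216 / r ^ 3) * exp (- (r / 2) * x)"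
proof -
  have "x powr a \<le> 1 + x ^ 3"
  proof (cases "x \<le> 1")
    case True
    then have "x powr a \<le> 1" using x a by (intro powr_le1) auto
    then show ?thesis using zero_le_power[OF x, of 3] by linarith
  next
    case False
    then have "x powr a \<le> x powr 3" using a by (intro powr_mono) auto
    then show ?thesis using False by simp
  qed
  moreover have "x ^ 3 * exp (- (r / 2) * x) \<le> 216 / r ^ 3"
  proof -
    define y where "y = r / 2 * x"
    have y: "y \<ge> 0" using r x by (simp add: y_def)
    have "(y / 3) ^ 3 \<le> exp (y / 3) ^ 3"
    proof (rule power_mono)
      show "y / 3 \<le> exp (y / 3)" using exp_ge_add_one_self[of "y / 3"] by linarith
    qed (use y in simp)
    also have "exp (y / 3) ^ 3 = exp y" by (simp flip: exp_of_nat_mult)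
    finally have "y ^ 3 * exp (- y) \<le> 27"
      by (simp add: exp_minus field_simps)
    moreover have "x ^ 3 * exp (- (r / 2) * x) = (8 / r ^ 3) * (y ^ 3 * exp (- y))"
      using r by (simp add: y_def power_mult_distrib power_divide)
    moreover have "(8 / r ^ 3) * (y ^ 3 * exp (- y)) \<le> (8 / r ^ 3) * 27"
      by (rule mult_left_mono) (use calculation r in auto)
    ultimately show ?thesis by simp
  qed
  moreover define e where "e = exp (- (r / 2) * x)"
  ultimately have p: "x powr a \<le> 1 + x ^ 3" and q: "x ^ 3 * e \<le> 216 / r ^ 3" by simp_all
  have e: "0 \<le> e" "e \<le> 1" using r x by (simp_all add: e_def)
  have "x powr a * e \<le> (1 + x ^ 3) * e" by (rule mult_right_mono[OF p e(1)])
  also have "\<dots> \<le> 1 + 216 / r ^ 3" using q e(2) by (simp add: distrib_right)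
  finally have "x powr a * e * e \<le> (1 + 216 / r ^ 3) * e" by (rule mult_right_mono[OF _ e(1)])
  moreover have "exp (- r * x) = e * e" unfolding e_def by (simp flip: exp_add)
  ultimately show ?thesis unfolding e_def[symmetric] by (simp only: mult.assoc)
qed

lemma summable_eig_powr_exp:
  assumes r: "r > 0" and a: "0 \<le> a" "a \<le> 3"
  shows "(\<lambda>k :: int ^ 'n::finite. eig k powr a * exp (- r * eig k)) summable_on UNIV"
proof (rule summable_on_comparison_test)
  show "(\<lambda>k :: int ^ 'n. (1 + 216 / r ^ 3) * exp (- (r / 2) * eig k)) summable_on UNIV"
    by (intro summable_on_cmult_right summable_exp_eig) (use r in simp)
  show "eig k powr a * exp (- r * eig k) \<le> (1 + 216 / r ^ 3) * exp (- (r / 2) * eig k)" for k :: "int ^ 'n"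
    by (rule powr_exp_bound[OF r a eig_nonneg])
qed simp

text \<open>
  If the symbols of two operators differ by the factor \<open>eig k powr s\<close>, then their values on \<open>z = (-\<Delta>)\<^sup>s u\<close> and on
  \<open>u\<close> agree.  Both subordination formulas for the fractional Laplacian are instances.  The Gaussian bound on the symbol of
  \<open>\<Lambda>\<^sub>1\<close> makes both Fourier series absolutely convergent, although that of \<open>z\<close> need not be.
\<close>

theorem bl_functional_transfer:
  assumes L: "bl_functional \<Lambda>\<^sub>1" "bl_functional \<Lambda>\<^sub>2"
    and r: "r > 0" and s: "0 \<le> s" "s \<le> 3"
    and L1: "\<And>k. norm (\<Lambda>\<^sub>1 (chr k)) \<le> C * exp (- r * eig k)"
    and L2: "\<And>k. \<Lambda>\<^sub>2 (chr k) = complex_of_real (eig k powr s) * \<Lambda>\<^sub>1 (chr k)"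
    and uz: "cont_periodic u" "cont_periodic z"
      "\<And>k. fcoeff z k = complex_of_real (eig k powr s) * fcoeff u k"
  shows "\<Lambda>\<^sub>1 z = \<Lambda>\<^sub>2 u"
proof -
  have s1: "(\<lambda>k. norm (\<Lambda>\<^sub>1 (chr k))) summable_on UNIV"
  proof (rule summable_on_comparison_test)
    show "(\<lambda>k. C * exp (- r * eig k)) summable_on UNIV"
      by (intro summable_on_cmult_right summable_exp_eig r)
    show "norm (\<Lambda>\<^sub>1 (chr k)) \<le> C * exp (- r * eig k)" for k by (rule L1)
  qed simp
  have s2: "(\<lambda>k. norm (\<Lambda>\<^sub>2 (chr k))) summable_on UNIV"
  proof (rule summable_on_comparison_test)
    show "(\<lambda>k. C * (eig k powr s * exp (- r * eig k))) summable_on UNIV"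
      by (intro summable_on_cmult_right summable_eig_powr_exp r s)
    fix k :: "int ^ 'a"
    have "norm (\<Lambda>\<^sub>2 (chr k)) \<le> eig k powr s * (C * exp (- r * eig k))"
      unfolding L2 norm_mult by (intro mult_mono L1) auto
    then show "norm (\<Lambda>\<^sub>2 (chr k)) \<le> C * (eig k powr s * exp (- r * eig k))"
      by (simp only: mult.left_commute)
  qed simp
  show ?thesis
    unfolding bl_functional_series[OF L(1) s1 uz(2)] bl_functional_series[OF L(2) s2 uz(1)] uz(3) L2
    by (intro infsum_cong) (simp only: mult.assoc mult.left_commute)
qed

section \<open>The standard Gaussian measure\<close>

lemma std_normal_density_le:
  assumes "k \<le> 1" "\<bar>z\<bar> \<ge> 1"
  shows "\<bar>z ^ k * std_normal_density z\<bar> \<le> 2 * norm (inverse z)"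
proof -
  have "sqrt (2 * pi) \<ge> 1" using pi_gt3 by simp
  then have "1 / sqrt (2 * pi) \<le> 1" by simp
  moreover have "exp (- z\<^sup>2 / 2) \<le> 2 / z\<^sup>2"
  proof -
    have "z\<^sup>2 / 2 \<le> exp (z\<^sup>2 / 2)" using exp_ge_add_one_self[of "z\<^sup>2 / 2"] by linarith
    moreover have "z \<noteq> 0" using assms(2) by auto
    ultimately show ?thesis by (simp add: exp_minus field_simps)
  qed
  ultimately have "std_normal_density z \<le> 1 * (2 / z\<^sup>2)"
    unfolding std_normal_density_def by (intro mult_mono) auto
  moreover have "\<bar>z\<bar> ^ k \<le> \<bar>z\<bar>"
    using power_increasing[OF assms] by simp
  ultimately have "\<bar>z\<bar> ^ k * std_normal_density z \<le> \<bar>z\<bar> * (2 / z\<^sup>2)"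
    by (intro mult_mono) auto
  also have "\<dots> = 2 * norm (inverse z)"
  proof -
    have z2: "z\<^sup>2 = \<bar>z\<bar> * \<bar>z\<bar>" by (simp add: power2_eq_square)
    have "z \<noteq> 0" using assms(2) by auto
    have "y * (2 / (y * y)) = 2 * inverse y" if "y \<noteq> 0" for y :: real
      using that by (simp add: field_simps)
    from this[of "\<bar>z\<bar>"] \<open>z \<noteq> 0\<close> show ?thesis
      unfolding z2 by (simp only: norm_inverse real_norm_def) simp
  qed
  finally show ?thesis by (simp add: abs_mult power_abs)
qed

lemma integrable_moment_cis:
  "integrable lborel (\<lambda>z. std_normal_density z *\<^sub>R (complex_of_real (z ^ k) * cis (a * z)))"
proof (rule Bochner_Integration.integrable_bound)
  show "integrable lborel (\<lambda>x. std_normal_density x * \<bar>x\<bar> ^ k)"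
    by (rule integrable_std_normal_moment_abs)
  show "(\<lambda>z. std_normal_density z *\<^sub>R (complex_of_real (z ^ k) * cis (a * z))) \<in> borel_measurable lborel"
    unfolding cis_conv_exp by measurable
qed (auto simp: norm_mult norm_power abs_mult power_abs)

text \<open>
  Integration by parts against the Gaussian: the integrand
  \<open>\<phi>(z) * z ^ k * exp (\<i> a z)\<close> vanishes at infinity, so its derivative has integral zero.
\<close>

lemma moment_recursion:
  fixes a :: real
  assumes k: "k \<le> 1"
  defines "J m \<equiv> (LINT z|lborel. std_normal_density z *\<^sub>R (complex_of_real (z ^ m) * cis (a * z)))"
  shows "J (Suc k) = of_nat k * J (k - 1) + \<i> * a * J k"
proof -
  let ?F = "\<lambda>z. std_normal_density z *\<^sub>R (complex_of_real (z ^ k) * cis (a * z))"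
  let ?f = "\<lambda>z. of_nat k * (std_normal_density z *\<^sub>R (complex_of_real (z ^ (k - 1)) * cis (a * z)))
      + \<i> * a * (std_normal_density z *\<^sub>R (complex_of_real (z ^ k) * cis (a * z)))
      - std_normal_density z *\<^sub>R (complex_of_real (z ^ Suc k) * cis (a * z))"
  have int: "integrable lborel ?f"
    by (intro Bochner_Integration.integrable_diff Bochner_Integration.integrable_add
        integrable_mult_right integrable_moment_cis)
  have tend: "(?F \<longlongrightarrow> 0) at_infinity"
  proof (rule Lim_null_comparison)
    have "((\<lambda>z::real. 2 * norm (inverse z)) \<longlongrightarrow> 2 * norm (0::real)) at_infinity"
      by (intro tendsto_intros tendsto_inverse_0)
    then show "((\<lambda>z::real. 2 * norm (inverse z)) \<longlongrightarrow> 0) at_infinity" by simp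
    show "\<forall>\<^sub>F z in at_infinity. norm (?F z) \<le> 2 * norm (inverse z)"
      unfolding eventually_at_infinity
    proof (intro exI[of _ 1] allI impI)
      fix z :: real assume "1 \<le> norm z"
      then show "norm (?F z) \<le> 2 * norm (inverse z)"
        using std_normal_density_le[OF k, of z] by (simp add: norm_mult norm_power abs_mult power_abs mult.commute)
    qed
  qed
  have dens: "(std_normal_density has_real_derivative (- z * std_normal_density z)) (at z)" for z
    unfolding std_normal_density_def by (auto intro!: derivative_eq_intros simp: field_simps)
  have "(LBINT z=-\<infinity>..\<infinity>. ?f z) = 0 - 0"
  proof (rule interval_integral_FTC_integrable)
    show "(?F has_vector_derivative ?f z) (at z)" for z
    proof -
      have "((\<lambda>w. w ^ k * exp (\<i> * (a * w))) has_field_derivative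
          (of_nat k * of_real z ^ (k - 1) * exp (\<i> * (a * of_real z)) + of_real z ^ k * (exp (\<i> * (a * of_real z)) * (\<i> * a)))) (at (of_real z))"
        by (auto intro!: derivative_eq_intros simp: algebra_simps)
      from has_vector_derivative_real_field[OF this, of UNIV]
      have "((\<lambda>w. complex_of_real w ^ k * exp (\<i> * (a * of_real w))) has_vector_derivative
          (of_nat k * of_real z ^ (k - 1) * exp (\<i> * (a * of_real z)) + of_real z ^ k * (exp (\<i> * (a * of_real z)) * (\<i> * a)))) (at z)"
        by simp
      note D = has_vector_derivative_scaleR[OF dens[of z] this]
      have F: "?F = (\<lambda>w. std_normal_density w *\<^sub>R (complex_of_real w ^ k * exp (\<i> * (a * of_real w))))"
        by (simp add: fun_eq_iff cis_conv_exp)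
      have f: "?f z = std_normal_density z *\<^sub>R
            (of_nat k * of_real z ^ (k - 1) * exp (\<i> * (a * of_real z)) +
              of_real z ^ k * (exp (\<i> * (a * of_real z)) * (\<i> * a))) +
          (- z * std_normal_density z) *\<^sub>R (complex_of_real z ^ k * exp (\<i> * (a * of_real z)))"
        by (simp add: cis_conv_exp scaleR_conv_of_real algebra_simps)
      show ?thesis unfolding F f by (rule D)
    qed
    show "isCont ?f z" for z
      unfolding cis_conv_exp std_normal_density_def by (intro continuous_intros) simp_all
    show "set_integrable lborel (einterval (-\<infinity>) \<infinity>) ?f"
      using int by (simp add: set_integrable_def einterval_def)
    show "((?F \<circ> real_of_ereal) \<longlongrightarrow> 0) (at_right (- \<infinity>))"
      unfolding ereal_tendsto_simps by (rule tendsto_mono[OF at_bot_le_at_infinity tend])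
    show "((?F \<circ> real_of_ereal) \<longlongrightarrow> 0) (at_left \<infinity>)"
      unfolding ereal_tendsto_simps by (rule tendsto_mono[OF at_top_le_at_infinity tend])
  qed simp
  then have "(LINT z|lborel. ?f z) = 0"
    by (simp add: interval_lebesgue_integral_def set_lebesgue_integral_def einterval_def)
  also have "(LINT z|lborel. ?f z) = of_nat k * J (k - 1) + \<i> * a * J k - J (Suc k)"
    unfolding J_def
    by (simp only: Bochner_Integration.integral_diff Bochner_Integration.integral_add
        Bochner_Integration.integrable_add integrable_mult_right integrable_moment_cis
        integral_mult_right_zero)
  finally show ?thesis by simp
qed

lemma std_normal_moments_cis:
  shows "(LINT z|std_normal_distribution. cis (a * z)) = exp (- (a\<^sup>2) / 2)" (is ?m0)
    and "(LINT z|std_normal_distribution. complex_of_real z * cis (a * z)) = \<i> * a * exp (- (a\<^sup>2) / 2)" (is ?m1)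
    and "(LINT z|std_normal_distribution. complex_of_real (z\<^sup>2) * cis (a * z)) = (1 - a\<^sup>2) * exp (- (a\<^sup>2) / 2)" (is ?m2)
    and "integrable std_normal_distribution (\<lambda>z. complex_of_real (z ^ k) * cis (a * z))"
proof -
  define J where "J m = (LINT z|lborel. std_normal_density z *\<^sub>R (complex_of_real (z ^ m) * cis (a * z)))" for m
  have J: "(LINT z|std_normal_distribution. complex_of_real (z ^ m) * cis (a * z)) = J m" for m
    unfolding J_def cis_conv_exp by (subst integral_density) auto
  have J0: "J 0 = exp (- (a\<^sup>2) / 2)"
    using fun_cong[OF char_std_normal_distribution, of a] J[of 0] unfolding char_def cis_conv_exp
    by simp
  have J1: "J (Suc 0) = \<i> * a * J 0" and J2: "J (Suc 1) = J 0 + \<i> * a * J 1"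
    using moment_recursion[of 0 a] moment_recursion[of 1 a] by (simp_all add: J_def)
  show ?m0 using J[of 0] J0 by simp
  show ?m1 using J[of 1] J0 J1 by simp
  show ?m2 using J[of 2] J0 J1 J2 by (simp add: numeral_2_eq_2 algebra_simps power2_eq_square)
  show "integrable std_normal_distribution (\<lambda>z. complex_of_real (z ^ k) * cis (a * z))"
    using integrable_moment_cis[of k a] unfolding cis_conv_exp by (subst integrable_density) auto
qed

definition gauss :: "(real ^ 'n::finite) measure" where
  "gauss = distr (\<Pi>\<^sub>M i\<in>UNIV. std_normal_distribution) borel (\<lambda>f. \<chi> i. f i)"

lemma measurable_vec_lambda_PiM:
  "(\<lambda>f. \<chi> i. f i) \<in> (\<Pi>\<^sub>M i\<in>(UNIV :: 'n::finite set). std_normal_distribution) \<rightarrow>\<^sub>M borel"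
proof (subst borel_measurable_euclidean_space, intro ballI)
  fix b :: "real ^ 'n" assume "b \<in> Basis"
  then obtain i where b: "b = axis i 1" by (auto simp: Basis_vec_def)
  have "(\<lambda>f. f i) \<in> (\<Pi>\<^sub>M i\<in>(UNIV :: 'n::finite set). std_normal_distribution) \<rightarrow>\<^sub>M std_normal_distribution"
    by (rule measurable_component_singleton) simp
  then show "(\<lambda>f. (\<chi> i. f i) \<bullet> b) \<in> borel_measurable (\<Pi>\<^sub>M i\<in>(UNIV :: 'n::finite set). std_normal_distribution)"
    by (simp add: b inner_axis)
qed

lemma sets_gauss [simp, measurable_cong]: "sets gauss = sets borel"
  by (simp add: gauss_def)

lemma space_gauss [simp]: "space gauss = UNIV"
  by (simp add: gauss_def)

lemma product_prob_std_normal: "product_prob_space (\<lambda>_ :: 'n. std_normal_distribution)"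
  using prob_space_normal_density[of 1 0]
  by (intro product_prob_spaceI) auto

lemma prob_space_gauss: "prob_space gauss"
proof -
  interpret product_prob_space "\<lambda>_ :: 'a. std_normal_distribution" UNIV
    by (rule product_prob_std_normal)
  show ?thesis unfolding gauss_def
    by (rule prob_space_distr) (rule measurable_vec_lambda_PiM)
qed

interpretation gauss: prob_space gauss
  by (rule prob_space_gauss)

lemma gauss_product:
  fixes g :: "'n::finite \<Rightarrow> real \<Rightarrow> complex"
  assumes "\<And>i. integrable std_normal_distribution (g i)"
  shows "integrable gauss (\<lambda>\<zeta>. \<Prod>i\<in>UNIV. g i (\<zeta> $ i))"
    and "(LINT \<zeta>|gauss. (\<Prod>i\<in>UNIV. g i (\<zeta> $ i))) = (\<Prod>i\<in>UNIV. (LINT z|std_normal_distribution. g i z))"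
proof -
  interpret product_prob_space "\<lambda>_ :: 'n. std_normal_distribution" UNIV
    by (rule product_prob_std_normal)
  have m: "g i \<in> borel_measurable borel" for i
    using assms[of i] by auto
  have [measurable]: "(\<lambda>\<zeta> :: real ^ 'n. \<zeta> $ i) \<in> borel_measurable borel" for i
    by (intro borel_measurable_continuous_onI continuous_intros)
  have mm: "(\<lambda>\<zeta> :: real ^ 'n. \<Prod>i\<in>UNIV. g i (\<zeta> $ i)) \<in> borel_measurable borel"
    using m by (intro borel_measurable_prod measurable_compose[OF _ m]) measurable
  show "integrable gauss (\<lambda>\<zeta>. \<Prod>i\<in>UNIV. g i (\<zeta> $ i))"
    unfolding gauss_def integrable_distr_eq[OF measurable_vec_lambda_PiM mm]
    using product_integrable_prod[of UNIV g] assms by simp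
  show "(LINT \<zeta>|gauss. (\<Prod>i\<in>UNIV. g i (\<zeta> $ i))) = (\<Prod>i\<in>UNIV. (LINT z|std_normal_distribution. g i z))"
    unfolding gauss_def integral_distr[OF measurable_vec_lambda_PiM mm]
    using product_integral_prod[of UNIV g] assms by simp
qed

lemma cis_inner: "cis (v \<bullet> \<zeta>) = (\<Prod>i\<in>UNIV. cis (v $ i * \<zeta> $ i))" for v \<zeta> :: "real ^ 'n::finite"
  unfolding inner_vec_def cis_conv_exp by (simp add: exp_sum sum_distrib_left)

lemma gauss_coordinate_moments:
  fixes v :: "real ^ 'n::finite"
  shows "(LINT \<zeta>|gauss. cis (v \<bullet> \<zeta>)) = exp (- (norm v)\<^sup>2 / 2)" (is ?m0)
    and "(LINT \<zeta>|gauss. complex_of_real (\<zeta> $ j) * cis (v \<bullet> \<zeta>)) = \<i> * v $ j * exp (- (norm v)\<^sup>2 / 2)" (is ?m1)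
    and "(LINT \<zeta>|gauss. complex_of_real ((\<zeta> $ j)\<^sup>2) * cis (v \<bullet> \<zeta>)) = (1 - (v $ j)\<^sup>2) * exp (- (norm v)\<^sup>2 / 2)" (is ?m2)
    and "integrable gauss (\<lambda>\<zeta>. complex_of_real ((\<zeta> $ j) ^ k) * cis (v \<bullet> \<zeta>))" (is ?i)
proof -
  define g where "g k i z = complex_of_real (z ^ (if i = j then k else 0)) * cis (v $ i * z)" for k and i :: 'n and z
  have int: "integrable std_normal_distribution (g k i)" for k i
    unfolding g_def by (rule std_normal_moments_cis)
  have eq: "complex_of_real ((\<zeta> $ j) ^ k) * cis (v \<bullet> \<zeta>) = (\<Prod>i\<in>UNIV. g k i (\<zeta> $ i))" for k \<zeta>
  proof -
    have "(\<Prod>i\<in>UNIV. complex_of_real (\<zeta> $ i ^ (if i = j then k else 0))) =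
        (\<Prod>i\<in>UNIV. if i = j then complex_of_real ((\<zeta> $ j) ^ k) else 1)"
      by (intro prod.cong) auto
    then show ?thesis unfolding g_def prod.distrib cis_inner by simp
  qed
  have nv: "complex_of_real (exp (- (norm v)\<^sup>2 / 2)) = (\<Prod>i\<in>UNIV. complex_of_real (exp (- (v $ i)\<^sup>2 / 2)))"
    unfolding norm_vec_def L2_set_def
    by (simp add: sum_nonneg exp_sum[symmetric] sum_negf sum_divide_distrib flip: of_real_prod)
  have val: "(LINT \<zeta>|gauss. complex_of_real ((\<zeta> $ j) ^ k) * cis (v \<bullet> \<zeta>)) = c * exp (- (norm v)\<^sup>2 / 2)"
    if "(LINT z|std_normal_distribution. g k j z) = c * exp (- (v $ j)\<^sup>2 / 2)" for k and c :: complex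
  proof -
    have "(LINT z|std_normal_distribution. g k i z) = (if i = j then c else 1) * exp (- (v $ i)\<^sup>2 / 2)" for i
      using that std_normal_moments_cis(1)[of "v $ i"] by (auto simp: g_def)
    note * = this
    show ?thesis
      unfolding eq gauss_product(2)[OF int] nv * prod.distrib by simp
  qed
  show ?m0 using val[of 0 1] std_normal_moments_cis(1)[of "v $ j"] by (simp add: g_def)
  show ?m1 using val[of 1 "\<i> * v $ j"] std_normal_moments_cis(2)[of "v $ j"] by (simp add: g_def)
  show ?m2 using val[of 2 "1 - (v $ j)\<^sup>2"] std_normal_moments_cis(3)[of "v $ j"] by (simp add: g_def)
  show ?i unfolding eq by (rule gauss_product(1)[OF int])
qed

lemma measurable_vec_nth_borel [measurable]: "(\<lambda>\<zeta> :: real ^ 'n::finite. \<zeta> $ i) \<in> borel_measurable borel"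
  by (intro borel_measurable_continuous_onI continuous_intros)

lemma integrable_gauss_coordinate_power: "integrable gauss (\<lambda>\<zeta>. (\<zeta> $ j) ^ k)"
proof -
  have "integrable gauss (\<lambda>\<zeta>. complex_of_real ((\<zeta> $ j) ^ k))"
    using gauss_coordinate_moments(4)[of j k 0] by simp
  then show ?thesis by (simp only: complex_of_real_integrable_eq)
qed

text \<open>
  Degree four suffices for all weights below: the weight of the heat Laplacian is quadratic and is multiplied
  with at most a second power of the norm.
\<close>

lemma integrable_gauss_polynomial_bound:
  assumes "W \<in> borel_measurable borel" "\<And>\<zeta>. \<bar>W \<zeta>\<bar> \<le> C * (1 + norm \<zeta> ^ 4)"
  shows "integrable gauss W"
proof (rule Bochner_Integration.integrable_bound)
  let ?g = "\<lambda>\<zeta> :: real ^ 'a. \<bar>C\<bar> * (1 + CARD('a) * (\<Sum>i\<in>UNIV. (\<zeta> $ i) ^ 4))"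
  show "integrable gauss ?g"
    by (intro integrable_mult_right Bochner_Integration.integrable_add Bochner_Integration.integrable_sum
        integrable_gauss_coordinate_power) auto
  have "norm (W \<zeta>) \<le> norm (?g \<zeta>)" for \<zeta>
  proof -
    have "norm \<zeta> ^ 4 = ((norm \<zeta>)\<^sup>2)\<^sup>2" by simp
    also have "(norm \<zeta>)\<^sup>2 = (\<Sum>i\<in>UNIV. (\<zeta> $ i)\<^sup>2)"
      unfolding norm_vec_def L2_set_def by (simp add: sum_nonneg)
    also have "\<dots>\<^sup>2 \<le> CARD('a) * (\<Sum>i\<in>UNIV. ((\<zeta> $ i)\<^sup>2)\<^sup>2)"
      using sum_squared_le_sum_of_squares[of "\<lambda>i. (\<zeta> $ i)\<^sup>2" "UNIV :: 'a set"] by (simp add: mult.commute)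
    also have "\<dots> = CARD('a) * (\<Sum>i\<in>UNIV. (\<zeta> $ i) ^ 4)" by simp
    finally have 4: "norm \<zeta> ^ 4 \<le> CARD('a) * (\<Sum>i\<in>UNIV. (\<zeta> $ i) ^ 4)" .
    have "norm (W \<zeta>) \<le> C * (1 + norm \<zeta> ^ 4)" using assms(2) by simp
    also have "\<dots> \<le> \<bar>C\<bar> * (1 + norm \<zeta> ^ 4)" by (intro mult_right_mono) auto
    also have "\<dots> \<le> ?g \<zeta>" using 4 by (intro mult_left_mono) auto
    also have "\<dots> \<le> norm (?g \<zeta>)" by simp
    finally show ?thesis .
  qed
  then show "AE \<zeta> in gauss. norm (W \<zeta>) \<le> norm (?g \<zeta>)" by simp
qed (use assms(1) in simp)

section \<open>Operators and integrals of functionals\<close>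

text \<open>
  For a function that is not integrable the left-hand side is zero, so only the dominating function has
  to be integrable.
\<close>

lemma norm_integral_le:
  fixes f :: "'a \<Rightarrow> 'b::{banach, second_countable_topology}"
  assumes "integrable M g" "\<And>x. x \<in> space M \<Longrightarrow> norm (f x) \<le> g x"
  shows "norm (LINT x|M. f x) \<le> (LINT x|M. g x)"
proof (cases "integrable M f")
  case True
  have "norm (LINT x|M. f x) \<le> (LINT x|M. norm (f x))" by (rule integral_norm_bound)
  also have "\<dots> \<le> (LINT x|M. g x)"
    by (rule Bochner_Integration.integral_mono) (use True assms in auto)
  finally show ?thesis .
next
  case False
  have "0 \<le> (LINT x|M. g x)"
    by (rule Bochner_Integration.integral_nonneg_AE) (use assms(2) norm_ge_zero order_trans in \<open>blast intro: AE_I2\<close>)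
  then show ?thesis using False by (simp add: not_integrable_integral_eq)
qed

lemma norm_set_integral_le:
  fixes f :: "'a \<Rightarrow> 'b::{banach, second_countable_topology}"
  assumes "set_integrable M S g" "\<And>x. x \<in> S \<Longrightarrow> norm (f x) \<le> g x"
  shows "norm (LINT x:S|M. f x) \<le> (LINT x:S|M. g x)"
  unfolding set_lebesgue_integral_def
  by (rule norm_integral_le) (use assms in \<open>auto simp: set_integrable_def indicator_def\<close>)

lemma set_integral_FTC:
  fixes F :: "real \<Rightarrow> complex"
  assumes "a \<le> b" "\<And>x. x \<in> {a..b} \<Longrightarrow> (F has_vector_derivative f x) (at x within {a..b})"
    and "continuous_on {a..b} f"
  shows "(LINT x:{a..b}|lborel. f x) = F b - F a"
  using set_borel_integral_eq_integral(2)[OF borel_integrable_atLeastAtMost'[OF assms(3)]]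
    integral_unique[OF fundamental_theorem_of_calculus[OF assms(1,2)]] by simp

definition bl_operator :: "((real ^ 'n::finite \<Rightarrow> complex) \<Rightarrow> real ^ 'n \<Rightarrow> complex) \<Rightarrow> bool" where
  "bl_operator A \<longleftrightarrow> (\<forall>h. cont_periodic h \<longrightarrow> cont_periodic (A h)) \<and>
     (\<forall>f g. cont_periodic f \<longrightarrow> cont_periodic g \<longrightarrow> A (\<lambda>x. f x + g x) = (\<lambda>x. A f x + A g x)) \<and>
     (\<forall>c f. cont_periodic f \<longrightarrow> A (\<lambda>x. c * f x) = (\<lambda>x. c * A f x)) \<and>
     (\<exists>B\<ge>0. \<forall>f b x. cont_periodic f \<longrightarrow> (\<forall>x. norm (f x) \<le> b) \<longrightarrow> norm (A f x) \<le> B * b)"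

lemma bl_operator_cont_periodic: "bl_operator A \<Longrightarrow> cont_periodic h \<Longrightarrow> cont_periodic (A h)"
  unfolding bl_operator_def by blast

lemma bl_functional_operator:
  assumes L: "bl_functional \<Lambda>" and A: "bl_operator A"
  shows "bl_functional (\<lambda>h. \<Lambda> (A h))"
proof -
  obtain B where B: "B \<ge> 0" "\<And>f b. cont_periodic f \<Longrightarrow> (\<And>x. norm (f x) \<le> b) \<Longrightarrow> norm (\<Lambda> f) \<le> B * b"
    using bl_functional_bound[OF L] by blast
  obtain B' where B': "B' \<ge> 0" "\<And>f b x. cont_periodic f \<Longrightarrow> (\<And>x. norm (f x) \<le> b) \<Longrightarrow> norm (A f x) \<le> B' * b"
    using A unfolding bl_operator_def by blast
  show ?thesis
  proof (rule bl_functionalI[where B = "B * B'"])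
    show "\<Lambda> (A (\<lambda>x. f x + g x)) = \<Lambda> (A f) + \<Lambda> (A g)" if "cont_periodic f" "cont_periodic g" for f g
      using that A bl_functional_add[OF L, of "A f" "A g"] unfolding bl_operator_def by simp
    show "\<Lambda> (A (\<lambda>x. c * f x)) = c * \<Lambda> (A f)" if "cont_periodic f" for c f
      using that A bl_functional_cmult[OF L, of "A f"] unfolding bl_operator_def by simp
    show "norm (\<Lambda> (A f)) \<le> B * B' * b" if f: "cont_periodic f" "\<And>x. norm (f x) \<le> b" for f b
      using B(2)[OF bl_operator_cont_periodic[OF A f(1)] B'(2)[OF f]] by (simp add: mult.assoc)
  qed (use B B' in simp)
qed

lemma bl_functional_eval: "bl_functional (\<lambda>h. h x)"
  by (rule bl_functionalI[where B = 1]) auto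

lemma bl_functional_apply: "bl_operator A \<Longrightarrow> bl_functional (\<lambda>h. A h x)"
  by (rule bl_functional_operator[OF bl_functional_eval])

lemma bl_operator_cmult:
  assumes A: "bl_operator A" shows "bl_operator (\<lambda>h x. c * A h x)"
proof -
  obtain B' where B': "B' \<ge> 0" "\<And>f b x. cont_periodic f \<Longrightarrow> (\<And>x. norm (f x) \<le> b) \<Longrightarrow> norm (A f x) \<le> B' * b"
    using A unfolding bl_operator_def by blast
  have "norm (c * A f x) \<le> (norm c * B') * b" if f: "cont_periodic f" "\<And>x. norm (f x) \<le> b" for f b x
    using B'(2)[OF f, of x] by (simp add: norm_mult mult_left_mono mult.assoc)
  then have "\<exists>B\<ge>0. \<forall>f b x. cont_periodic f \<longrightarrow> (\<forall>x. norm (f x) \<le> b) \<longrightarrow> norm (c * A f x) \<le> B * b"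
    using B'(1) by (intro exI[of _ "norm c * B'"]) simp
  then show ?thesis
    using A unfolding bl_operator_def
    by (elim conjE) (intro conjI allI impI, simp_all add: cont_periodic_cmult distrib_left mult.left_commute)
qed

lemma bl_functional_cmultI: "bl_functional \<Lambda> \<Longrightarrow> bl_functional (\<lambda>h. c * \<Lambda> h)"
proof -
  assume L: "bl_functional \<Lambda>"
  obtain B where B: "B \<ge> 0" "\<And>f b. cont_periodic f \<Longrightarrow> (\<And>x. norm (f x) \<le> b) \<Longrightarrow> norm (\<Lambda> f) \<le> B * b"
    using bl_functional_bound[OF L] by blast
  show ?thesis
  proof (rule bl_functionalI[where B = "norm c * B"])
    show "norm (c * \<Lambda> f) \<le> norm c * B * b" if f: "cont_periodic f" "\<And>x. norm (f x) \<le> b" for f b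
      using B(2)[OF f] by (simp add: norm_mult mult_left_mono mult.assoc)
  qed (use bl_functional_add[OF L] bl_functional_cmult[OF L] B(1)
      in \<open>simp_all add: distrib_left mult.left_commute\<close>)
qed

text \<open>
  Superpositions of functionals; this is how subordination integrals and heat integrals become
  accessible to the density principle.
\<close>

lemma bl_functional_set_integral:
  assumes S: "S \<in> sets M"
    and L: "\<And>\<sigma>. \<sigma> \<in> S \<Longrightarrow> bl_functional (\<Lambda> \<sigma>)"
    and B: "\<And>\<sigma> h b. \<sigma> \<in> S \<Longrightarrow> cont_periodic h \<Longrightarrow> (\<And>x. norm (h x) \<le> b) \<Longrightarrow> norm (\<Lambda> \<sigma> h) \<le> B \<sigma> * b"
    and int: "set_integrable M S B"
    and meas: "\<And>h. cont_periodic h \<Longrightarrow> (\<lambda>\<sigma>. \<Lambda> \<sigma> h) \<in> borel_measurable M"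
  shows "bl_functional (\<lambda>h. LINT \<sigma>:S|M. \<Lambda> \<sigma> h)"
proof -
  have ii: "set_integrable M S (\<lambda>\<sigma>. B \<sigma> * b)" for b
    using set_integrable_mult_left[of b M S B] int by blast
  have si: "set_integrable M S (\<lambda>\<sigma>. \<Lambda> \<sigma> h)" if h: "cont_periodic h" for h
  proof -
    obtain b where b: "\<And>x. norm (h x) \<le> b" using cont_periodic_bounded[OF h] by blast
    show ?thesis
    proof (rule set_integrable_bound[OF ii[of b]])
      show "set_borel_measurable M S (\<lambda>\<sigma>. \<Lambda> \<sigma> h)"
        unfolding set_borel_measurable_def using S meas[OF h] by measurable
      show "AE \<sigma> in M. \<sigma> \<in> S \<longrightarrow> norm (\<Lambda> \<sigma> h) \<le> norm (B \<sigma> * b)"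
        using B[OF _ h b] by (intro AE_I2 impI) (metis abs_ge_self order_trans real_norm_def)
    qed
  qed
  have cong: "(LINT \<sigma>:S|M. f \<sigma>) = (LINT \<sigma>:S|M. g \<sigma>)" if "\<And>\<sigma>. \<sigma> \<in> S \<Longrightarrow> f \<sigma> = g \<sigma>" for f g :: "'a \<Rightarrow> complex"
    unfolding set_lebesgue_integral_def using that
    by (intro Bochner_Integration.integral_cong) (auto simp: indicator_def)
  show ?thesis
  proof (rule bl_functionalI[where B = "\<bar>LINT \<sigma>:S|M. B \<sigma>\<bar>"])
    show "(LINT \<sigma>:S|M. \<Lambda> \<sigma> (\<lambda>x. f x + g x)) = (LINT \<sigma>:S|M. \<Lambda> \<sigma> f) + (LINT \<sigma>:S|M. \<Lambda> \<sigma> g)"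
      if "cont_periodic f" "cont_periodic g" for f g
      by (subst set_integral_add(2)[OF si si, OF that, symmetric])
         (rule cong, rule bl_functional_add[OF L that])
    show "(LINT \<sigma>:S|M. \<Lambda> \<sigma> (\<lambda>x. c * f x)) = c * (LINT \<sigma>:S|M. \<Lambda> \<sigma> f)"
      if "cont_periodic f" for c f
      by (subst set_integral_mult_right[symmetric]) (rule cong, rule bl_functional_cmult[OF L that])
    show "norm (LINT \<sigma>:S|M. \<Lambda> \<sigma> f) \<le> \<bar>LINT \<sigma>:S|M. B \<sigma>\<bar> * b"
      if f: "cont_periodic f" "\<And>x. norm (f x) \<le> b" and b: "b \<ge> 0" for f b
    proof -
      have "norm (LINT \<sigma>:S|M. \<Lambda> \<sigma> f) \<le> (LINT \<sigma>:S|M. B \<sigma> * b)"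
        by (rule norm_set_integral_le[OF ii B[OF _ f]])
      also have "\<dots> = (LINT \<sigma>:S|M. B \<sigma>) * b" by (rule set_integral_mult_left)
      also have "\<dots> \<le> \<bar>LINT \<sigma>:S|M. B \<sigma>\<bar> * b" using b by (intro mult_right_mono) auto
      finally show ?thesis .
    qed
  qed simp
qed

section \<open>Gaussian averages\<close>

text \<open>
  With weight \<open>1\<close> and \<open>c = sqrt (2 r)\<close> this is the heat semigroup at time \<open>r\<close>; its derivatives are obtained by
  polynomial weights, so that no kernel on the torus is needed.
\<close>

definition gauss_avg :: "(real ^ 'n::finite \<Rightarrow> real) \<Rightarrow> real \<Rightarrow> (real ^ 'n \<Rightarrow> complex) \<Rightarrow> real ^ 'n \<Rightarrow> complex" where
  "gauss_avg W c h x = (LINT \<zeta>|gauss. complex_of_real (W \<zeta>) * h (x + c *\<^sub>R \<zeta>))"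

lemma cont_periodic_measurable [measurable_dest]: "cont_periodic h \<Longrightarrow> h \<in> borel_measurable borel"
  unfolding cont_periodic_def by (blast intro: borel_measurable_continuous_onI)

lemma integrable_gauss_avg:
  assumes W: "integrable gauss W" and h: "cont_periodic h"
  shows "integrable gauss (\<lambda>\<zeta>. complex_of_real (W \<zeta>) * h (x + c *\<^sub>R \<zeta>))"
proof -
  obtain b where b: "\<And>x. norm (h x) \<le> b" using cont_periodic_bounded[OF h] by blast
  have [measurable]: "h \<in> borel_measurable borel" by (rule cont_periodic_measurable[OF h])
  have [measurable]: "W \<in> borel_measurable borel" using W by auto
  show ?thesis
  proof (rule Bochner_Integration.integrable_bound)
    show "integrable gauss (\<lambda>\<zeta>. \<bar>W \<zeta>\<bar> * b)" using W by auto
    have "norm (complex_of_real (W \<zeta>) * h (x + c *\<^sub>R \<zeta>)) \<le> norm (\<bar>W \<zeta>\<bar> * b)" for \<zeta>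
    proof -
      have "0 \<le> b" using b[of 0] norm_ge_zero order_trans by blast
      then show ?thesis using b[of "x + c *\<^sub>R \<zeta>"] by (simp add: norm_mult abs_mult mult_left_mono)
    qed
    then show "AE \<zeta> in gauss. norm (complex_of_real (W \<zeta>) * h (x + c *\<^sub>R \<zeta>)) \<le> norm (\<bar>W \<zeta>\<bar> * b)" by simp
  qed measurable
qed

lemma norm_gauss_avg_le:
  assumes W: "integrable gauss W" and b: "\<And>x. norm (h x) \<le> b"
  shows "norm (gauss_avg W c h x) \<le> (LINT \<zeta>|gauss. \<bar>W \<zeta>\<bar>) * b"
proof -
  have "norm (gauss_avg W c h x) \<le> (LINT \<zeta>|gauss. \<bar>W \<zeta>\<bar> * b)"
    unfolding gauss_avg_def
    by (rule norm_integral_le) (use W b in \<open>auto simp: norm_mult intro!: mult_left_mono\<close>)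
  then show ?thesis by simp
qed

lemma bl_operator_gauss_avg:
  assumes W: "integrable gauss W"
  shows "bl_operator (gauss_avg W c)"
  unfolding bl_operator_def
proof (intro conjI allI impI)
  note int = integrable_gauss_avg[OF W]
  show "cont_periodic (gauss_avg W c h)" if h: "cont_periodic h" for h
    unfolding cont_periodic_def
  proof
    show "periodic (gauss_avg W c h)"
      unfolding periodic_def gauss_avg_def
    proof (intro allI Bochner_Integration.integral_cong refl)
      fix x \<zeta> :: "real ^ 'a" and i
      have "h ((x + c *\<^sub>R \<zeta>) + axis i 1) = h (x + c *\<^sub>R \<zeta>)"
        using h unfolding cont_periodic_def periodic_def by blast
      then show "complex_of_real (W \<zeta>) * h (x + axis i 1 + c *\<^sub>R \<zeta>) =
          complex_of_real (W \<zeta>) * h (x + c *\<^sub>R \<zeta>)"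
        by (simp only: add.assoc add.commute[of "axis i 1"])
    qed
    have [measurable]: "h \<in> borel_measurable borel" by (rule cont_periodic_measurable[OF h])
    have [measurable]: "W \<in> borel_measurable borel" using W by auto
    obtain b where b: "\<And>x. norm (h x) \<le> b" using cont_periodic_bounded[OF h] by blast
    have "(\<lambda>n. gauss_avg W c h (X n)) \<longlonglongrightarrow> gauss_avg W c h x" if X: "X \<longlonglongrightarrow> x" for X x
      unfolding gauss_avg_def
    proof (rule integral_dominated_convergence)
      show "integrable gauss (\<lambda>\<zeta>. \<bar>W \<zeta>\<bar> * b)" using W by auto
      show "AE \<zeta> in gauss. (\<lambda>n. complex_of_real (W \<zeta>) * h (X n + c *\<^sub>R \<zeta>)) \<longlonglongrightarrow>
          complex_of_real (W \<zeta>) * h (x + c *\<^sub>R \<zeta>)"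
      proof (intro AE_I2 tendsto_mult tendsto_const)
        fix \<zeta>
        have "isCont h (x + c *\<^sub>R \<zeta>)"
          using h unfolding cont_periodic_def by (simp add: continuous_on_eq_continuous_at)
        then show "(\<lambda>n. h (X n + c *\<^sub>R \<zeta>)) \<longlonglongrightarrow> h (x + c *\<^sub>R \<zeta>)"
          by (rule isCont_tendsto_compose) (intro tendsto_intros X)
      qed
      show "AE \<zeta> in gauss. norm (complex_of_real (W \<zeta>) * h (X n + c *\<^sub>R \<zeta>)) \<le> \<bar>W \<zeta>\<bar> * b" for n
        by (auto simp: norm_mult intro!: mult_left_mono b)
    qed measurable
    then show "continuous_on UNIV (gauss_avg W c h)"
      by (auto simp: continuous_on_sequentially o_def)
  qed
  show "gauss_avg W c (\<lambda>x. f x + g x) = (\<lambda>x. gauss_avg W c f x + gauss_avg W c g x)"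
    if "cont_periodic f" "cont_periodic g" for f g
    unfolding gauss_avg_def distrib_left using int that by (simp add: Bochner_Integration.integral_add)
  show "gauss_avg W c (\<lambda>x. a * f x) = (\<lambda>x. a * gauss_avg W c f x)" for a f
    unfolding gauss_avg_def by (simp add: mult.left_commute)
  show "\<exists>B\<ge>0. \<forall>f b x. cont_periodic f \<longrightarrow> (\<forall>x. norm (f x) \<le> b) \<longrightarrow> norm (gauss_avg W c f x) \<le> B * b"
    using norm_gauss_avg_le[OF W] by (intro exI[of _ "LINT \<zeta>|gauss. \<bar>W \<zeta>\<bar>"]) simp
qed

lemma gauss_avg_chr:
  "gauss_avg W c (chr k) x = chr k x * (LINT \<zeta>|gauss. complex_of_real (W \<zeta>) * cis (((2 * pi * c) *\<^sub>R freq k) \<bullet> \<zeta>))"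
proof -
  have "chr k (c *\<^sub>R \<zeta>) = cis (((2 * pi * c) *\<^sub>R freq k) \<bullet> \<zeta>)" for \<zeta>
    by (simp add: chr_def mult.assoc)
  then show ?thesis
    unfolding gauss_avg_def chr_add by (simp only: mult.left_commute[of _ "chr k x"] integral_mult_right_zero)
qed

text \<open>
  A weight of mean zero allows subtracting \<open>h x\<close> inside the average, which gains the factor \<open>c powr \<beta>\<close>.
\<close>

lemma norm_gauss_avg_holder:
  assumes W: "integrable gauss W" "(LINT \<zeta>|gauss. W \<zeta>) = 0"
    and W\<beta>: "integrable gauss (\<lambda>\<zeta>. \<bar>W \<zeta>\<bar> * norm \<zeta> powr \<beta>)"
    and h: "cont_periodic h" "\<And>x y. norm (h x - h y) \<le> H * norm (x - y) powr \<beta>"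
    and c: "c \<ge> 0"
  shows "norm (gauss_avg W c h x) \<le> H * c powr \<beta> * (LINT \<zeta>|gauss. \<bar>W \<zeta>\<bar> * norm \<zeta> powr \<beta>)"
proof -
  
  have "gauss_avg W c h x = (LINT \<zeta>|gauss. complex_of_real (W \<zeta>) * (h (x + c *\<^sub>R \<zeta>) - h x))"
  proof -
    have "(LINT \<zeta>|gauss. complex_of_real (W \<zeta>) * h x) = 0" using W by simp
    then show ?thesis
      unfolding gauss_avg_def right_diff_distrib using integrable_gauss_avg[OF W(1) h(1)] W(1)
      by (subst Bochner_Integration.integral_diff) auto
  qed
  also have "norm \<dots> \<le> (LINT \<zeta>|gauss. H * c powr \<beta> * (\<bar>W \<zeta>\<bar> * norm \<zeta> powr \<beta>))"
  proof (rule norm_integral_le)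
    fix \<zeta> :: "real ^ 'a"
    have "norm (h (x + c *\<^sub>R \<zeta>) - h x) \<le> H * (c powr \<beta> * norm \<zeta> powr \<beta>)"
      using h(2)[of "x + c *\<^sub>R \<zeta>" x] c by (simp add: powr_mult)
    then have "\<bar>W \<zeta>\<bar> * norm (h (x + c *\<^sub>R \<zeta>) - h x) \<le> \<bar>W \<zeta>\<bar> * (H * (c powr \<beta> * norm \<zeta> powr \<beta>))"
      by (rule mult_left_mono) simp
    then show "norm (complex_of_real (W \<zeta>) * (h (x + c *\<^sub>R \<zeta>) - h x)) \<le> H * c powr \<beta> * (\<bar>W \<zeta>\<bar> * norm \<zeta> powr \<beta>)"
      by (simp only: norm_mult norm_of_real mult.assoc mult.left_commute)
  qed (use W\<beta> in simp)
  also have "\<dots> = H * c powr \<beta> * (LINT \<zeta>|gauss. \<bar>W \<zeta>\<bar> * norm \<zeta> powr \<beta>)" by simp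
  finally show ?thesis .
qed

lemma measurable_gauss_avg [measurable]:
  assumes [measurable]: "W \<in> borel_measurable borel" "f \<in> borel_measurable M" "g \<in> borel_measurable M"
    and h: "cont_periodic h"
  shows "(\<lambda>\<sigma>. gauss_avg W (f \<sigma>) h (g \<sigma>)) \<in> borel_measurable M"
proof -
  have [measurable]: "h \<in> borel_measurable borel" by (rule cont_periodic_measurable[OF h])
  show ?thesis unfolding gauss_avg_def by measurable
qed

section \<open>The heat semigroup\<close>

text \<open>
  The weight for which the Gaussian average represents \<open>-r \<Delta> G\<^sub>r\<close>: if \<open>p\<^sub>r\<close> is the heat kernel, it is the value of
  \<open>-r \<partial>\<^sub>r (log p\<^sub>r)\<close> at the point \<open>sqrt (2 r) *\<^sub>R \<zeta>\<close>.
\<close>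

definition lap_weight :: "real ^ 'n::finite \<Rightarrow> real" where
  "lap_weight \<zeta> = (CARD('n) - (norm \<zeta>)\<^sup>2) / 2"

definition heat :: "real \<Rightarrow> (real ^ 'n::finite \<Rightarrow> complex) \<Rightarrow> real ^ 'n \<Rightarrow> complex" where
  "heat r = gauss_avg (\<lambda>_. 1) (sqrt (2 * r))"

text \<open>
  \<open>-\<Delta> G\<^sub>r h\<close>, where \<open>G\<^sub>r\<close> is the heat semigroup.
\<close>

definition heat_lap :: "real \<Rightarrow> (real ^ 'n::finite \<Rightarrow> complex) \<Rightarrow> real ^ 'n \<Rightarrow> complex" where
  "heat_lap r h x = complex_of_real (1 / r) * gauss_avg lap_weight (sqrt (2 * r)) h x"

text \<open>
  The derivative of \<open>G\<^sub>r h\<close> in direction \<open>y\<close>.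
\<close>

definition heat_grad :: "real ^ 'n::finite \<Rightarrow> real \<Rightarrow> (real ^ 'n \<Rightarrow> complex) \<Rightarrow> real ^ 'n \<Rightarrow> complex" where
  "heat_grad y r h x = complex_of_real (1 / sqrt (2 * r)) * gauss_avg (\<lambda>\<zeta>. \<zeta> \<bullet> y) (sqrt (2 * r)) h x"

lemma lap_weight_measurable [measurable]: "lap_weight \<in> borel_measurable borel"
  unfolding lap_weight_def by measurable

lemma norm_sq_sum: "(norm \<zeta>)\<^sup>2 = (\<Sum>j\<in>UNIV. (\<zeta> $ j)\<^sup>2)" for \<zeta> :: "real ^ 'n::finite"
  unfolding norm_vec_def L2_set_def by (simp add: sum_nonneg)

lemma abs_lap_weight_le: "\<bar>lap_weight \<zeta>\<bar> \<le> CARD('n) * (1 + (norm \<zeta>)\<^sup>2)"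
  for \<zeta> :: "real ^ 'n::finite"
proof -
  have "\<bar>(d - q) / 2\<bar> \<le> d * (1 + q)" if d: "1 \<le> d" and q: "0 \<le> q" for d q :: real
  proof -
    have "q \<le> d * q" using mult_right_mono[OF d q] by simp
    then show ?thesis using d q by (simp add: distrib_left abs_le_iff)
  qed
  then show ?thesis unfolding lap_weight_def by (simp add: Suc_leI)
qed

text \<open>
  The range \<open>p \<le> 2\<close> covers Hoelder moduli (\<open>p = \<beta>\<close>) and second differences (\<open>p = 1 + \<alpha>\<close> and \<open>p = 2\<close>).
\<close>

lemma integrable_lap_weight_powr:
  assumes "0 \<le> p" "p \<le> 2"
  shows "integrable gauss (\<lambda>\<zeta> :: real ^ 'n::finite. \<bar>lap_weight \<zeta>\<bar> * norm \<zeta> powr p)"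
proof (rule integrable_gauss_polynomial_bound)
  fix \<zeta> :: "real ^ 'n"
  let ?d = "real CARD('n)"
  have p: "norm \<zeta> powr p \<le> 1 + (norm \<zeta>)\<^sup>2"
  proof (cases "norm \<zeta> \<le> 1")
    case True
    then have "norm \<zeta> powr p \<le> 1" using assms by (intro powr_le1) auto
    then show ?thesis using zero_le_power2[of "norm \<zeta>"] by linarith
  next
    case False
    then have "norm \<zeta> powr p \<le> norm \<zeta> powr 2" using assms by (intro powr_mono) auto
    then show ?thesis using False by simp
  qed
  have "\<bar>lap_weight \<zeta>\<bar> * norm \<zeta> powr p \<le> (?d * (1 + (norm \<zeta>)\<^sup>2)) * (1 + (norm \<zeta>)\<^sup>2)"
    by (intro mult_mono p abs_lap_weight_le) auto
  also have "\<dots> = ?d * (1 + (norm \<zeta>)\<^sup>2)\<^sup>2" by (simp add: power2_eq_square)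
  also have "\<dots> \<le> ?d * (2 * (1 + norm \<zeta> ^ 4))"
  proof (rule mult_left_mono)
    have "0 \<le> (1 - (norm \<zeta>)\<^sup>2)\<^sup>2" by simp
    then show "(1 + (norm \<zeta>)\<^sup>2)\<^sup>2 \<le> 2 * (1 + norm \<zeta> ^ 4)"
      by (simp add: power2_eq_square power4_eq_xxxx algebra_simps)
  qed simp
  finally show "\<bar>\<bar>lap_weight \<zeta>\<bar> * norm \<zeta> powr p\<bar> \<le> (2 * ?d) * (1 + norm \<zeta> ^ 4)" by (simp add: algebra_simps)
qed measurable

lemma integrable_lap_weight: "integrable gauss lap_weight"
proof (rule integrable_gauss_polynomial_bound)
  fix \<zeta> :: "real ^ 'a"
  have "1 + q \<le> 2 * (1 + q\<^sup>2)" for q :: real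
  proof -
    have a: "2 * q \<le> 1 + q\<^sup>2" using zero_le_power2[of "1 - q"] by (simp add: power2_diff)
    have b: "1 + q \<le> 2 * (1 + p)" if "2 * q \<le> 1 + p" "0 \<le> p" for p :: real
      using that by (simp add: algebra_simps)
    show ?thesis by (rule b[OF a zero_le_power2])
  qed
  from this[of "(norm \<zeta>)\<^sup>2"] have "1 + (norm \<zeta>)\<^sup>2 \<le> 2 * (1 + norm \<zeta> ^ 4)" by simp
  then have "real CARD('a) * (1 + (norm \<zeta>)\<^sup>2) \<le> CARD('a) * (2 * (1 + norm \<zeta> ^ 4))"
    by (rule mult_left_mono) simp
  also have "CARD('a) * (2 * (1 + norm \<zeta> ^ 4)) = (2 * CARD('a)) * (1 + norm \<zeta> ^ 4)"
    by (simp only: mult.assoc mult.left_commute)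
  finally show "\<bar>lap_weight \<zeta>\<bar> \<le> (2 * CARD('a)) * (1 + norm \<zeta> ^ 4)"
    by (rule order_trans[OF abs_lap_weight_le])
qed measurable

lemma integrable_inner: "integrable gauss (\<lambda>\<zeta>. \<zeta> \<bullet> y)" for y :: "real ^ 'n::finite"
proof -
  have "integrable gauss (\<lambda>\<zeta>. \<zeta> $ j)" for j :: 'n
    using integrable_gauss_coordinate_power[of j 1] by simp
  then show ?thesis unfolding inner_vec_def by auto
qed

lemma lap_weight_cis:
  "(LINT \<zeta>|gauss. complex_of_real (lap_weight \<zeta>) * cis (v \<bullet> \<zeta>)) = (norm v)\<^sup>2 / 2 * exp (- (norm v)\<^sup>2 / 2)"
  for v :: "real ^ 'n::finite"
proof -
  let ?E = "complex_of_real (exp (- (norm v)\<^sup>2 / 2))"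
  have i0: "integrable gauss (\<lambda>\<zeta>. cis (v \<bullet> \<zeta>))"
    using gauss_coordinate_moments(4)[of undefined 0 v] by simp
  have "(LINT \<zeta>|gauss. complex_of_real (lap_weight \<zeta>) * cis (v \<bullet> \<zeta>)) =
      (LINT \<zeta>|gauss. (CARD('n) / 2) * cis (v \<bullet> \<zeta>) - (1 / 2) * (\<Sum>j\<in>UNIV. complex_of_real ((\<zeta> $ j)\<^sup>2) * cis (v \<bullet> \<zeta>)))"
    by (intro Bochner_Integration.integral_cong refl)
       (simp add: lap_weight_def norm_sq_sum sum_distrib_right diff_divide_distrib left_diff_distrib)
  also have "\<dots> = (CARD('n) / 2) * ?E - (1 / 2) * (\<Sum>j\<in>UNIV. complex_of_real (1 - (v $ j)\<^sup>2) * ?E)"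
    by (simp only: Bochner_Integration.integral_diff Bochner_Integration.integrable_sum integrable_mult_right i0
        Bochner_Integration.integral_sum gauss_coordinate_moments integral_mult_right_zero of_real_mult)
  also have "(\<Sum>j\<in>UNIV. complex_of_real (1 - (v $ j)\<^sup>2) * ?E) = (CARD('n) - (norm v)\<^sup>2) * ?E"
  proof -
    have "(\<Sum>j\<in>UNIV. 1 - (v $ j)\<^sup>2) = CARD('n) - (norm v)\<^sup>2"
      by (simp add: norm_sq_sum sum_subtractf)
    then show ?thesis by (simp only: sum_distrib_right[symmetric] of_real_sum[symmetric])
  qed
  finally show ?thesis by (simp add: field_simps)
qed

lemma lap_weight_mean: "(LINT \<zeta>|gauss. lap_weight \<zeta>) = 0"
proof -
  have "(LINT \<zeta>|gauss. complex_of_real (lap_weight \<zeta>)) = 0" using lap_weight_cis[of 0] by simp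
  then show ?thesis by simp
qed

lemma inner_weight_cis:
  "(LINT \<zeta>|gauss. complex_of_real (\<zeta> \<bullet> y) * cis (v \<bullet> \<zeta>)) = \<i> * (v \<bullet> y) * exp (- (norm v)\<^sup>2 / 2)"
  for v :: "real ^ 'n::finite"
proof -
  have i: "integrable gauss (\<lambda>\<zeta>. complex_of_real (\<zeta> $ j) * cis (v \<bullet> \<zeta>))" for j
    using gauss_coordinate_moments(4)[of j 1 v] by simp
  have "(LINT \<zeta>|gauss. complex_of_real (\<zeta> \<bullet> y) * cis (v \<bullet> \<zeta>)) =
      (LINT \<zeta>|gauss. (\<Sum>j\<in>UNIV. (y $ j) * (complex_of_real (\<zeta> $ j) * cis (v \<bullet> \<zeta>))))"
  proof (intro Bochner_Integration.integral_cong refl)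
    fix \<zeta> :: "real ^ 'n"
    have "complex_of_real (\<zeta> \<bullet> y) = (\<Sum>j\<in>UNIV. complex_of_real (y $ j) * complex_of_real (\<zeta> $ j))"
      by (simp add: inner_vec_def mult.commute)
    then show "complex_of_real (\<zeta> \<bullet> y) * cis (v \<bullet> \<zeta>) =
        (\<Sum>j\<in>UNIV. (y $ j) * (complex_of_real (\<zeta> $ j) * cis (v \<bullet> \<zeta>)))"
      by (simp add: sum_distrib_right mult.assoc)
  qed
  also have "\<dots> = (\<Sum>j\<in>UNIV. (y $ j) * (\<i> * v $ j * exp (- (norm v)\<^sup>2 / 2)))"
    by (simp only: Bochner_Integration.integral_sum integrable_mult_right i
        gauss_coordinate_moments integral_mult_right_zero)
  also have "\<dots> = \<i> * (v \<bullet> y) * exp (- (norm v)\<^sup>2 / 2)"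
    by (simp add: inner_vec_def sum_distrib_left sum_distrib_right ac_simps)
  finally show ?thesis .
qed

lemma norm_symbol_vector:
  "r \<ge> 0 \<Longrightarrow> (norm ((2 * pi * sqrt (2 * r)) *\<^sub>R freq k))\<^sup>2 = 2 * r * eig k"
  by (simp add: eig_def power_mult_distrib)

lemma heat_chr: "r \<ge> 0 \<Longrightarrow> heat r (chr k) x = complex_of_real (exp (- r * eig k)) * chr k x"
  unfolding heat_def gauss_avg_chr
  using gauss_coordinate_moments(1)[of "(2 * pi * sqrt (2 * r)) *\<^sub>R freq k"] norm_symbol_vector[of r k]
  by (simp add: mult.commute del: norm_scaleR inner_scaleR_left)

lemma heat_lap_chr: "r > 0 \<Longrightarrow> heat_lap r (chr k) x = complex_of_real (eig k * exp (- r * eig k)) * chr k x"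
  unfolding heat_lap_def gauss_avg_chr lap_weight_cis
  using norm_symbol_vector[of r k]
  by (simp add: mult.commute del: norm_scaleR inner_scaleR_left)

lemma heat_grad_chr:
  assumes "r > 0"
  shows "heat_grad y r (chr k) x = complex_of_real (exp (- r * eig k)) * (\<i> * complex_of_real (2 * pi * (freq k \<bullet> y)) * chr k x)"
proof -
  have "sqrt (2 * r) \<noteq> 0" using assms by simp
  then show ?thesis
    unfolding heat_grad_def gauss_avg_chr inner_weight_cis
    using norm_symbol_vector[of r k] assms
    by (simp add: field_simps del: norm_scaleR)
qed

lemma bl_operator_heat: "bl_operator (heat r)"
  unfolding heat_def by (rule bl_operator_gauss_avg) simp

lemma bl_operator_heat_lap: "bl_operator (heat_lap r)"
  unfolding heat_lap_def[abs_def] by (intro bl_operator_cmult bl_operator_gauss_avg integrable_lap_weight)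

lemma bl_operator_heat_grad: "bl_operator (heat_grad y r)"
  unfolding heat_grad_def[abs_def] by (intro bl_operator_cmult bl_operator_gauss_avg integrable_inner)

lemmas cont_periodic_heat_lap = bl_operator_cont_periodic[OF bl_operator_heat_lap]

lemma bl_operator_chr_mult:
  assumes "bl_operator A" "\<And>x. A' (chr k) x = c * chr k x"
  shows "A (A' (chr k)) x = c * A (chr k) x"
proof -
  have "A' (chr k) = (\<lambda>x. c * chr k x)" using assms(2) by auto
  then show ?thesis
    using bl_functional_cmult[OF bl_functional_apply[OF assms(1)] cont_periodic_chr] by simp
qed

lemma heat_heat_lap:
  assumes "a \<ge> 0" "b > 0" "cont_periodic h"
  shows "heat a (heat_lap b h) x = heat_lap (a + b) h x"
proof (rule bl_functional_eqI[OF _ _ _ assms(3)])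
  show "bl_functional (\<lambda>h. heat a (heat_lap b h) x)"
    by (rule bl_functional_operator[OF bl_functional_apply[OF bl_operator_heat] bl_operator_heat_lap])
  show "bl_functional (\<lambda>h. heat_lap (a + b) h x)"
    by (rule bl_functional_apply[OF bl_operator_heat_lap])
  show "heat a (heat_lap b (chr k)) x = heat_lap (a + b) (chr k) x" for k
  proof -
    have "heat a (heat_lap b (chr k)) x = complex_of_real (eig k * exp (- b * eig k)) * heat a (chr k) x"
      by (rule bl_operator_chr_mult[OF bl_operator_heat], rule heat_lap_chr, fact)
    then show ?thesis using assms(1,2) by (simp add: heat_chr heat_lap_chr distrib_right exp_add exp_diff exp_minus field_simps)
  qed
qed

text \<open>
  Only the total time matters.  The individual times can therefore be chosen as each estimate requires.
\<close>

lemma heat_lap_heat_lap: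
  assumes "a > 0" "b > 0" "a' > 0" "b' > 0" "a + b = a' + b'" "cont_periodic h"
  shows "heat_lap a (heat_lap b h) x = heat_lap a' (heat_lap b' h) x"
proof (rule bl_functional_eqI[OF _ _ _ assms(6)])
  show "bl_functional (\<lambda>h. heat_lap a (heat_lap b h) x)" for a b
    by (rule bl_functional_operator[OF bl_functional_apply[OF bl_operator_heat_lap] bl_operator_heat_lap])
  then show "bl_functional (\<lambda>h. heat_lap a' (heat_lap b' h) x)" .
  have "heat_lap a (heat_lap b (chr k)) x = complex_of_real ((eig k)\<^sup>2 * exp (- (a + b) * eig k)) * chr k x"
    if "a > 0" "b > 0" for k a b
  proof -
    have "heat_lap a (heat_lap b (chr k)) x = complex_of_real (eig k * exp (- b * eig k)) * heat_lap a (chr k) x"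
      by (rule bl_operator_chr_mult[OF bl_operator_heat_lap], rule heat_lap_chr, fact)
    then show ?thesis using that
      by (simp add: heat_lap_chr distrib_right exp_add exp_diff exp_minus power2_eq_square field_simps)
  qed
  then show "heat_lap a (heat_lap b (chr k)) x = heat_lap a' (heat_lap b' (chr k)) x" for k
    using assms(1-5) by simp
qed

lemma norm_heat_le: "(\<And>x. norm (h x) \<le> b) \<Longrightarrow> norm (heat r h x) \<le> b"
  using norm_gauss_avg_le[of "\<lambda>_. 1" h b "sqrt (2 * r)" x] by (simp add: heat_def gauss.prob_space[unfolded space_gauss])

lemma norm_heat_lap: "r > 0 \<Longrightarrow> norm (heat_lap r h x) = norm (gauss_avg lap_weight (sqrt (2 * r)) h x) / r"
  by (simp add: heat_lap_def norm_mult norm_divide)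

lemma heat_lap_bound:
  "\<exists>C\<ge>0. \<forall>r>0. \<forall>(h :: real ^ 'n::finite \<Rightarrow> complex) b x. (\<forall>x. norm (h x) \<le> b) \<longrightarrow> norm (heat_lap r h x) \<le> C / r * b"
proof (intro exI conjI allI impI)
  let ?C = "LINT \<zeta>|(gauss :: (real ^ 'n) measure). \<bar>lap_weight \<zeta>\<bar>"
  show "?C \<ge> 0" by simp
  fix r :: real and h :: "real ^ 'n \<Rightarrow> complex" and b x
  assume "r > 0" "\<forall>x. norm (h x) \<le> b"
  then show "norm (heat_lap r h x) \<le> ?C / r * b"
    using norm_gauss_avg_le[OF integrable_lap_weight, of h b "sqrt (2 * r)" x]
    by (simp add: norm_heat_lap divide_right_mono)
qed

text \<open>
  One half of the description of \<open>C\<^sup>\<beta>\<close> by heat decay.  The other half is \<open>holder_from_heat_decay\<close>.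
\<close>

lemma heat_lap_holder_bound:
  assumes "0 \<le> \<beta>" "\<beta> \<le> 2"
  shows "\<exists>C\<ge>0. \<forall>r>0. \<forall>(h :: real ^ 'n::finite \<Rightarrow> complex) H x. cont_periodic h \<longrightarrow>
    (\<forall>x y. norm (h x - h y) \<le> H * norm (x - y) powr \<beta>) \<longrightarrow>
    norm (heat_lap r h x) \<le> C * H * r powr (\<beta> / 2 - 1)"
proof (intro exI conjI allI impI)
  let ?I = "LINT \<zeta>|(gauss :: (real ^ 'n) measure). \<bar>lap_weight \<zeta>\<bar> * norm \<zeta> powr \<beta>"
  let ?C = "2 powr (\<beta> / 2) * ?I"
  show "?C \<ge> 0" by simp
  fix r :: real and h :: "real ^ 'n \<Rightarrow> complex" and H x
  assume r: "r > 0" and h: "cont_periodic h" "\<forall>x y. norm (h x - h y) \<le> H * norm (x - y) powr \<beta>"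
  have "norm (gauss_avg lap_weight (sqrt (2 * r)) h x) \<le> H * sqrt (2 * r) powr \<beta> * ?I"
    by (rule norm_gauss_avg_holder[OF integrable_lap_weight lap_weight_mean])
       (use integrable_lap_weight_powr assms h r in auto)
  then have "norm (heat_lap r h x) \<le> (1 / r) * (H * sqrt (2 * r) powr \<beta> * ?I)"
    using r by (simp add: norm_heat_lap divide_right_mono)
  also have "sqrt (2 * r) powr \<beta> = 2 powr (\<beta> / 2) * r powr (\<beta> / 2)"
  proof -
    have "(2 * r) powr (1 / 2) = sqrt (2 * r)" by (rule powr_half_sqrt) (use r in simp)
    then have "sqrt (2 * r) powr \<beta> = (2 * r) powr (\<beta> / 2)" using powr_powr[of "2 * r" "1/2" \<beta>] by simp
    then show ?thesis using r by (simp add: powr_mult)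
  qed
  also have "r powr (\<beta> / 2) = r * r powr (\<beta> / 2 - 1)"
    using r by (simp add: powr_diff)
  finally show "norm (heat_lap r h x) \<le> ?C * H * r powr (\<beta> / 2 - 1)"
    using r by (simp add: mult.assoc mult.commute mult.left_commute)
qed

lemma measurable_heat_lap:
  assumes h: "cont_periodic h" and [measurable]: "f \<in> borel_measurable M" "g \<in> borel_measurable M"
  shows "(\<lambda>\<sigma>. heat_lap (f \<sigma>) h (g \<sigma>)) \<in> borel_measurable M"
  unfolding heat_lap_def using h by measurable

lemma measurable_heat:
  assumes h: "cont_periodic h" and [measurable]: "f \<in> borel_measurable M" "g \<in> borel_measurable M"
  shows "(\<lambda>\<sigma>. heat (f \<sigma>) h (g \<sigma>)) \<in> borel_measurable M"
  unfolding heat_def using h by measurable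

lemma measurable_heat_grad:
  assumes h: "cont_periodic h" and [measurable]: "f \<in> borel_measurable M" "g \<in> borel_measurable M"
  shows "(\<lambda>\<sigma>. heat_grad y (f \<sigma>) h (g \<sigma>)) \<in> borel_measurable M"
  unfolding heat_grad_def using h by measurable

text \<open>
  The integrated heat equation \<open>\<partial>\<^sub>r G\<^sub>r = \<Delta> G\<^sub>r\<close>.
\<close>

lemma heat_difference:
  fixes h :: "real ^ 'n::finite \<Rightarrow> complex"
  assumes a: "0 < a" "a \<le> r" and h: "cont_periodic h"
  shows "heat a h x - heat r h x = (LINT \<rho>:{a..r}|lborel. heat_lap \<rho> h x)"
proof (rule bl_functional_eqI[OF _ _ _ h])
  show "bl_functional (\<lambda>h. heat a h x - heat r h x)"
    by (intro bl_functional_minus bl_functional_apply bl_operator_heat)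
  obtain C where C: "C \<ge> 0" "\<And>r (h :: real ^ 'n \<Rightarrow> complex) b x. r > 0 \<Longrightarrow> (\<And>x. norm (h x) \<le> b) \<Longrightarrow> norm (heat_lap r h x) \<le> C / r * b"
    using heat_lap_bound[where 'n = 'n] by blast
  show "bl_functional (\<lambda>h. LINT \<rho>:{a..r}|lborel. heat_lap \<rho> h x)"
  proof (rule bl_functional_set_integral[where B = "\<lambda>\<rho>. C / \<rho>"])
    show "set_integrable lborel {a..r} (\<lambda>\<rho>. C / \<rho>)"
      using a by (intro borel_integrable_atLeastAtMost' continuous_intros) auto
    show "(\<lambda>\<sigma>. heat_lap \<sigma> h x) \<in> borel_measurable lborel" if "cont_periodic h" for h
      by (rule measurable_heat_lap[OF that]) auto
  qed (use C a in \<open>auto intro: bl_functional_apply bl_operator_heat_lap\<close>)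
  fix k :: "int ^ 'n"
  have "(LINT \<rho>:{a..r}|lborel. heat_lap \<rho> (chr k) x) =
      (LINT \<rho>:{a..r}|lborel. complex_of_real (eig k * exp (- \<rho> * eig k)) * chr k x)"
    by (rule set_lebesgue_integral_cong) (use a in \<open>auto simp: heat_lap_chr\<close>)
  also have "\<dots> = - complex_of_real (exp (- r * eig k)) * chr k x - - complex_of_real (exp (- a * eig k)) * chr k x"
  proof (rule set_integral_FTC[OF a(2)])
    show "((\<lambda>\<rho>. - complex_of_real (exp (- \<rho> * eig k)) * chr k x) has_vector_derivative
        complex_of_real (eig k * exp (- \<rho> * eig k)) * chr k x) (at \<rho> within {a..r})" for \<rho>
      by (auto intro!: derivative_eq_intros has_vector_derivative_mult_left simp flip: of_real_minus
          simp: has_real_derivative_iff_has_vector_derivative[symmetric])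
    show "continuous_on {a..r} (\<lambda>\<rho>. complex_of_real (eig k * exp (- \<rho> * eig k)) * chr k x)"
      by (intro continuous_intros)
  qed
  finally show "heat a (chr k) x - heat r (chr k) x = (LINT \<rho>:{a..r}|lborel. heat_lap \<rho> (chr k) x)"
    using a by (simp add: heat_chr)
qed

lemma norm_heat_grad_le:
  fixes h :: "real ^ 'n::finite \<Rightarrow> complex"
  assumes r: "r > 0" and b: "\<And>x. norm (h x) \<le> b"
  shows "norm (heat_grad y r h x) \<le> CARD('n) * norm y / sqrt r * b"
proof -
  have m: "(LINT \<zeta>|(gauss :: (real ^ 'n) measure). \<bar>\<zeta> \<bullet> y\<bar>) \<le> CARD('n) * norm y"
  proof -
    have e: "(LINT \<zeta>|gauss. (\<zeta> $ j)\<^sup>2) = 1" for j :: 'n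
    proof -
      have "(LINT \<zeta>|gauss. complex_of_real ((\<zeta> $ j)\<^sup>2)) = 1"
        using gauss_coordinate_moments(3)[of j 0] by simp
      then show ?thesis by (metis integral_complex_of_real of_real_eq_1_iff)
    qed
    have "(LINT \<zeta>|(gauss :: (real ^ 'n) measure). \<bar>\<zeta> \<bullet> y\<bar>) \<le> (LINT \<zeta>|(gauss :: (real ^ 'n) measure). norm y * ((1 + (\<Sum>j\<in>UNIV. (\<zeta> $ j)\<^sup>2)) / 2))"
    proof (rule Bochner_Integration.integral_mono)
      show "integrable gauss (\<lambda>\<zeta> :: real ^ 'n. \<bar>\<zeta> \<bullet> y\<bar>)" by (rule integrable_abs[OF integrable_inner])
      show "integrable gauss (\<lambda>\<zeta> :: real ^ 'n. norm y * ((1 + (\<Sum>j\<in>UNIV. (\<zeta> $ j)\<^sup>2)) / 2))"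
        by (intro integrable_mult_right Bochner_Integration.integrable_divide Bochner_Integration.integrable_add
            Bochner_Integration.integrable_sum integrable_gauss_coordinate_power) simp
      fix \<zeta> :: "real ^ 'n"
      have "0 \<le> (1 - norm \<zeta>)\<^sup>2" by simp
      then have "norm \<zeta> \<le> (1 + (norm \<zeta>)\<^sup>2) / 2" by (simp add: power2_eq_square algebra_simps)
      then have "norm y * norm \<zeta> \<le> norm y * ((1 + (\<Sum>j\<in>UNIV. (\<zeta> $ j)\<^sup>2)) / 2)"
        unfolding norm_sq_sum by (rule mult_left_mono) simp
      then show "\<bar>\<zeta> \<bullet> y\<bar> \<le> norm y * ((1 + (\<Sum>j\<in>UNIV. (\<zeta> $ j)\<^sup>2)) / 2)"
        using Cauchy_Schwarz_ineq2[of \<zeta> y] by (simp add: mult.commute)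
    qed
    also have "\<dots> = norm y * ((1 + real CARD('n)) / 2)"
    proof -
      have ij: "integrable gauss (\<lambda>\<zeta> :: real ^ 'n. (\<zeta> $ j)\<^sup>2)" for j
        by (rule integrable_gauss_coordinate_power)
      have "(LINT \<zeta>|(gauss :: (real ^ 'n) measure). 1 + (\<Sum>j\<in>UNIV. (\<zeta> $ j)\<^sup>2)) = 1 + CARD('n)"
        using ij e by (subst Bochner_Integration.integral_add)
          (auto simp: Bochner_Integration.integral_sum gauss.prob_space[unfolded space_gauss])
      then show ?thesis by simp
    qed
    also have "\<dots> \<le> norm y * CARD('n)"
    proof (rule mult_left_mono)
      have "1 \<le> real CARD('n)" by (simp add: Suc_leI)
      then show "(1 + real CARD('n)) / 2 \<le> CARD('n)" by simp
    qed simp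
    finally show ?thesis by (simp add: mult.commute)
  qed
  have b0: "0 \<le> b" using b[of 0] norm_ge_zero order_trans by blast
  have "norm (heat_grad y r h x) \<le> 1 / sqrt (2 * r) * ((LINT \<zeta>|(gauss :: (real ^ 'n) measure). \<bar>\<zeta> \<bullet> y\<bar>) * b)"
    unfolding heat_grad_def norm_mult
    by (intro mult_mono norm_gauss_avg_le integrable_inner b) (use r in \<open>auto simp: norm_divide\<close>)
  also have "\<dots> \<le> 1 / sqrt r * (CARD('n) * norm y * b)"
    by (intro mult_mono m b0 mult_nonneg_nonneg) (use r b0 in \<open>auto simp: field_simps\<close>)
  finally show ?thesis by simp
qed

lemma heat_translation:
  fixes h :: "real ^ 'n::finite \<Rightarrow> complex"
  assumes r: "r > 0" and h: "cont_periodic h"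
  shows "heat r h (x + y) - heat r h x = (LINT \<tau>:{0..1}|lborel. heat_grad y r h (x + \<tau> *\<^sub>R y))"
proof (rule bl_functional_eqI[OF _ _ _ h])
  show "bl_functional (\<lambda>h. heat r h (x + y) - heat r h x)"
    by (intro bl_functional_minus bl_functional_apply bl_operator_heat)
  show "bl_functional (\<lambda>h. LINT \<tau>:{0..1}|lborel. heat_grad y r h (x + \<tau> *\<^sub>R y))"
  proof (rule bl_functional_set_integral[where B = "\<lambda>_. CARD('n) * norm y / sqrt r"])
    show "set_integrable lborel {0..1} (\<lambda>_ :: real. CARD('n) * norm y / sqrt r)"
      by (intro borel_integrable_atLeastAtMost' continuous_intros)
    show "(\<lambda>\<sigma>. heat_grad y r h (x + \<sigma> *\<^sub>R y)) \<in> borel_measurable lborel" if "cont_periodic h" for h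
      by (rule measurable_heat_grad[OF that]) auto
    show "norm (heat_grad y r h (x + \<tau> *\<^sub>R y)) \<le> CARD('n) * norm y / sqrt r * b"
      if "\<And>x. norm (h x) \<le> b" for \<tau> h b
      by (rule norm_heat_grad_le[OF r that])
  qed (auto intro: bl_functional_apply bl_operator_heat_grad)
  fix k :: "int ^ 'n"
  let ?e = "complex_of_real (exp (- r * eig k))"
  have "(LINT \<tau>:{0..1}|lborel. heat_grad y r (chr k) (x + \<tau> *\<^sub>R y)) = ?e * chr k (x + 1 *\<^sub>R y) - ?e * chr k (x + 0 *\<^sub>R y)"
  proof (rule set_integral_FTC)
    fix \<tau> :: real
    have "((\<lambda>z. exp (\<i> * complex_of_real (2 * pi * (freq k \<bullet> y)) * z)) has_field_derivative
        \<i> * complex_of_real (2 * pi * (freq k \<bullet> y)) * exp (\<i> * complex_of_real (2 * pi * (freq k \<bullet> y)) * \<tau>)) (at (of_real \<tau>))"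
      by (auto intro!: derivative_eq_intros)
    from has_vector_derivative_mult_right[OF has_vector_derivative_real_field[OF this, of "{0..1}"], of "?e * chr k x"]
    show "((\<lambda>\<tau>. ?e * chr k (x + \<tau> *\<^sub>R y)) has_vector_derivative heat_grad y r (chr k) (x + \<tau> *\<^sub>R y)) (at \<tau> within {0..1})"
      unfolding heat_grad_chr[OF r] chr_add chr_def[of k "_ *\<^sub>R y"] cis_conv_exp
      by (simp add: mult.assoc mult.commute mult.left_commute)
    show "continuous_on {0..1} (\<lambda>\<tau>. heat_grad y r (chr k) (x + \<tau> *\<^sub>R y))"
      unfolding heat_grad_chr[OF r] by (intro continuous_intros)
  qed simp
  then show "heat r (chr k) (x + y) - heat r (chr k) x = (LINT \<tau>:{0..1}|lborel. heat_grad y r (chr k) (x + \<tau> *\<^sub>R y))"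
    using r by (simp add: heat_chr)
qed

lemma norm_heat_translation_le:
  fixes h :: "real ^ 'n::finite \<Rightarrow> complex"
  assumes r: "r > 0" and h: "cont_periodic h" and b: "\<And>x. norm (h x) \<le> b"
  shows "norm (heat r h (x + y) - heat r h x) \<le> CARD('n) * norm y / sqrt r * b"
proof -
  have "norm (heat r h (x + y) - heat r h x) \<le> (LINT \<tau>:{0..1}|(lborel :: real measure). CARD('n) * norm y / sqrt r * b)"
    unfolding heat_translation[OF r h]
    by (rule norm_set_integral_le[OF _ norm_heat_grad_le[OF r b]])
       (intro borel_integrable_atLeastAtMost' continuous_intros)
  then show ?thesis by (simp add: set_lebesgue_integral_def)
qed

section \<open>Subordination formulas\<close>

lemma set_integral_nonneg_has_integral:
  fixes f :: "real \<Rightarrow> real"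
  assumes [measurable]: "f \<in> borel_measurable borel" "S \<in> sets borel"
    and nn: "\<And>x. x \<in> S \<Longrightarrow> 0 \<le> f x" and I: "(f has_integral I) S"
  shows "set_integrable lborel S f" "(LINT x:S|lborel. f x) = I"
proof -
  have "f absolutely_integrable_on S"
    by (rule nonnegative_absolutely_integrable_1) (use I nn in \<open>auto simp: integrable_on_def\<close>)
  then show si: "set_integrable lborel S f"
    unfolding set_integrable_def by (subst (asm) integrable_completion) auto
  show "(LINT x:S|lborel. f x) = I"
    using set_borel_integral_eq_integral(2)[OF si] integral_unique[OF I] by simp
qed

text \<open>
  All integrals over the half line in this development are dominated by functions of this form, with one
  power that is integrable at zero and one that is integrable at infinity.
\<close>

lemma powr_split_integral:
  fixes r p q a b :: real
  assumes r: "r > 0" and p: "p < 1" and q: "q > 1"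
  defines "G \<equiv> \<lambda>\<sigma>. a * (indicator {0..r} \<sigma> * \<sigma> powr (- p)) + b * (indicator {r..} \<sigma> * \<sigma> powr (- q))"
  shows "integrable lborel G" "(LINT \<sigma>|lborel. G \<sigma>) = a * (r powr (1 - p) / (1 - p)) + b * (r powr (1 - q) / (q - 1))"
proof -
  have 1: "set_integrable lborel {0..r} (\<lambda>\<sigma>. \<sigma> powr (- p))"
    "(LINT \<sigma>:{0..r}|lborel. \<sigma> powr (- p)) = r powr (1 - p) / (1 - p)"
    using has_integral_powr_from_0[of "- p" r] r p
    by (auto intro!: set_integral_nonneg_has_integral)
  have 2: "set_integrable lborel {r..} (\<lambda>\<sigma>. \<sigma> powr (- q))"
    "(LINT \<sigma>:{r..}|lborel. \<sigma> powr (- q)) = r powr (1 - q) / (q - 1)"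
  proof -
    have "((\<lambda>\<sigma>. \<sigma> powr (- q)) has_integral - (r powr (- q + 1)) / (- q + 1)) {r..}"
      using has_integral_powr_to_inf[of "- q" r] r q by simp
    moreover have "- (r powr (- q + 1)) / (- q + 1) = r powr (1 - q) / (q - 1)"
    proof -
      have "- q + 1 = 1 - q" by simp
      then show ?thesis by (simp only: minus_divide_left[symmetric] minus_divide_right minus_diff_eq)
    qed
    ultimately have "((\<lambda>\<sigma>. \<sigma> powr (- q)) has_integral r powr (1 - q) / (q - 1)) {r..}" by simp
    then show "set_integrable lborel {r..} (\<lambda>\<sigma>. \<sigma> powr (- q))"
      "(LINT \<sigma>:{r..}|lborel. \<sigma> powr (- q)) = r powr (1 - q) / (q - 1)"
      by (auto intro!: set_integral_nonneg_has_integral)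
  qed
  have i: "integrable lborel (\<lambda>\<sigma>. indicator {0..r} \<sigma> * \<sigma> powr (- p))"
    "integrable lborel (\<lambda>\<sigma>. indicator {r..} \<sigma> * \<sigma> powr (- q))"
    using 1(1) 2(1) by (simp_all add: set_integrable_def)
  show "integrable lborel G" unfolding G_def
    by (intro Bochner_Integration.integrable_add integrable_mult_right i)
  show "(LINT \<sigma>|lborel. G \<sigma>) = a * (r powr (1 - p) / (1 - p)) + b * (r powr (1 - q) / (q - 1))"
    unfolding G_def using i 1(2) 2(2) by (simp add: set_lebesgue_integral_def)
qed

lemma powr_kernel_integral:
  fixes r \<kappa> s :: real
  assumes r: "r > 0" and \<kappa>: "\<kappa> \<ge> 0" and s: "s < 1" "\<kappa> + s > 1"
  shows "set_integrable lborel {0<..} (\<lambda>\<sigma>. \<sigma> powr (- s) * (r + \<sigma>) powr (- \<kappa>))"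
    and "(LINT \<sigma>:{0<..}|lborel. \<sigma> powr (- s) * (r + \<sigma>) powr (- \<kappa>)) \<le>
      (1 / (1 - s) + 1 / (\<kappa> + s - 1)) * r powr (1 - \<kappa> - s)"
proof -
  let ?G = "\<lambda>\<sigma>. r powr (- \<kappa>) * (indicator {0..r} \<sigma> * \<sigma> powr (- s)) + 1 * (indicator {r..} \<sigma> * \<sigma> powr (- (\<kappa> + s)))"
  let ?f = "\<lambda>\<sigma>. indicator {0<..} \<sigma> *\<^sub>R (\<sigma> powr (- s) * (r + \<sigma>) powr (- \<kappa>))"
  have G: "integrable lborel ?G" "(LINT \<sigma>|lborel. ?G \<sigma>) =
      r powr (- \<kappa>) * (r powr (1 - s) / (1 - s)) + 1 * (r powr (1 - (\<kappa> + s)) / ((\<kappa> + s) - 1))"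
    by (rule powr_split_integral[OF r s])+
  have le: "0 \<le> ?f \<sigma>" "?f \<sigma> \<le> ?G \<sigma>" for \<sigma>
  proof -
    show "0 \<le> ?f \<sigma>" by simp
    consider "\<sigma> \<le> 0" | "0 < \<sigma>" "\<sigma> \<le> r" | "r < \<sigma>" by linarith
    then show "?f \<sigma> \<le> ?G \<sigma>"
    proof cases
      case 2
      have "(r + \<sigma>) powr (- \<kappa>) \<le> r powr (- \<kappa>)"
        by (rule powr_mono2') (use 2 r \<kappa> in auto)
      then have "?f \<sigma> \<le> r powr (- \<kappa>) * \<sigma> powr (- s)"
        using 2 by (simp add: mult.commute mult_right_mono)
      also have "\<dots> \<le> ?G \<sigma>" using 2 by simp
      finally show ?thesis .
    next
      case 3
      have "(r + \<sigma>) powr (- \<kappa>) \<le> \<sigma> powr (- \<kappa>)"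
        by (rule powr_mono2') (use 3 r \<kappa> in auto)
      then have "?f \<sigma> \<le> \<sigma> powr (- s) * \<sigma> powr (- \<kappa>)"
        using 3 r by (simp add: mult_left_mono)
      also have "\<dots> = ?G \<sigma>" using 3 r by (simp add: algebra_simps flip: powr_add)
      finally show ?thesis .
    qed simp
  qed
  have "integrable lborel ?f"
    by (rule Bochner_Integration.integrable_bound[OF G(1)]) (use le in \<open>auto intro!: AE_I2 order_trans[OF le(2) abs_ge_self]\<close>)
  then show "set_integrable lborel {0<..} (\<lambda>\<sigma>. \<sigma> powr (- s) * (r + \<sigma>) powr (- \<kappa>))"
    by (simp only: set_integrable_def)
  have "(LINT \<sigma>|lborel. ?f \<sigma>) \<le> (LINT \<sigma>|lborel. ?G \<sigma>)"
    by (rule Bochner_Integration.integral_mono[OF \<open>integrable lborel ?f\<close> G(1) le(2)])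
  also have "\<dots> = (1 / (1 - s) + 1 / (\<kappa> + s - 1)) * r powr (1 - \<kappa> - s)"
  proof -
    have "r powr (- \<kappa>) * r powr (1 - s) = r powr (1 - \<kappa> - s)"
      using r by (simp add: algebra_simps flip: powr_add)
    moreover have e: "1 - (\<kappa> + s) = 1 - \<kappa> - s" by simp
    ultimately show ?thesis unfolding G(2) e by (simp add: distrib_right)
  qed
  finally show "(LINT \<sigma>:{0<..}|lborel. \<sigma> powr (- s) * (r + \<sigma>) powr (- \<kappa>)) \<le>
      (1 / (1 - s) + 1 / (\<kappa> + s - 1)) * r powr (1 - \<kappa> - s)"
    by (simp only: set_lebesgue_integral_def)
qed

text \<open>
  Because of this scaling the constants in both subordination formulas can be left as integrals: the
  dependence on the eigenvalue is forced to be a power.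
\<close>

lemma powr_integral_scale:
  fixes g :: "real \<Rightarrow> real"
  assumes l: "l > 0"
  shows "(LINT \<sigma>:{0<..}|lborel. \<sigma> powr p * g (l * \<sigma>)) = l powr (- p - 1) * (LINT \<sigma>:{0<..}|lborel. \<sigma> powr p * g \<sigma>)"
proof -
  have "(LINT \<sigma>:{0<..}|lborel. \<sigma> powr p * g \<sigma>) =
      l * (LINT \<sigma>|lborel. indicator {0<..} (0 + l * \<sigma>) *\<^sub>R ((0 + l * \<sigma>) powr p * g (0 + l * \<sigma>)))"
    unfolding set_lebesgue_integral_def using l by (subst lborel_integral_real_affine[of l _ 0]) auto
  also have "(LINT \<sigma>|lborel. indicator {0<..} (0 + l * \<sigma>) *\<^sub>R ((0 + l * \<sigma>) powr p * g (0 + l * \<sigma>))) =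
      (LINT \<sigma>|lborel. l powr p * (indicator {0<..} \<sigma> *\<^sub>R (\<sigma> powr p * g (l * \<sigma>))))"
    using l by (intro Bochner_Integration.integral_cong refl)
      (auto simp: indicator_def zero_less_mult_iff powr_mult mult.assoc)
  also have "\<dots> = l powr p * (LINT \<sigma>:{0<..}|lborel. \<sigma> powr p * g (l * \<sigma>))"
    by (simp only: set_lebesgue_integral_def integral_mult_right_zero)
  finally have *: "(LINT \<sigma>:{0<..}|lborel. \<sigma> powr p * g \<sigma>) = (l * l powr p) * (LINT \<sigma>:{0<..}|lborel. \<sigma> powr p * g (l * \<sigma>))"
    by (simp only: mult.assoc)
  have "l powr (- p - 1) * (l * l powr p) = 1"
    using l by (simp add: powr_diff powr_minus field_simps)
  then show ?thesis unfolding * by (simp only: mult.assoc[symmetric] mult_1_left)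
qed

text \<open>
  \<open>z = (-\<Delta>)\<^sup>s u\<close> on the level of Fourier coefficients; this form is stable under all translation
  invariant operators.
\<close>

definition frac_pair :: "real \<Rightarrow> (real ^ 'n::finite \<Rightarrow> complex) \<Rightarrow> (real ^ 'n \<Rightarrow> complex) \<Rightarrow> bool" where
  "frac_pair s u z \<longleftrightarrow> cont_periodic u \<and> cont_periodic z \<and>
     (\<forall>k. fcoeff z k = complex_of_real (eig k powr s) * fcoeff u k)"

lemma bl_functional_fcoeff: "bl_functional (\<lambda>h. fcoeff h k)"
  by (rule bl_functionalI[where B = 1]) (simp_all add: fcoeff_add fcoeff_cmult norm_fcoeff_le)

lemma fcoeff_heat_lap:
  fixes h :: "real ^ 'n::finite \<Rightarrow> complex"
  assumes a: "a > 0" and h: "cont_periodic h"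
  shows "fcoeff (heat_lap a h) k = complex_of_real (eig k * exp (- a * eig k)) * fcoeff h k"
proof (rule bl_functional_eqI[OF _ _ _ h])
  show "bl_functional (\<lambda>h. fcoeff (heat_lap a h) k)"
    by (rule bl_functional_operator[OF bl_functional_fcoeff bl_operator_heat_lap])
  show "bl_functional (\<lambda>h. complex_of_real (eig k * exp (- a * eig k)) * fcoeff h k)"
    by (rule bl_functional_cmultI[OF bl_functional_fcoeff])
  fix j :: "int ^ 'n"
  have "heat_lap a (chr j) = (\<lambda>x. complex_of_real (eig j * exp (- a * eig j)) * chr j x)"
    using heat_lap_chr[OF a] by auto
  then show "fcoeff (heat_lap a (chr j)) k = complex_of_real (eig k * exp (- a * eig k)) * fcoeff (chr j) k"
    by (simp add: fcoeff_cmult fcoeff_chr)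
qed

lemma frac_pair_heat_lap: "a > 0 \<Longrightarrow> frac_pair s u z \<Longrightarrow> frac_pair s (heat_lap a u) (heat_lap a z)"
  unfolding frac_pair_def by (simp add: cont_periodic_heat_lap fcoeff_heat_lap mult.left_commute)

lemma fcoeff_diff:
  "cont_periodic f \<Longrightarrow> cont_periodic g \<Longrightarrow> fcoeff (\<lambda>x. f x - g x) k = fcoeff f k - fcoeff g k"
  by (rule bl_functional_diff[OF bl_functional_fcoeff])

lemma frac_pair_diff:
  "frac_pair s u z \<Longrightarrow> frac_pair s u' z' \<Longrightarrow> frac_pair s (\<lambda>x. u x - u' x) (\<lambda>x. z x - z' x)"
  unfolding frac_pair_def by (simp add: cont_periodic_diff fcoeff_diff right_diff_distrib)

text \<open>
  For \<open>s < 1\<close> this is \<open>Gamma (1 - s)\<close>.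
\<close>

definition gamma_const :: "real \<Rightarrow> real" where
  "gamma_const s = (LINT \<sigma>:{0<..}|lborel. \<sigma> powr (- s) * exp (- \<sigma>))"

definition levy_const :: "real \<Rightarrow> real" where
  "levy_const s = (LINT \<sigma>:{0<..}|lborel. \<sigma> powr (- 1 - s) * (1 - exp (- \<sigma>)))"

lemma levy_const_nonneg: "levy_const s \<ge> 0"
  unfolding levy_const_def set_lebesgue_integral_def
  by (intro Bochner_Integration.integral_nonneg) (auto simp: indicator_def)

lemma gamma_const_pos:
  assumes "s < 1" shows "gamma_const s > 0"
proof -
  let ?f = "\<lambda>t. t powr (- s) * exp (- t)"
  have "((\<lambda>t. t powr ((1 - s) - 1) / exp t) has_integral Gamma (1 - s)) {0..}"
    using assms by (intro Gamma_integral_real) simp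
  then have I: "(?f has_integral Gamma (1 - s)) {0..}"
    by (simp add: exp_minus divide_inverse)
  have "(LINT \<sigma>:{0..}|lborel. ?f \<sigma>) = Gamma (1 - s)"
    by (rule set_integral_nonneg_has_integral(2)[OF _ _ _ I]) auto
  moreover have "(LINT \<sigma>:{0..}|lborel. ?f \<sigma>) = gamma_const s"
    unfolding gamma_const_def set_lebesgue_integral_def
    by (intro Bochner_Integration.integral_cong) (auto simp: indicator_def)
  ultimately show ?thesis using Gamma_real_pos[of "1 - s"] assms by simp
qed

lemma set_integral_complex_of_real:
  "(LINT \<sigma>:S|M. complex_of_real (f \<sigma>)) = complex_of_real (LINT \<sigma>:S|M. f \<sigma>)"
  unfolding set_lebesgue_integral_def
  by (simp add: scaleR_conv_of_real flip: of_real_mult integral_complex_of_real)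

text \<open>
  On an eigenfunction with eigenvalue \<open>l\<close> this is the formula
  \<open>gamma_const s * l powr s = \<integral> \<sigma> powr (-s) * (l * exp (- l \<sigma>)) d\<sigma>\<close>, multiplied with \<open>exp (- r l)\<close>.
\<close>

theorem heat_frac_gamma:
  fixes u z :: "real ^ 'n::finite \<Rightarrow> complex"
  assumes s: "0 < s" "s < 1" and r: "r > 0" and uz: "frac_pair s u z"
  shows "complex_of_real (gamma_const s) * heat r z x =
    (LINT \<sigma>:{0<..}|lborel. complex_of_real (\<sigma> powr (- s)) * heat_lap (r + \<sigma>) u x)"
proof (rule bl_functional_transfer[where \<Lambda>\<^sub>1 = "\<lambda>h. complex_of_real (gamma_const s) * heat r h x"
      and \<Lambda>\<^sub>2 = "\<lambda>h. LINT \<sigma>:{0<..}|lborel. complex_of_real (\<sigma> powr (- s)) * heat_lap (r + \<sigma>) h x"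
      and s = s and r = r and C = "gamma_const s"])
  show "bl_functional (\<lambda>h. complex_of_real (gamma_const s) * heat r h x)"
    by (intro bl_functional_cmultI bl_functional_apply bl_operator_heat)
  obtain C where C: "C \<ge> 0" "\<And>r (h :: real ^ 'n \<Rightarrow> complex) b x. r > 0 \<Longrightarrow> (\<And>x. norm (h x) \<le> b) \<Longrightarrow> norm (heat_lap r h x) \<le> C / r * b"
    using heat_lap_bound[where 'n = 'n] by blast
  show "bl_functional (\<lambda>h. LINT \<sigma>:{0<..}|lborel. complex_of_real (\<sigma> powr (- s)) * heat_lap (r + \<sigma>) h x)"
  proof (rule bl_functional_set_integral[where B = "\<lambda>\<sigma>. C * (\<sigma> powr (- s) * (r + \<sigma>) powr (- 1))"])
    have "set_integrable lborel {0<..} (\<lambda>\<sigma>. \<sigma> powr (- s) * (r + \<sigma>) powr (- 1))"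
      by (rule powr_kernel_integral(1)) (use r s in auto)
    then show "set_integrable lborel {0<..} (\<lambda>\<sigma>. C * (\<sigma> powr (- s) * (r + \<sigma>) powr (- 1)))"
      by (intro set_integrable_mult_right) auto
    show "norm (complex_of_real (\<sigma> powr (- s)) * heat_lap (r + \<sigma>) h x) \<le> C * (\<sigma> powr (- s) * (r + \<sigma>) powr (- 1)) * b"
      if "\<sigma> \<in> {0<..}" "\<And>x. norm (h x) \<le> b" for \<sigma> h b
    proof -
      have "norm (heat_lap (r + \<sigma>) h x) \<le> C / (r + \<sigma>) * b" by (rule C(2)) (use that r in auto)
      then have "\<sigma> powr (- s) * norm (heat_lap (r + \<sigma>) h x) \<le> \<sigma> powr (- s) * (C / (r + \<sigma>) * b)"
        by (rule mult_left_mono) simp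
      moreover have "(r + \<sigma>) powr (- 1) = 1 / (r + \<sigma>)" using that r by (simp add: powr_minus_divide)
      ultimately show ?thesis by (simp add: norm_mult mult.commute mult.left_commute)
    qed
    show "(\<lambda>\<sigma>. complex_of_real (\<sigma> powr (- s)) * heat_lap (r + \<sigma>) h x) \<in> borel_measurable lborel" if "cont_periodic h" for h
      by (intro borel_measurable_times measurable_heat_lap that) auto
    show "bl_functional (\<lambda>h. complex_of_real (\<sigma> powr (- s)) * heat_lap (r + \<sigma>) h x)" for \<sigma>
      by (rule bl_functional_cmultI[OF bl_functional_apply[OF bl_operator_heat_lap]])
  qed simp
  fix k :: "int ^ 'n"
  show "norm (complex_of_real (gamma_const s) * heat r (chr k) x) \<le> gamma_const s * exp (- r * eig k)"
    using gamma_const_pos[OF s(2)] r by (simp add: heat_chr norm_mult)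
  show "(LINT \<sigma>:{0<..}|lborel. complex_of_real (\<sigma> powr (- s)) * heat_lap (r + \<sigma>) (chr k) x) =
      complex_of_real (eig k powr s) * (complex_of_real (gamma_const s) * heat r (chr k) x)"
  proof (cases "eig k = 0")
    case False
    then have l: "eig k > 0" using eig_nonneg[of k] by linarith
    have "(LINT \<sigma>:{0<..}|lborel. complex_of_real (\<sigma> powr (- s)) * heat_lap (r + \<sigma>) (chr k) x) =
        (LINT \<sigma>:{0<..}|lborel. complex_of_real (\<sigma> powr (- s) * exp (- (eig k * \<sigma>))) * (complex_of_real (eig k * exp (- r * eig k)) * chr k x))"
    proof (rule set_lebesgue_integral_cong, simp, intro allI impI)
      fix \<sigma> :: real assume "\<sigma> \<in> {0<..}"
      then have "heat_lap (r + \<sigma>) (chr k) x = complex_of_real (eig k * exp (- (r + \<sigma>) * eig k)) * chr k x"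
        using r by (intro heat_lap_chr) simp
      moreover have "exp (- (r + \<sigma>) * eig k) = exp (- (eig k * \<sigma>)) * exp (- r * eig k)"
        by (simp add: algebra_simps flip: exp_add)
      ultimately show "complex_of_real (\<sigma> powr (- s)) * heat_lap (r + \<sigma>) (chr k) x =
          complex_of_real (\<sigma> powr (- s) * exp (- (eig k * \<sigma>))) * (complex_of_real (eig k * exp (- r * eig k)) * chr k x)"
        by (simp only: of_real_mult mult.assoc mult.left_commute)
    qed
    also have "\<dots> = complex_of_real (eig k powr (s - 1) * gamma_const s) * (complex_of_real (eig k * exp (- r * eig k)) * chr k x)"
      unfolding set_integral_mult_left set_integral_complex_of_real
      using powr_integral_scale[OF l, of "- s" "\<lambda>\<sigma>. exp (- \<sigma>)"] by (simp add: gamma_const_def)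
    also have "\<dots> = complex_of_real (eig k powr s) * (complex_of_real (gamma_const s) * heat r (chr k) x)"
    proof -
      have "eig k powr (s - 1) * eig k = eig k powr s" using l by (simp add: powr_diff)
      then have "complex_of_real (eig k powr (s - 1)) * complex_of_real (eig k) = complex_of_real (eig k powr s)"
        by (simp flip: of_real_mult)
      then show ?thesis using r by (simp add: heat_chr mult.assoc mult.commute mult.left_commute)
    qed
    finally show ?thesis .
  next
    case True
    then have "complex_of_real (\<sigma> powr (- s)) * heat_lap (r + \<sigma>) (chr k) x = 0" if "\<sigma> > 0" for \<sigma>
      using r that by (simp add: heat_lap_chr)
    then have "(LINT \<sigma>:{0<..}|lborel. complex_of_real (\<sigma> powr (- s)) * heat_lap (r + \<sigma>) (chr k) x) = (LINT \<sigma>:{0<..}|(lborel :: real measure). 0)"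
      by (intro set_lebesgue_integral_cong) auto
    then show ?thesis using True by simp
  qed
qed (use uz s r in \<open>auto simp: frac_pair_def\<close>)

text \<open>
  The Levy-Khintchine form of the fractional Laplacian.  The kernel is positive and acts on the difference
  of \<open>u\<close> and its averages, and this is the source of the maximum principle.  Near \<open>\<sigma> = 0\<close> the
  difference is of order \<open>\<sigma> / r\<close>, near infinity it is bounded.
\<close>

theorem heat_frac_levy:
  fixes u z :: "real ^ 'n::finite \<Rightarrow> complex"
  assumes s: "0 < s" "s < 1" and r: "r > 0" and uz: "frac_pair s u z"
  shows "complex_of_real (levy_const s) * heat r z x =
    (LINT \<sigma>:{0<..}|lborel. complex_of_real (\<sigma> powr (- 1 - s)) * (heat r u x - heat (r + \<sigma>) u x))"
    (is ?eq)
    and "set_integrable lborel {0<..} (\<lambda>\<sigma>. complex_of_real (\<sigma> powr (- 1 - s)) * (heat r u x - heat (r + \<sigma>) u x))"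
    (is ?int)
proof -
  obtain C where C: "C \<ge> 0" "\<And>r (h :: real ^ 'n \<Rightarrow> complex) b x. r > 0 \<Longrightarrow> (\<And>x. norm (h x) \<le> b) \<Longrightarrow> norm (heat_lap r h x) \<le> C / r * b"
    using heat_lap_bound[where 'n = 'n] by blast
  let ?B = "\<lambda>\<sigma>. (C / r) * (indicator {0..r} \<sigma> * \<sigma> powr (- s)) + 2 * (indicator {r..} \<sigma> * \<sigma> powr (- (1 + s)))"
  have B: "set_integrable lborel {0<..} ?B"
    using powr_split_integral(1)[OF r s(2), of "1 + s" "C / r" 2] s(1)
    unfolding set_integrable_def by (intro integrable_mult_indicator) auto
  have diff: "norm (heat r h x - heat (r + \<sigma>) h x) \<le> (C / r) * \<sigma> * b"
    "norm (heat r h x - heat (r + \<sigma>) h x) \<le> 2 * b"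
    if h: "cont_periodic h" "\<And>x. norm (h x) \<le> b" and \<sigma>: "\<sigma> > 0" for h :: "real ^ 'n \<Rightarrow> complex" and b \<sigma>
  proof -
    have b: "b \<ge> 0" using h(2)[of 0] norm_ge_zero order_trans by blast
    have "norm (heat r h x - heat (r + \<sigma>) h x) \<le> (LINT \<rho>:{r..r+\<sigma>}|(lborel :: real measure). C / r * b)"
    proof (subst heat_difference[OF r _ h(1)])
      show "norm (LINT \<rho>:{r..r+\<sigma>}|lborel. heat_lap \<rho> h x) \<le> (LINT \<rho>:{r..r+\<sigma>}|(lborel :: real measure). C / r * b)"
      proof (rule norm_set_integral_le)
        show "set_integrable lborel {r..r+\<sigma>} (\<lambda>_ :: real. C / r * b)"
          by (intro borel_integrable_atLeastAtMost' continuous_intros)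
        fix \<rho> assume \<rho>: "\<rho> \<in> {r..r+\<sigma>}"
        have "norm (heat_lap \<rho> h x) \<le> C / \<rho> * b" by (rule C(2)) (use \<rho> r h in auto)
        also have "\<dots> \<le> C / r * b"
          by (intro mult_right_mono divide_left_mono) (use \<rho> r b C(1) in auto)
        finally show "norm (heat_lap \<rho> h x) \<le> C / r * b" .
      qed
    qed (use \<sigma> in simp)
    also have "\<dots> = (C / r) * \<sigma> * b" using \<sigma> by (simp add: set_lebesgue_integral_def)
    finally show "norm (heat r h x - heat (r + \<sigma>) h x) \<le> (C / r) * \<sigma> * b" .
    show "norm (heat r h x - heat (r + \<sigma>) h x) \<le> 2 * b"
    proof -
      have "norm (heat r h x) \<le> b" "norm (heat (r + \<sigma>) h x) \<le> b" by (rule norm_heat_le, rule h)+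
      then show ?thesis using norm_triangle_ineq4[of "heat r h x" "heat (r + \<sigma>) h x"] by linarith
    qed
  qed
  have bound: "norm (complex_of_real (\<sigma> powr (- 1 - s)) * (heat r h x - heat (r + \<sigma>) h x)) \<le> ?B \<sigma> * b"
    if \<sigma>: "\<sigma> \<in> {0<..}" and h: "cont_periodic h" "\<And>x. norm (h x) \<le> b" for \<sigma> h b
  proof -
    have b: "b \<ge> 0" using h(2)[of 0] norm_ge_zero order_trans by blast
    have \<sigma>0: "\<sigma> > 0" using \<sigma> by simp
    have pp: "\<sigma> powr (- 1 - s) * \<sigma> = \<sigma> powr (- s)" using \<sigma>0 by (simp add: powr_diff powr_minus field_simps)
    show ?thesis
    proof (cases "\<sigma> \<le> r")
      case True
      have "\<sigma> powr (- 1 - s) * norm (heat r h x - heat (r + \<sigma>) h x) \<le> \<sigma> powr (- 1 - s) * ((C / r) * \<sigma> * b)"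
        by (intro mult_left_mono diff h \<sigma>0) simp
      also have "\<dots> = (C / r) * \<sigma> powr (- s) * b" using pp by (simp only: mult.assoc mult.left_commute) (simp add: mult.commute)
      also have "\<dots> \<le> ?B \<sigma> * b" using True \<sigma>0 b by (intro mult_right_mono) auto
      finally show ?thesis by (simp add: norm_mult)
    next
      case False
      have "\<sigma> powr (- 1 - s) * norm (heat r h x - heat (r + \<sigma>) h x) \<le> \<sigma> powr (- 1 - s) * (2 * b)"
        by (intro mult_left_mono diff h \<sigma>0) simp
      also have "\<dots> = ?B \<sigma> * b" using False by simp
      finally show ?thesis by (simp add: norm_mult)
    qed
  qed
  have meas: "(\<lambda>\<sigma>. complex_of_real (\<sigma> powr (- 1 - s)) * (heat r h x - heat (r + \<sigma>) h x)) \<in> borel_measurable lborel"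
    if "cont_periodic h" for h
    by (intro borel_measurable_times borel_measurable_diff measurable_heat that) auto
  have bl: "bl_functional (\<lambda>h. LINT \<sigma>:{0<..}|lborel. complex_of_real (\<sigma> powr (- 1 - s)) * (heat r h x - heat (r + \<sigma>) h x))"
  proof (rule bl_functional_set_integral[where B = ?B, OF _ _ bound B meas])
    show "bl_functional (\<lambda>h. complex_of_real (\<sigma> powr (- 1 - s)) * (heat r h x - heat (r + \<sigma>) h x))" for \<sigma>
      by (intro bl_functional_cmultI bl_functional_minus bl_functional_apply bl_operator_heat)
  qed auto
  show ?eq
  proof (rule bl_functional_transfer[where \<Lambda>\<^sub>1 = "\<lambda>h. complex_of_real (levy_const s) * heat r h x"
      and s = s and r = r and C = "levy_const s", OF _ bl])
    show "bl_functional (\<lambda>h. complex_of_real (levy_const s) * heat r h x)"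
      by (intro bl_functional_cmultI bl_functional_apply bl_operator_heat)
    fix k :: "int ^ 'n"
    show "norm (complex_of_real (levy_const s) * heat r (chr k) x) \<le> levy_const s * exp (- r * eig k)"
      using levy_const_nonneg[of s] r by (simp add: heat_chr norm_mult)
    have "(LINT \<sigma>:{0<..}|lborel. complex_of_real (\<sigma> powr (- 1 - s)) * (heat r (chr k) x - heat (r + \<sigma>) (chr k) x)) =
        (LINT \<sigma>:{0<..}|lborel. complex_of_real (\<sigma> powr (- 1 - s) * (1 - exp (- (eig k * \<sigma>)))) * heat r (chr k) x)"
    proof (rule set_lebesgue_integral_cong, simp, intro allI impI)
      fix \<sigma> :: real assume "\<sigma> \<in> {0<..}"
      then have "heat (r + \<sigma>) (chr k) x = complex_of_real (exp (- (r + \<sigma>) * eig k)) * chr k x"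
        using r by (intro heat_chr) simp
      moreover have "exp (- (r + \<sigma>) * eig k) = exp (- (eig k * \<sigma>)) * exp (- r * eig k)"
        by (simp add: algebra_simps flip: exp_add)
      ultimately have "heat (r + \<sigma>) (chr k) x = complex_of_real (exp (- (eig k * \<sigma>))) * heat r (chr k) x"
        using r by (simp add: heat_chr)
      then show "complex_of_real (\<sigma> powr (- 1 - s)) * (heat r (chr k) x - heat (r + \<sigma>) (chr k) x) =
          complex_of_real (\<sigma> powr (- 1 - s) * (1 - exp (- (eig k * \<sigma>)))) * heat r (chr k) x"
        by (simp add: algebra_simps)
    qed
    also have "\<dots> = complex_of_real (LINT \<sigma>:{0<..}|lborel. \<sigma> powr (- 1 - s) * (1 - exp (- (eig k * \<sigma>)))) * heat r (chr k) x"
      unfolding set_integral_mult_left set_integral_complex_of_real ..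
    also have "(LINT \<sigma>:{0<..}|lborel. \<sigma> powr (- 1 - s) * (1 - exp (- (eig k * \<sigma>)))) = eig k powr s * levy_const s"
    proof (cases "eig k = 0")
      case False
      then have l: "eig k > 0" using eig_nonneg[of k] by linarith
      show ?thesis
        using powr_integral_scale[OF l, of "- 1 - s" "\<lambda>\<sigma>. 1 - exp (- \<sigma>)"] by (simp add: levy_const_def)
    qed (simp add: set_lebesgue_integral_def)
    finally show "(LINT \<sigma>:{0<..}|lborel. complex_of_real (\<sigma> powr (- 1 - s)) * (heat r (chr k) x - heat (r + \<sigma>) (chr k) x)) =
        complex_of_real (eig k powr s) * (complex_of_real (levy_const s) * heat r (chr k) x)"
      by simp
  qed (use uz s r in \<open>auto simp: frac_pair_def\<close>)
  have u: "cont_periodic u" using uz by (simp add: frac_pair_def)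
  obtain b where b: "\<And>x. norm (u x) \<le> b" using cont_periodic_bounded[OF u] by blast
  show ?int
  proof (rule set_integrable_bound)
    show "set_integrable lborel {0<..} (\<lambda>\<sigma>. ?B \<sigma> * b)"
      using set_integrable_mult_left[of b lborel "{0<..}" ?B] B by blast
    show "set_borel_measurable lborel {0<..} (\<lambda>\<sigma>. complex_of_real (\<sigma> powr (- 1 - s)) * (heat r u x - heat (r + \<sigma>) u x))"
      unfolding set_borel_measurable_def using meas[OF u] by measurable
    show "AE \<sigma> in lborel. \<sigma> \<in> {0<..} \<longrightarrow>
        norm (complex_of_real (\<sigma> powr (- 1 - s)) * (heat r u x - heat (r + \<sigma>) u x)) \<le> norm (?B \<sigma> * b)"
    proof (intro AE_I2 impI)
      fix \<sigma> :: real assume "\<sigma> \<in> {0<..}"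
      from bound[OF this u b] show "norm (complex_of_real (\<sigma> powr (- 1 - s)) * (heat r u x - heat (r + \<sigma>) u x)) \<le> norm (?B \<sigma> * b)"
        unfolding real_norm_def by (rule order_trans[OF _ abs_ge_self])
    qed
  qed
qed

section \<open>The smoothed bi-Laplacian\<close>

text \<open>
  \<open>\<Delta>\<^sup>2 G\<^sub>r h\<close>, written as a product of two second order operators so that each factor can be estimated by
  itself.
\<close>

definition bilap :: "real \<Rightarrow> (real ^ 'n::finite \<Rightarrow> complex) \<Rightarrow> real ^ 'n \<Rightarrow> complex" where
  "bilap r h = heat_lap (r / 2) (heat_lap (r / 2) h)"

lemma bl_operator_compose:
  assumes A: "bl_operator A" and B: "bl_operator B"
  shows "bl_operator (\<lambda>h. A (B h))"
proof -
  obtain a where a: "a \<ge> 0" "\<And>f b x. cont_periodic f \<Longrightarrow> (\<And>x. norm (f x) \<le> b) \<Longrightarrow> norm (A f x) \<le> a * b"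
    using A unfolding bl_operator_def by blast
  obtain a' where a': "a' \<ge> 0" "\<And>f b x. cont_periodic f \<Longrightarrow> (\<And>x. norm (f x) \<le> b) \<Longrightarrow> norm (B f x) \<le> a' * b"
    using B unfolding bl_operator_def by blast
  have "norm (A (B f) x) \<le> (a * a') * b" if f: "cont_periodic f" "\<And>x. norm (f x) \<le> b" for f b x
    using a(2)[OF bl_operator_cont_periodic[OF B f(1)] a'(2)[OF f]] by (simp add: mult.assoc)
  then have "\<exists>c\<ge>0. \<forall>f b x. cont_periodic f \<longrightarrow> (\<forall>x. norm (f x) \<le> b) \<longrightarrow> norm (A (B f) x) \<le> c * b"
    using a(1) a'(1) by (intro exI[of _ "a * a'"]) simp
  then show ?thesis using A B unfolding bl_operator_def by simp
qed

lemma bl_operator_bilap: "bl_operator (bilap r)"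
  unfolding bilap_def[abs_def] by (rule bl_operator_compose[OF bl_operator_heat_lap bl_operator_heat_lap])

lemma heat_bilap:
  assumes "r > 0" "\<sigma> \<ge> 0" "cont_periodic h"
  shows "heat \<sigma> (bilap r h) x = bilap (r + \<sigma>) h x"
proof -
  have "heat \<sigma> (bilap r h) x = heat_lap (\<sigma> + r / 2) (heat_lap (r / 2) h) x"
    unfolding bilap_def using assms by (intro heat_heat_lap cont_periodic_heat_lap) auto
  also have "\<dots> = bilap (r + \<sigma>) h x"
    unfolding bilap_def using assms by (intro heat_lap_heat_lap) auto
  finally show ?thesis .
qed

text \<open>
  The heat semigroup is an average, so the maximum of \<open>bilap r h\<close> decreases in \<open>r\<close>.  In the maximum principle
  this makes the part \<open>\<sigma> \<le> r\<close> of the Levy integral nonnegative.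
\<close>

lemma norm_bilap_shift_le:
  assumes "r > 0" "\<sigma> \<ge> 0" "cont_periodic h" "\<And>x. norm (bilap r h x) \<le> m"
  shows "norm (bilap (r + \<sigma>) h x) \<le> m"
  unfolding heat_bilap[OF assms(1-3), symmetric] by (rule norm_heat_le[OF assms(4)])

lemma bilap_bound:
  "\<exists>C\<ge>0. \<forall>r>0. \<forall>(h :: real ^ 'n::finite \<Rightarrow> complex) b x. (\<forall>x. norm (h x) \<le> b) \<longrightarrow> norm (bilap r h x) \<le> C / r\<^sup>2 * b"
proof -
  obtain C where C: "C \<ge> 0" "\<And>r (h :: real ^ 'n \<Rightarrow> complex) b x. r > 0 \<Longrightarrow> (\<And>x. norm (h x) \<le> b) \<Longrightarrow> norm (heat_lap r h x) \<le> C / r * b"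
    using heat_lap_bound[where 'n = 'n] by blast
  show ?thesis
  proof (intro exI[of _ "4 * C\<^sup>2"] conjI allI impI)
    fix r :: real and h :: "real ^ 'n \<Rightarrow> complex" and b x
    assume r: "r > 0" and h: "\<forall>x. norm (h x) \<le> b"
    have "norm (bilap r h x) \<le> C / (r / 2) * (C / (r / 2) * b)"
      unfolding bilap_def by (intro C(2)) (use r h in auto)
    then show "norm (bilap r h x) \<le> 4 * C\<^sup>2 / r\<^sup>2 * b" by (simp add: power2_eq_square)
  qed simp
qed

lemma bilap_holder_bound:
  assumes "0 \<le> \<beta>" "\<beta> \<le> 2"
  shows "\<exists>C\<ge>0. \<forall>r>0. \<forall>(h :: real ^ 'n::finite \<Rightarrow> complex) H x. cont_periodic h \<longrightarrow>
    (\<forall>x y. norm (h x - h y) \<le> H * norm (x - y) powr \<beta>) \<longrightarrow>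
    norm (bilap r h x) \<le> C * H * r powr (\<beta> / 2 - 2)"
proof -
  obtain C where C: "C \<ge> 0" "\<And>r (h :: real ^ 'n \<Rightarrow> complex) b x. r > 0 \<Longrightarrow> (\<And>x. norm (h x) \<le> b) \<Longrightarrow> norm (heat_lap r h x) \<le> C / r * b"
    using heat_lap_bound[where 'n = 'n] by blast
  obtain D where D: "D \<ge> 0" "\<And>r (h :: real ^ 'n \<Rightarrow> complex) H x. r > 0 \<Longrightarrow> cont_periodic h \<Longrightarrow>
      (\<forall>x y. norm (h x - h y) \<le> H * norm (x - y) powr \<beta>) \<Longrightarrow> norm (heat_lap r h x) \<le> D * H * r powr (\<beta> / 2 - 1)"
    using heat_lap_holder_bound[OF assms, where 'n = 'n] by blast
  let ?k = "2 powr (1 - \<beta> / 2)"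
  show ?thesis
  proof (intro exI[of _ "2 * C * D * ?k"] conjI allI impI)
    fix r :: real and h :: "real ^ 'n \<Rightarrow> complex" and H x
    assume r: "r > 0" and h: "cont_periodic h" "\<forall>x y. norm (h x - h y) \<le> H * norm (x - y) powr \<beta>"
    have "norm (bilap r h x) \<le> C / (r / 2) * (D * H * (r / 2) powr (\<beta> / 2 - 1))"
      unfolding bilap_def by (intro C(2) D(2)) (use r h in auto)
    also have "(r / 2) powr (\<beta> / 2 - 1) = r powr (\<beta> / 2 - 1) * ?k"
      using r by (simp add: powr_divide powr_diff)
    also have "r powr (\<beta> / 2 - 1) = r * r powr (\<beta> / 2 - 2)"
      using r by (simp add: powr_diff power2_eq_square)
    finally show "norm (bilap r h x) \<le> 2 * C * D * ?k * H * r powr (\<beta> / 2 - 2)"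
      using r by (simp add: mult.assoc mult.commute mult.left_commute)
  qed (use C D in simp)
qed

text \<open>
  The formula \<open>heat_frac_levy\<close> for the pair \<open>\<Delta>\<^sup>2 G u\<close>, \<open>\<Delta>\<^sup>2 G z\<close>; a quarter of the heat time is kept outside
  the pair, because that formula needs a smoothing factor.
\<close>

lemma bilap_levy:
  fixes u z :: "real ^ 'n::finite \<Rightarrow> complex"
  assumes s: "0 < s" "s < 1" and r: "r > 0" and uz: "frac_pair s u z"
  shows "complex_of_real (levy_const s) * bilap r z x =
    (LINT \<sigma>:{0<..}|lborel. complex_of_real (\<sigma> powr (- 1 - s)) * (bilap r u x - bilap (r + \<sigma>) u x))"
    and "set_integrable lborel {0<..} (\<lambda>\<sigma>. complex_of_real (\<sigma> powr (- 1 - s)) * (bilap r u x - bilap (r + \<sigma>) u x))"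
proof -
  let ?g = "\<lambda>h. heat_lap (r / 4) (heat_lap (r / 2) h)"
  have cu: "cont_periodic u" and cz: "cont_periodic z" using uz by (auto simp: frac_pair_def)
  have pair: "frac_pair s (?g u) (?g z)"
    using uz r by (intro frac_pair_heat_lap) auto
  have eq: "heat (r / 4 + \<sigma>) (?g h) x = bilap (r + \<sigma>) h x" if "\<sigma> \<ge> 0" "cont_periodic h" for \<sigma> h
  proof -
    have "heat (r / 4 + \<sigma>) (?g h) x = heat_lap ((r / 4 + \<sigma>) + r / 4) (heat_lap (r / 2) h) x"
      using that r by (intro heat_heat_lap cont_periodic_heat_lap) auto
    also have "\<dots> = bilap (r + \<sigma>) h x"
      unfolding bilap_def using that r by (intro heat_lap_heat_lap) auto
    finally show ?thesis .
  qed
  have r4: "r / 4 > 0" using r by simp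
  have e0: "heat (r / 4) (?g h) x = bilap r h x" if "cont_periodic h" for h
    using eq[of 0 h] that by simp
  have cong: "complex_of_real (\<sigma> powr (- 1 - s)) * (heat (r / 4) (?g u) x - heat (r / 4 + \<sigma>) (?g u) x) =
      complex_of_real (\<sigma> powr (- 1 - s)) * (bilap r u x - bilap (r + \<sigma>) u x)" if "\<sigma> \<in> {0<..}" for \<sigma>
    using eq[of \<sigma> u] e0[OF cu] cu that by simp
  show "complex_of_real (levy_const s) * bilap r z x =
    (LINT \<sigma>:{0<..}|lborel. complex_of_real (\<sigma> powr (- 1 - s)) * (bilap r u x - bilap (r + \<sigma>) u x))"
  proof -
    have "(LINT \<sigma>:{0<..}|lborel. complex_of_real (\<sigma> powr (- 1 - s)) * (heat (r / 4) (?g u) x - heat (r / 4 + \<sigma>) (?g u) x)) =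
      (LINT \<sigma>:{0<..}|lborel. complex_of_real (\<sigma> powr (- 1 - s)) * (bilap r u x - bilap (r + \<sigma>) u x))"
      by (rule set_lebesgue_integral_cong) (use cong in auto)
    then show ?thesis using heat_frac_levy(1)[OF s r4 pair, of x] by (simp only: e0[OF cz])
  qed
  show "set_integrable lborel {0<..} (\<lambda>\<sigma>. complex_of_real (\<sigma> powr (- 1 - s)) * (bilap r u x - bilap (r + \<sigma>) u x))"
    by (rule iffD1[OF set_integrable_cong[OF refl refl] heat_frac_levy(2)[OF s r4 pair, of x]], rule cong, assumption)
qed

lemma heat_lap_gamma:
  fixes u z :: "real ^ 'n::finite \<Rightarrow> complex"
  assumes s: "0 < s" "s < 1" and r: "r > 0" and uz: "frac_pair s u z"
  shows "complex_of_real (gamma_const s) * heat_lap r z x =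
    (LINT \<sigma>:{0<..}|lborel. complex_of_real (\<sigma> powr (- s)) * bilap (r + \<sigma>) u x)"
proof -
  have cu: "cont_periodic u" and cz: "cont_periodic z" using uz by (auto simp: frac_pair_def)
  have r2: "r / 2 > 0" using r by simp
  have pair: "frac_pair s (heat_lap (r / 2) u) (heat_lap (r / 2) z)"
    by (rule frac_pair_heat_lap[OF r2 uz])
  have "heat (r / 2) (heat_lap (r / 2) z) x = heat_lap r z x"
    using heat_heat_lap[of "r / 2" "r / 2" z x] r cz by simp
  moreover have "heat_lap (r / 2 + \<sigma>) (heat_lap (r / 2) u) x = bilap (r + \<sigma>) u x" if "\<sigma> \<in> {0<..}" for \<sigma>
    unfolding bilap_def using r that cu by (intro heat_lap_heat_lap) auto
  then have "(LINT \<sigma>:{0<..}|lborel. complex_of_real (\<sigma> powr (- s)) * heat_lap (r / 2 + \<sigma>) (heat_lap (r / 2) u) x) =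
      (LINT \<sigma>:{0<..}|lborel. complex_of_real (\<sigma> powr (- s)) * bilap (r + \<sigma>) u x)"
    by (intro set_lebesgue_integral_cong) auto
  ultimately show ?thesis
    using heat_frac_gamma[OF s r2 pair, of x] by simp
qed

section \<open>The maximum principle\<close>

definition cont_cyl :: "real \<Rightarrow> (real ^ 'n::finite \<Rightarrow> real \<Rightarrow> complex) \<Rightarrow> bool" where
  "cont_cyl T v \<longleftrightarrow> (\<forall>t\<in>{0..T}. periodic (\<lambda>x. v x t)) \<and> continuous_on (UNIV \<times> {0..T}) (\<lambda>(x, t). v x t)"

lemma cont_cyl_slice: "cont_cyl T v \<Longrightarrow> t \<in> {0..T} \<Longrightarrow> cont_periodic (\<lambda>x. v x t)"
  unfolding cont_cyl_def cont_periodic_def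
  by (auto intro!: continuous_on_compose2[of "UNIV \<times> {0..T}" "\<lambda>(x, t). v x t" UNIV "\<lambda>x. (x, t)", simplified] continuous_intros)

text \<open>
  By periodicity the uniform continuity on the compact set \<open>cbox 0 1 \<times> {0..T}\<close> extends to all \<open>x\<close>.
\<close>

lemma cont_cyl_uniform_in_time:
  assumes v: "cont_cyl T v" and t0: "t\<^sub>0 \<in> {0..T}" and e: "e > 0"
  obtains d where "d > 0" "\<And>t x. t \<in> {0..T} \<Longrightarrow> \<bar>t - t\<^sub>0\<bar> < d \<Longrightarrow> norm (v x t - v x t\<^sub>0) \<le> e"
proof -
  let ?K = "cbox 0 1 \<times> {0..T} :: ((real ^ 'a) \<times> real) set"
  have "continuous_on ?K (\<lambda>(x, t). v x t)"
    using v unfolding cont_cyl_def by (elim conjE continuous_on_subset) auto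
  then have uc: "uniformly_continuous_on ?K (\<lambda>(x, t). v x t)"
    by (intro compact_uniformly_continuous compact_Times compact_cbox compact_Icc)
  obtain d where d0: "d > 0" and d':
    "\<forall>p\<in>?K. \<forall>q\<in>?K. dist q p < d \<longrightarrow> dist (case q of (x, t) \<Rightarrow> v x t) (case p of (x, t) \<Rightarrow> v x t) < e"
    using uc[unfolded uniformly_continuous_on_def, THEN spec, THEN mp, OF e] by (elim exE conjE)
  have d: "p \<in> ?K \<Longrightarrow> q \<in> ?K \<Longrightarrow> dist q p < d \<Longrightarrow>
      dist (case q of (x, t) \<Rightarrow> v x t) (case p of (x, t) \<Rightarrow> v x t) < e" for p q
    using d' by blast
  show ?thesis
  proof (rule that[OF d0])
    fix t and x :: "real ^ 'a" assume t: "t \<in> {0..T}" "\<bar>t - t\<^sub>0\<bar> < d"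
    obtain k where k: "x + freq k \<in> cbox 0 1" by (rule cube_representative)
    have "dist (x + freq k, t) (x + freq k, t\<^sub>0) < d" using t by (simp add: dist_Pair_Pair dist_real_def)
    then have "dist (v (x + freq k) t) (v (x + freq k) t\<^sub>0) < e"
      using d[of "(x + freq k, t\<^sub>0)" "(x + freq k, t)"] k t t0 by simp
    moreover have "v (x + freq k) t = v x t" "v (x + freq k) t\<^sub>0 = v x t\<^sub>0"
      using v t t0 periodic_shift_freq[of "\<lambda>x. v x t" x k] periodic_shift_freq[of "\<lambda>x. v x t\<^sub>0" x k]
      unfolding cont_cyl_def by auto
    ultimately show "norm (v x t - v x t\<^sub>0) \<le> e" by (simp add: dist_norm)
  qed
qed

lemma cont_cyl_bounded:
  assumes v: "cont_cyl T v" obtains b where "b \<ge> 0" "\<And>x t. t \<in> {0..T} \<Longrightarrow> norm (v x t) \<le> b"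
proof -
  have "compact ((\<lambda>(x, t). v x t) ` (cbox 0 1 \<times> {0..T}))"
    using v unfolding cont_cyl_def
    by (intro compact_continuous_image compact_Times compact_cbox compact_Icc)
       (auto intro: continuous_on_subset)
  then have "bounded ((\<lambda>(x, t). v x t) ` (cbox 0 1 \<times> {0..T}))" by (rule compact_imp_bounded)
  then obtain b where b': "\<forall>y\<in>(\<lambda>(x, t). v x t) ` (cbox 0 1 \<times> {0..T}). norm y \<le> b"
    unfolding bounded_iff by blast
  have b: "norm (v x t) \<le> b" if "x \<in> cbox 0 1" "t \<in> {0..T}" for x t
  proof -
    have "v x t \<in> (\<lambda>(x, t). v x t) ` (cbox 0 1 \<times> {0..T})"
      by (rule image_eqI[of _ _ "(x, t)"]) (use that in auto)
    then show ?thesis using b' by blast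
  qed
  have "norm (v x t) \<le> max 0 b" if t: "t \<in> {0..T}" for x t
  proof -
    obtain k where k: "x + freq k \<in> cbox 0 1" by (rule cube_representative)
    have "v (x + freq k) t = v x t"
      using v t periodic_shift_freq[of "\<lambda>x. v x t" x k] unfolding cont_cyl_def by auto
    then show ?thesis using b[OF k t] by simp
  qed
  then show ?thesis using that[of "max 0 b"] by simp
qed

lemma cont_cyl_operator:
  assumes A: "bl_operator A" and u: "cont_cyl T u"
  shows "cont_cyl T (\<lambda>x t. A (\<lambda>y. u y t) x)"
proof -
  have cp: "cont_periodic (A (\<lambda>y. u y t))" if "t \<in> {0..T}" for t
    by (rule bl_operator_cont_periodic[OF A cont_cyl_slice[OF u that]])
  obtain B where B: "B \<ge> 0" "\<And>f b x. cont_periodic f \<Longrightarrow> (\<And>x. norm (f x) \<le> b) \<Longrightarrow> norm (A f x) \<le> B * b"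
    using A unfolding bl_operator_def by blast
  have "continuous_on (UNIV \<times> {0..T}) (\<lambda>(x, t). A (\<lambda>y. u y t) x)"
    unfolding continuous_on_iff
  proof (intro ballI allI impI)
    fix p :: "(real ^ 'a) \<times> real" and e :: real assume p: "p \<in> UNIV \<times> {0..T}" and e: "e > 0"
    obtain x0 t0 where pp: "p = (x0, t0)" and t0: "t0 \<in> {0..T}" using p by auto
    define e' where "e' = e / (2 * (B + 1))"
    have e': "e' > 0" "B * e' < e / 2"
      using e B(1) by (auto simp: e'_def field_simps)
    obtain d1 where d1: "d1 > 0" "\<And>t x. t \<in> {0..T} \<Longrightarrow> \<bar>t - t0\<bar> < d1 \<Longrightarrow> norm (u x t - u x t0) \<le> e'"
      using cont_cyl_uniform_in_time[OF u t0 e'(1)] by blast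
    have "isCont (A (\<lambda>y. u y t0)) x0"
      using cp[OF t0] unfolding cont_periodic_def by (simp add: continuous_on_eq_continuous_at)
    then obtain d2 where d2: "d2 > 0" "\<And>x. dist x x0 < d2 \<Longrightarrow> dist (A (\<lambda>y. u y t0) x) (A (\<lambda>y. u y t0) x0) < e / 2"
      unfolding continuous_at_eps_delta using e half_gt_zero by blast
    show "\<exists>d>0. \<forall>q\<in>UNIV \<times> {0..T}. dist q p < d \<longrightarrow>
        dist (case q of (x, t) \<Rightarrow> A (\<lambda>y. u y t) x) (case p of (x, t) \<Rightarrow> A (\<lambda>y. u y t) x) < e"
    proof (intro exI[of _ "min d1 d2"] conjI ballI impI)
      fix q :: "(real ^ 'a) \<times> real" assume q: "q \<in> UNIV \<times> {0..T}" "dist q p < min d1 d2"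
      obtain x t where qq: "q = (x, t)" and t: "t \<in> {0..T}" using q by auto
      have dx: "dist x x0 < d2" and dt: "\<bar>t - t0\<bar> < d1"
        using q(2) dist_fst_le[of q p] dist_snd_le[of q p] by (auto simp: qq pp dist_real_def)
      have "A (\<lambda>y. u y t - u y t0) x = A (\<lambda>y. u y t) x - A (\<lambda>y. u y t0) x"
        by (rule bl_functional_diff[OF bl_functional_apply[OF A] cont_cyl_slice[OF u t] cont_cyl_slice[OF u t0]])
      moreover have "norm (A (\<lambda>y. u y t - u y t0) x) \<le> B * e'"
        by (rule B(2)[OF cont_periodic_diff[OF cont_cyl_slice[OF u t] cont_cyl_slice[OF u t0]] d1(2)[OF t dt]])
      ultimately have "dist (A (\<lambda>y. u y t) x) (A (\<lambda>y. u y t0) x) < e / 2"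
        using e'(2) by (simp add: dist_norm)
      then have "dist (A (\<lambda>y. u y t) x) (A (\<lambda>y. u y t0) x0) < e"
        using d2(2)[OF dx] dist_triangle[of "A (\<lambda>y. u y t) x" "A (\<lambda>y. u y t0) x0" "A (\<lambda>y. u y t0) x"]
        by linarith
      then show "dist (case q of (x, t) \<Rightarrow> A (\<lambda>y. u y t) x) (case p of (x, t) \<Rightarrow> A (\<lambda>y. u y t) x) < e"
        by (simp add: qq pp)
    qed (use d1 d2 in simp)
  qed
  then show ?thesis using cp unfolding cont_cyl_def cont_periodic_def by auto
qed

lemma cont_cyl_attains_max:
  assumes v: "cont_cyl T v" and T: "T \<ge> 0"
  obtains x\<^sub>0 t\<^sub>0 where "t\<^sub>0 \<in> {0..T}" "\<And>x t. t \<in> {0..T} \<Longrightarrow> norm (v x t) \<le> norm (v x\<^sub>0 t\<^sub>0)"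
proof -
  let ?K = "cbox 0 1 \<times> {0..T} :: ((real ^ 'a) \<times> real) set"
  have "continuous_on ?K (\<lambda>p. norm (case p of (x, t) \<Rightarrow> v x t))"
    using v unfolding cont_cyl_def by (intro continuous_on_norm) (auto intro: continuous_on_subset)
  moreover have "(0, 0) \<in> ?K" using T by (auto simp: mem_box_cart)
  then have "?K \<noteq> {}" by blast
  moreover have "compact ?K" by (intro compact_Times compact_cbox compact_Icc)
  ultimately have "\<exists>p\<in>?K. \<forall>q\<in>?K. norm (case q of (x, t) \<Rightarrow> v x t) \<le> norm (case p of (x, t) \<Rightarrow> v x t)"
    by (intro continuous_attains_sup)
  then obtain p where p: "p \<in> ?K" "\<And>q. q \<in> ?K \<Longrightarrow> norm (case q of (x, t) \<Rightarrow> v x t) \<le> norm (case p of (x, t) \<Rightarrow> v x t)"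
    by blast
  have "norm (v x t) \<le> norm (v (fst p) (snd p))" if t: "t \<in> {0..T}" for x t
  proof -
    obtain k where k: "x + freq k \<in> cbox 0 1" by (rule cube_representative)
    have "v (x + freq k) t = v x t"
      using v t periodic_shift_freq[of "\<lambda>x. v x t" x k] unfolding cont_cyl_def by auto
    then show ?thesis using p(2)[of "(x + freq k, t)"] k t by (simp add: case_prod_beta)
  qed
  then show ?thesis using that[of "snd p" "fst p"] p(1) by auto
qed

text \<open>
  The derivative of \<open>u\<close> in time exists pointwise in \<open>x\<close>, and uniform continuity of \<open>v\<close> makes the difference
  quotients converge uniformly; hence a bounded functional may be applied to them.  At a maximum in time
  before \<open>T\<close> the right derivative is nonpositive.
\<close>

lemma derivative_at_max_nonpos:
  assumes u: "cont_cyl T u" and v: "cont_cyl T v"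
    and deriv: "\<And>x t. t \<in> {0..T} \<Longrightarrow> (u x has_vector_derivative v x t) (at t within {0..T})"
    and L: "bl_functional \<Lambda>" and t0: "0 \<le> t\<^sub>0" "t\<^sub>0 < T"
    and max: "\<And>t. t \<in> {0..T} \<Longrightarrow> Re (\<omega> * \<Lambda> (\<lambda>x. u x t)) \<le> Re (\<omega> * \<Lambda> (\<lambda>x. u x t\<^sub>0))"
  shows "Re (\<omega> * \<Lambda> (\<lambda>x. v x t\<^sub>0)) \<le> 0"
proof -
  have t0': "t\<^sub>0 \<in> {0..T}" using t0 by simp
  obtain B where B: "B \<ge> 0" "\<And>f b. cont_periodic f \<Longrightarrow> (\<And>x. norm (f x) \<le> b) \<Longrightarrow> norm (\<Lambda> f) \<le> B * b"
    using bl_functional_bound[OF L] by blast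
  have "Re (\<omega> * \<Lambda> (\<lambda>x. v x t\<^sub>0)) \<le> norm \<omega> * B * e" if e: "e > 0" for e
  proof -
    obtain d where d: "d > 0" "\<And>t x. t \<in> {0..T} \<Longrightarrow> \<bar>t - t\<^sub>0\<bar> < d \<Longrightarrow> norm (v x t - v x t\<^sub>0) \<le> e"
      using cont_cyl_uniform_in_time[OF v t0' e] by blast
    define t where "t = min T (t\<^sub>0 + d / 2)"
    have t: "t\<^sub>0 < t" "t \<in> {0..T}" "\<And>\<tau>. \<tau> \<in> {t\<^sub>0..t} \<Longrightarrow> \<tau> \<in> {0..T} \<and> \<bar>\<tau> - t\<^sub>0\<bar> < d"
      using t0 d(1) by (auto simp: t_def)
    \<comment> \<open>the first order Taylor remainder in time, uniformly small in \<open>x\<close>\<close>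
    let ?w = "\<lambda>x. (u x t - u x t\<^sub>0) - complex_of_real (t - t\<^sub>0) * v x t\<^sub>0"
    have w: "norm (?w x) \<le> (t - t\<^sub>0) * e" for x
    proof -
      have "norm (u x t - u x t\<^sub>0 - (t - t\<^sub>0) *\<^sub>R v x t\<^sub>0) \<le> norm (t - t\<^sub>0) * e"
      proof (rule vector_differentiable_bound_linearization)
        show "(u x has_vector_derivative v x \<tau>) (at \<tau> within {t\<^sub>0..t})" if "\<tau> \<in> {t\<^sub>0..t}" for \<tau>
          by (rule has_vector_derivative_within_subset[OF deriv]) (use t that in auto)
        show "closed_segment t\<^sub>0 t \<subseteq> {t\<^sub>0..t}" using t(1) by (simp add: closed_segment_eq_real_ivl)
        show "norm (v x \<tau> - v x t\<^sub>0) \<le> e" if "\<tau> \<in> {t\<^sub>0..t}" for \<tau>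
          using d(2) t(3)[OF that] by blast
      qed (use t in auto)
      then show ?thesis using t(1) by (simp add: scaleR_conv_of_real)
    qed
    note cu = cont_cyl_slice[OF u t(2)] and cu0 = cont_cyl_slice[OF u t0'] and cv = cont_cyl_slice[OF v t0']
    have cw: "cont_periodic ?w"
      by (intro cont_periodic_diff cont_periodic_cmult cu cu0 cv)
    have "\<Lambda> ?w = (\<Lambda> (\<lambda>x. u x t) - \<Lambda> (\<lambda>x. u x t\<^sub>0)) - complex_of_real (t - t\<^sub>0) * \<Lambda> (\<lambda>x. v x t\<^sub>0)"
      using bl_functional_diff[OF L cont_periodic_diff[OF cu cu0] cont_periodic_cmult[OF cv, of "complex_of_real (t - t\<^sub>0)"]]
        bl_functional_diff[OF L cu cu0] bl_functional_cmult[OF L cv] by simp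
    then have eq: "\<omega> * \<Lambda> ?w = \<omega> * \<Lambda> (\<lambda>x. u x t) - \<omega> * \<Lambda> (\<lambda>x. u x t\<^sub>0) - complex_of_real (t - t\<^sub>0) * (\<omega> * \<Lambda> (\<lambda>x. v x t\<^sub>0))"
      by (simp only: right_diff_distrib mult.left_commute)
    then have re: "(t - t\<^sub>0) * Re (\<omega> * \<Lambda> (\<lambda>x. v x t\<^sub>0)) = Re (\<omega> * \<Lambda> (\<lambda>x. u x t)) - Re (\<omega> * \<Lambda> (\<lambda>x. u x t\<^sub>0)) - Re (\<omega> * \<Lambda> ?w)"
    proof -
      have "Re (complex_of_real c * w) = c * Re w" for c w by simp
      then have "Re (\<omega> * \<Lambda> ?w) = Re (\<omega> * \<Lambda> (\<lambda>x. u x t)) - Re (\<omega> * \<Lambda> (\<lambda>x. u x t\<^sub>0)) - (t - t\<^sub>0) * Re (\<omega> * \<Lambda> (\<lambda>x. v x t\<^sub>0))"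
        unfolding eq by (simp only: minus_complex.simps)
      then show ?thesis by simp
    qed
    have "norm (\<omega> * \<Lambda> ?w) \<le> norm \<omega> * (B * ((t - t\<^sub>0) * e))"
      unfolding norm_mult by (intro mult_left_mono B(2)[OF cw w]) simp
    then have "- Re (\<omega> * \<Lambda> ?w) \<le> norm \<omega> * (B * ((t - t\<^sub>0) * e))"
      using abs_Re_le_cmod[of "\<omega> * \<Lambda> ?w"] by linarith
    then have "(t - t\<^sub>0) * Re (\<omega> * \<Lambda> (\<lambda>x. v x t\<^sub>0)) \<le> norm \<omega> * (B * ((t - t\<^sub>0) * e))"
      using max[OF t(2)] re by linarith
    also have "\<dots> = (t - t\<^sub>0) * (norm \<omega> * B * e)" by (simp only: mult.assoc mult.left_commute)
    finally show ?thesis using t(1) by (simp add: mult_le_cancel_left_pos)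
  qed
  note * = this
  have "Re (\<omega> * \<Lambda> (\<lambda>x. v x t\<^sub>0)) \<le> 0 + e" if e: "e > 0" for e
  proof -
    let ?c = "norm \<omega> * B"
    have c: "?c \<ge> 0" using B(1) by simp
    have "Re (\<omega> * \<Lambda> (\<lambda>x. v x t\<^sub>0)) \<le> ?c * (e / (?c + 1))" by (rule *) (use c e in auto)
    also have "\<dots> \<le> e" using c e by (simp add: field_simps)
    finally show ?thesis by simp
  qed
  then show ?thesis by (rule field_le_epsilon)
qed

text \<open>
  The central estimate.  Its constants depend neither on \<open>r\<close> nor on \<open>T\<close>, and the supremum \<open>M\<close> below
  is taken over parameters \<open>\<rho> \<ge> r\<close> only: for these it is finite by smoothing alone.
\<close>

theorem bilap_a_priori:
  fixes u z f :: "real ^ 'n::finite \<Rightarrow> real \<Rightarrow> complex"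
  assumes s: "0 < s" "s < 1" and \<beta>: "0 < \<beta>" "\<beta> < 1" and T: "T > 0"
    and \<kappa>: "\<kappa> = 2 - s - \<beta> / 2"
    and u: "cont_cyl T u" and z: "cont_cyl T z" and f: "cont_cyl T f"
    and pair: "\<And>t. t \<in> {0..T} \<Longrightarrow> frac_pair s (\<lambda>x. u x t) (\<lambda>x. z x t)"
    and deriv: "\<And>x t. t \<in> {0..T} \<Longrightarrow> (u x has_vector_derivative z x t + f x t) (at t within {0..T})"
    and F: "\<And>t r x. t \<in> {0..T} \<Longrightarrow> r > 0 \<Longrightarrow> norm (bilap r (\<lambda>x. f x t) x) \<le> N\<^sub>1 * r powr (\<beta> / 2 - 2)"
    and U: "\<And>r x. r > 0 \<Longrightarrow> norm (bilap r (\<lambda>x. u x T) x) \<le> N\<^sub>2 * r powr (- \<kappa>)"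
    and N: "N\<^sub>1 \<ge> 0" "N\<^sub>2 \<ge> 0"
    and tr: "t \<in> {0..T}" "r > 0"
  shows "norm (bilap r (\<lambda>x. u x t) x) \<le> (levy_const s * s * N\<^sub>1 + N\<^sub>2) / (1 - 2 powr (- \<kappa>)) * r powr (- \<kappa>)"
proof -
  define D where "D = levy_const s * s * N\<^sub>1 + N\<^sub>2"
  have D: "D \<ge> 0" "N\<^sub>2 \<le> D" using levy_const_nonneg[of s] s N by (auto simp: D_def)
  have \<kappa>': "0 < \<kappa>" "\<kappa> < 2" using s \<beta> \<kappa> by auto
  define y where "y \<rho> x t = bilap \<rho> (\<lambda>x. u x t) x" for \<rho> x t
  define P where "P = (\<lambda>(\<rho>, x, t). \<rho> powr \<kappa> * norm (y \<rho> x t)) ` ({r..} \<times> UNIV \<times> {0..T})"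
  define M where "M = Sup P"
  have bdd: "bdd_above P"
  proof -
    obtain C where C: "C \<ge> 0" "\<And>r (h :: real ^ 'n \<Rightarrow> complex) b x. r > 0 \<Longrightarrow> (\<And>x. norm (h x) \<le> b) \<Longrightarrow> norm (bilap r h x) \<le> C / r\<^sup>2 * b"
      using bilap_bound[where 'n = 'n] by blast
    obtain b where b: "b \<ge> 0" "\<And>x t. t \<in> {0..T} \<Longrightarrow> norm (u x t) \<le> b"
      using cont_cyl_bounded[OF u] by blast
    have "\<rho> powr \<kappa> * norm (y \<rho> x t) \<le> C * b * r powr (\<kappa> - 2)" if \<rho>: "\<rho> \<ge> r" and t: "t \<in> {0..T}" for \<rho> x t
    proof -
      have "\<rho> powr \<kappa> * norm (y \<rho> x t) \<le> \<rho> powr \<kappa> * (C / \<rho>\<^sup>2 * b)"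
        unfolding y_def by (intro mult_left_mono C(2) b t) (use \<rho> tr in auto)
      also have "\<dots> = C * b * \<rho> powr (\<kappa> - 2)" using \<rho> tr by (simp add: powr_diff)
      also have "\<dots> \<le> C * b * r powr (\<kappa> - 2)"
        by (intro mult_left_mono powr_mono2') (use \<rho> tr \<kappa>' C(1) b(1) in auto)
      finally show ?thesis .
    qed
    then show ?thesis unfolding P_def by (intro bdd_aboveI[of _ "C * b * r powr (\<kappa> - 2)"]) auto
  qed
  have M_upper: "\<rho> powr \<kappa> * norm (y \<rho> x t) \<le> M" if "\<rho> \<ge> r" "t \<in> {0..T}" for \<rho> x t
    unfolding M_def by (rule cSup_upper[OF _ bdd]) (use that in \<open>auto simp: P_def intro!: image_eqI[of _ _ "(\<rho>, x, t)"]\<close>)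
  have M0: "M \<ge> 0" using M_upper[OF order_refl tr(1), of x] by (rule order_trans[rotated]) simp
  have y_le: "norm (y \<rho> x t) \<le> M * \<rho> powr (- \<kappa>)" if "\<rho> \<ge> r" "t \<in> {0..T}" for \<rho> x t
    using M_upper[OF that] tr that by (simp add: powr_minus field_simps)
  have step: "\<rho> powr \<kappa> * norm (y \<rho> x t) \<le> 2 powr (- \<kappa>) * M + D" if \<rho>: "\<rho> \<ge> r" and t: "t \<in> {0..T}" for \<rho> x t
  proof -
    have \<rho>0: "\<rho> > 0" using \<rho> tr by simp
    have cy: "cont_cyl T (y \<rho>)" unfolding y_def[abs_def] by (rule cont_cyl_operator[OF bl_operator_bilap u])
    obtain x0 t0 where t0: "t0 \<in> {0..T}" and max: "\<And>x t. t \<in> {0..T} \<Longrightarrow> norm (y \<rho> x t) \<le> norm (y \<rho> x0 t0)"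
      using cont_cyl_attains_max[OF cy] T by (metis less_imp_le)
    define m where "m = norm (y \<rho> x0 t0)"
    define q where "q = M * (2 * \<rho>) powr (- \<kappa>)"
    have \<rho>q: "\<rho> powr \<kappa> * q = 2 powr (- \<kappa>) * M"
      using \<rho>0 by (simp add: q_def powr_mult powr_minus field_simps)
    have "\<rho> powr \<kappa> * m \<le> 2 powr (- \<kappa>) * M + D"
    proof (cases "t0 = T \<or> m \<le> q")
      case True
      then show ?thesis
      proof
        assume "t0 = T"
        then have "m \<le> N\<^sub>2 * \<rho> powr (- \<kappa>)" using U[OF \<rho>0, of x0] by (simp add: m_def y_def)
        then have "\<rho> powr \<kappa> * m \<le> N\<^sub>2" using \<rho>0 by (simp add: powr_minus field_simps)
        moreover have "0 \<le> 2 powr (- \<kappa>) * M" using M0 by simp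
        ultimately show ?thesis using D by linarith
      next
        assume "m \<le> q"
        then have "\<rho> powr \<kappa> * m \<le> \<rho> powr \<kappa> * q" by (rule mult_left_mono) simp
        then show ?thesis unfolding \<rho>q using D by linarith
      qed
    next
      case False
      have q0: "q \<ge> 0" using M0 by (simp add: q_def)
      have m: "m > 0" "m > q" and t0T: "0 \<le> t0" "t0 < T" using False q0 t0 by auto
      \<comment> \<open>the phase that makes \<open>y \<rho>\<close> positive at the maximum point\<close>
      define \<omega> where "\<omega> = cnj (y \<rho> x0 t0) / complex_of_real m"
      have \<omega>: "norm \<omega> = 1" "\<omega> * y \<rho> x0 t0 = complex_of_real m"
      proof -
        show "norm \<omega> = 1" using m by (simp add: \<omega>_def norm_divide m_def)
        have "cnj (y \<rho> x0 t0) * y \<rho> x0 t0 = complex_of_real (m * m)"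
          by (simp add: m_def mult.commute[of "cnj _"] complex_norm_square[symmetric] power2_eq_square)
        then show "\<omega> * y \<rho> x0 t0 = complex_of_real m" using m by (simp add: \<omega>_def)
      qed
      let ?L = "\<lambda>h. bilap \<rho> h x0"
      have L: "bl_functional ?L" by (rule bl_functional_apply[OF bl_operator_bilap])
      have re_le: "Re (\<omega> * w) \<le> norm w" for w
        using complex_Re_le_cmod[of "\<omega> * w"] \<omega>(1) by (simp add: norm_mult)
      have czf: "cont_cyl T (\<lambda>x t. z x t + f x t)"
        using z f unfolding cont_cyl_def periodic_def case_prod_beta by (auto intro: continuous_on_add)
      have "Re (\<omega> * ?L (\<lambda>x. z x t0 + f x t0)) \<le> 0"
      proof (rule derivative_at_max_nonpos[OF u czf deriv L t0T])
        fix t assume t: "t \<in> {0..T}"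
        have "Re (\<omega> * ?L (\<lambda>x. u x t)) \<le> norm (y \<rho> x0 t)" unfolding y_def by (rule re_le)
        also have "\<dots> \<le> m" unfolding m_def by (rule max[OF t])
        also have "m = Re (\<omega> * ?L (\<lambda>x. u x t0))" using \<omega>(2) by (simp add: y_def)
        finally show "Re (\<omega> * ?L (\<lambda>x. u x t)) \<le> Re (\<omega> * ?L (\<lambda>x. u x t0))" .
      qed
      moreover have "?L (\<lambda>x. z x t0 + f x t0) = ?L (\<lambda>x. z x t0) + ?L (\<lambda>x. f x t0)"
        by (rule bl_functional_add[OF L cont_cyl_slice[OF z t0] cont_cyl_slice[OF f t0]])
      moreover have "- Re (\<omega> * ?L (\<lambda>x. f x t0)) \<le> N\<^sub>1 * \<rho> powr (\<beta> / 2 - 2)"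
        using re_le[of "- ?L (\<lambda>x. f x t0)"] F[OF t0 \<rho>0, of x0] by simp
      ultimately have upper: "Re (\<omega> * ?L (\<lambda>x. z x t0)) \<le> N\<^sub>1 * \<rho> powr (\<beta> / 2 - 2)"
        by (simp only: distrib_left plus_complex.simps)
      \<comment> \<open>Only the part \<open>\<sigma> \<ge> \<rho>\<close> of the Levy integral is kept; there \<open>|y (\<rho> + \<sigma>)|\<close> is at most \<open>q\<close>.\<close>
      let ?F = "\<lambda>\<sigma>. indicator {0<..} \<sigma> *\<^sub>R (complex_of_real (\<sigma> powr (- 1 - s)) * (y \<rho> x0 t0 - y (\<rho> + \<sigma>) x0 t0))"
      let ?G = "\<lambda>\<sigma>. 0 * (indicator {0..\<rho>} \<sigma> * \<sigma> powr (- 0)) + (m - q) * (indicator {\<rho>..} \<sigma> * \<sigma> powr (- (1 + s)))"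
      have Fi: "integrable lborel ?F"
        using bilap_levy(2)[OF s \<rho>0 pair[OF t0], of x0] unfolding set_integrable_def y_def .
      have Fe: "complex_of_real (levy_const s) * ?L (\<lambda>x. z x t0) = (LINT \<sigma>|lborel. ?F \<sigma>)"
        using bilap_levy(1)[OF s \<rho>0 pair[OF t0], of x0] unfolding set_lebesgue_integral_def y_def .
      have G: "integrable lborel ?G" "(LINT \<sigma>|lborel. ?G \<sigma>) = 0 * (\<rho> powr (1 - 0) / (1 - 0)) + (m - q) * (\<rho> powr (1 - (1 + s)) / ((1 + s) - 1))"
        by (rule powr_split_integral[OF \<rho>0], use s in simp, use s in simp)+
      have "(LINT \<sigma>|lborel. ?G \<sigma>) \<le> (LINT \<sigma>|lborel. Re (\<omega> * ?F \<sigma>))"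
      proof (rule Bochner_Integration.integral_mono[OF G(1)])
        show "integrable lborel (\<lambda>\<sigma>. Re (\<omega> * ?F \<sigma>))" by (intro integrable_Re integrable_mult_right Fi)
        fix \<sigma> :: real
        show "?G \<sigma> \<le> Re (\<omega> * ?F \<sigma>)"
        proof (cases "\<sigma> > 0")
          case False
          then show ?thesis using \<rho>0 by simp
        next
          case True
          have "\<omega> * ?F \<sigma> = complex_of_real (\<sigma> powr (- 1 - s)) * (complex_of_real m - \<omega> * y (\<rho> + \<sigma>) x0 t0)"
            using True by (simp add: \<omega>(2)[symmetric] algebra_simps)
          then have ReF: "Re (\<omega> * ?F \<sigma>) = \<sigma> powr (- 1 - s) * (m - Re (\<omega> * y (\<rho> + \<sigma>) x0 t0))"
            by (simp only: Re_complex_of_real minus_complex.simps) simp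
          show ?thesis
          proof (cases "\<sigma> < \<rho>")
            case True': True
            have "norm (y (\<rho> + \<sigma>) x0 t0) \<le> m"
              unfolding y_def
              by (rule norm_bilap_shift_le[OF \<rho>0 _ cont_cyl_slice[OF u t0]])
                 (use True max[OF t0] in \<open>auto simp: m_def y_def\<close>)
            then have "0 \<le> \<sigma> powr (- 1 - s) * (m - Re (\<omega> * y (\<rho> + \<sigma>) x0 t0))"
              using re_le[of "y (\<rho> + \<sigma>) x0 t0"] by (intro mult_nonneg_nonneg) auto
            then show ?thesis unfolding ReF using True' by simp
          next
            case False
            have "norm (y (\<rho> + \<sigma>) x0 t0) \<le> M * (\<rho> + \<sigma>) powr (- \<kappa>)"
              by (rule y_le[OF _ t0]) (use \<rho> True in simp)
            also have "\<dots> \<le> q" unfolding q_def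
              by (intro mult_left_mono powr_mono2' M0) (use False \<rho>0 \<kappa>' in auto)
            finally have "m - q \<le> m - Re (\<omega> * y (\<rho> + \<sigma>) x0 t0)"
              using re_le[of "y (\<rho> + \<sigma>) x0 t0"] by simp
            then have "\<sigma> powr (- 1 - s) * (m - q) \<le> \<sigma> powr (- 1 - s) * (m - Re (\<omega> * y (\<rho> + \<sigma>) x0 t0))"
              by (rule mult_left_mono) simp
            then show ?thesis unfolding ReF using False by (simp add: mult.commute)
          qed
        qed
      qed
      also have "\<dots> = Re (\<omega> * (LINT \<sigma>|lborel. ?F \<sigma>))"
        by (simp only: integral_Re[OF integrable_mult_right[OF Fi]] integral_mult_right_zero)
      also have "\<dots> = levy_const s * Re (\<omega> * ?L (\<lambda>x. z x t0))"
      proof -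
        have "Re (complex_of_real c * w) = c * Re w" for c w by simp
        then show ?thesis unfolding Fe[symmetric] mult.left_commute[of \<omega>] by blast
      qed
      also have "\<dots> \<le> levy_const s * (N\<^sub>1 * \<rho> powr (\<beta> / 2 - 2))"
        by (rule mult_left_mono[OF upper levy_const_nonneg])
      finally have "(m - q) * (\<rho> powr (- s) / s) \<le> levy_const s * (N\<^sub>1 * \<rho> powr (\<beta> / 2 - 2))"
        unfolding G(2) by simp
      then have "(s * \<rho> powr (s + \<kappa>)) * ((m - q) * (\<rho> powr (- s) / s)) \<le> (s * \<rho> powr (s + \<kappa>)) * (levy_const s * (N\<^sub>1 * \<rho> powr (\<beta> / 2 - 2)))"
        by (rule mult_left_mono) (use s in simp)
      moreover have "(s * \<rho> powr (s + \<kappa>)) * ((m - q) * (\<rho> powr (- s) / s)) = \<rho> powr \<kappa> * (m - q)"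
        using s \<rho>0 by (simp add: powr_add powr_minus field_simps)
      moreover have "(s * \<rho> powr (s + \<kappa>)) * (levy_const s * (N\<^sub>1 * \<rho> powr (\<beta> / 2 - 2))) = levy_const s * s * N\<^sub>1"
      proof -
        have "\<rho> powr (s + \<kappa>) * \<rho> powr (\<beta> / 2 - 2) = 1"
          using \<rho>0 \<kappa> by (simp flip: powr_add)
        then show ?thesis by (simp add: mult.assoc mult.left_commute)
      qed
      ultimately have "\<rho> powr \<kappa> * m - \<rho> powr \<kappa> * q \<le> levy_const s * s * N\<^sub>1"
        by (simp only: right_diff_distrib)
      then show ?thesis unfolding \<rho>q using N by (simp add: D_def)
    qed
    moreover have "\<rho> powr \<kappa> * norm (y \<rho> x t) \<le> \<rho> powr \<kappa> * m"
      unfolding m_def by (intro mult_left_mono max t) simp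
    ultimately show ?thesis by linarith
  qed
  have "M \<le> 2 powr (- \<kappa>) * M + D"
    unfolding M_def
  proof (rule cSup_least)
    show "P \<noteq> {}" using T by (auto simp: P_def)
    fix p assume "p \<in> P"
    then show "p \<le> 2 powr (- \<kappa>) * Sup P + D" using step unfolding P_def M_def by auto
  qed
  moreover have p1: "2 powr (- \<kappa>) < 1" using \<kappa>' by (simp add: powr_less_one)
  ultimately have "M \<le> D / (1 - 2 powr (- \<kappa>))" by (simp add: field_simps)
  then have "M * r powr (- \<kappa>) \<le> D / (1 - 2 powr (- \<kappa>)) * r powr (- \<kappa>)" by (rule mult_right_mono) simp
  then show ?thesis using y_le[OF order_refl tr(1), of x] unfolding D_def y_def by linarith
qed

section \<open>Hoelder continuity from heat decay\<close>

lemma heat_approximation: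
  assumes h: "cont_periodic h" shows "(\<lambda>n. heat (r / real (Suc n)) h x) \<longlonglongrightarrow> h x"
proof -
  have [measurable]: "h \<in> borel_measurable borel" by (rule cont_periodic_measurable[OF h])
  obtain b where b: "\<And>x. norm (h x) \<le> b" using cont_periodic_bounded[OF h] by blast
  have "(\<lambda>n. LINT \<zeta>|gauss. h (x + sqrt (2 * (r / real (Suc n))) *\<^sub>R \<zeta>)) \<longlonglongrightarrow> (LINT \<zeta>|(gauss :: (real ^ 'a) measure). h x)"
  proof (rule integral_dominated_convergence)
    show "integrable (gauss :: (real ^ 'a) measure) (\<lambda>\<zeta>. b)" by simp
    show "AE \<zeta> in gauss. (\<lambda>n. h (x + sqrt (2 * (r / real (Suc n))) *\<^sub>R \<zeta>)) \<longlonglongrightarrow> h x"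
    proof (rule AE_I2)
      fix \<zeta> :: "real ^ 'a"
      have "(\<lambda>n. r / real (Suc n)) \<longlonglongrightarrow> 0"
        using tendsto_mult[OF tendsto_const[of r] LIMSEQ_inverse_real_of_nat] by (simp add: divide_inverse)
      then have "(\<lambda>n. x + sqrt (2 * (r / real (Suc n))) *\<^sub>R \<zeta>) \<longlonglongrightarrow> x + sqrt (2 * 0) *\<^sub>R \<zeta>"
        by (intro tendsto_intros)
      moreover have "isCont h (x + sqrt (2 * 0) *\<^sub>R \<zeta>)"
        using h unfolding cont_periodic_def by (simp add: continuous_on_eq_continuous_at)
      ultimately have "(\<lambda>n. h (x + sqrt (2 * (r / real (Suc n))) *\<^sub>R \<zeta>)) \<longlonglongrightarrow> h (x + sqrt (2 * 0) *\<^sub>R \<zeta>)"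
        by (intro isCont_tendsto_compose[of _ h])
      then show "(\<lambda>n. h (x + sqrt (2 * (r / real (Suc n))) *\<^sub>R \<zeta>)) \<longlonglongrightarrow> h x" by simp
    qed
    show "AE \<zeta> in gauss. norm (h (x + sqrt (2 * (r / real (Suc n))) *\<^sub>R \<zeta>)) \<le> b" for n
      using b by simp
  qed measurable
  then show ?thesis by (simp add: heat_def gauss_avg_def gauss.prob_space[unfolded space_gauss])
qed

lemma heat_error_bound:
  assumes h: "cont_periodic h" and \<beta>: "0 < \<beta>" "\<beta> < 1" and P: "P \<ge> 0"
    and dec: "\<And>\<rho> x. \<rho> > 0 \<Longrightarrow> norm (heat_lap \<rho> h x) \<le> P * \<rho> powr (\<beta> / 2 - 1)" and r: "r > 0"
  shows "norm (h x - heat r h x) \<le> P * (r powr (\<beta> / 2) / (\<beta> / 2))"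
proof -
  let ?G = "\<lambda>\<sigma>. P * (indicator {0..r} \<sigma> * \<sigma> powr (- (1 - \<beta> / 2))) + 0 * (indicator {r..} \<sigma> * \<sigma> powr (- 2))"
  have G: "integrable lborel ?G" "(LINT \<sigma>|lborel. ?G \<sigma>) = P * (r powr (1 - (1 - \<beta> / 2)) / (1 - (1 - \<beta> / 2))) + 0 * (r powr (1 - 2) / (2 - 1))"
    by (rule powr_split_integral[OF r], use \<beta> in simp, simp)+
  have bound: "norm (heat a h x - heat r h x) \<le> P * (r powr (\<beta> / 2) / (\<beta> / 2))" if a: "0 < a" "a \<le> r" for a
  proof -
    have "norm (heat a h x - heat r h x) \<le> (LINT \<sigma>|lborel. ?G \<sigma>)"
      unfolding heat_difference[OF a h] set_lebesgue_integral_def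
    proof (rule norm_integral_le[OF G(1)])
      fix \<sigma> :: real
      show "norm (indicator {a..r} \<sigma> *\<^sub>R heat_lap \<sigma> h x) \<le> ?G \<sigma>"
      proof (cases "\<sigma> \<in> {a..r}")
        case True
        then show ?thesis using dec[of \<sigma> x] a by simp
      next
        case False
        then show ?thesis using P by simp
      qed
    qed
    then show ?thesis unfolding G(2) by simp
  qed
  show ?thesis
  proof (rule tendsto_upperbound)
    show "(\<lambda>n. norm (heat (r / real (Suc n)) h x - heat r h x)) \<longlonglongrightarrow> norm (h x - heat r h x)"
      by (intro tendsto_intros heat_approximation[OF h])
    show "\<forall>\<^sub>F n in sequentially. norm (heat (r / real (Suc n)) h x - heat r h x) \<le> P * (r powr (\<beta> / 2) / (\<beta> / 2))"
      using r by (intro always_eventually allI bound) (auto simp: field_simps)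
  qed simp
qed

text \<open>
  The translate of \<open>heat_lap \<rho> h\<close> differs from it by \<open>C |y| \<rho> powr (-q)\<close> with \<open>q = 3/2 - \<beta>/2 > 1\<close>, which is
  integrable at infinity exactly because \<open>\<beta> < 1\<close>.  Integrating from \<open>r\<close> to a large time \<open>R\<close> leaves the difference
  at time \<open>R\<close>, which is of order \<open>1 / sqrt R\<close>.
\<close>

lemma heat_translation_decay:
  fixes h :: "real ^ 'n::finite \<Rightarrow> complex"
  assumes h: "cont_periodic h" and \<beta>: "0 < \<beta>" "\<beta> < 1" and P: "P \<ge> 0"
    and dec: "\<And>\<rho> x. \<rho> > 0 \<Longrightarrow> norm (heat_lap \<rho> h x) \<le> P * \<rho> powr (\<beta> / 2 - 1)" and r: "r > 0"
  defines "q \<equiv> 3 / 2 - \<beta> / 2"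
  shows "norm (heat r h (x + y) - heat r h x) \<le> CARD('n) * norm y * P * 2 powr q * (r powr (1 - q) / (q - 1))"
proof -
  have q: "q > 1" using \<beta> by (simp add: q_def)
  obtain b where b: "b \<ge> 0" "\<And>x. norm (h x) \<le> b" using cont_periodic_bounded[OF h] by blast
  let ?c = "CARD('n) * norm y * P * 2 powr q"
  let ?G = "\<lambda>\<sigma>. 0 * (indicator {0..r} \<sigma> * \<sigma> powr (- 0)) + ?c * (indicator {r..} \<sigma> * \<sigma> powr (- q))"
  have G: "integrable lborel ?G" "(LINT \<sigma>|lborel. ?G \<sigma>) = 0 * (r powr (1 - 0) / (1 - 0)) + ?c * (r powr (1 - q) / (q - 1))"
    by (rule powr_split_integral[OF r _ q], simp)+
  have lap: "norm (heat_lap \<rho> h (x + y) - heat_lap \<rho> h x) \<le> ?c * \<rho> powr (- q)" if \<rho>: "\<rho> > 0" for \<rho>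
  proof -
    have e: "heat_lap \<rho> h w = heat (\<rho> / 2) (heat_lap (\<rho> / 2) h) w" for w
      using heat_heat_lap[of "\<rho> / 2" "\<rho> / 2" h w] \<rho> h by simp
    have "norm (heat_lap \<rho> h (x + y) - heat_lap \<rho> h x) \<le> CARD('n) * norm y / sqrt (\<rho> / 2) * (P * (\<rho> / 2) powr (\<beta> / 2 - 1))"
      unfolding e by (intro norm_heat_translation_le cont_periodic_heat_lap h dec) (use \<rho> in auto)
    also have "\<dots> = CARD('n) * norm y * P * ((1 / sqrt (\<rho> / 2)) * (\<rho> / 2) powr (\<beta> / 2 - 1))"
      by simp
    also have "1 / sqrt (\<rho> / 2) = (\<rho> / 2) powr (- (1 / 2))"
      using \<rho> by (simp add: powr_minus_divide powr_half_sqrt)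
    also have "(\<rho> / 2) powr (- (1 / 2)) * (\<rho> / 2) powr (\<beta> / 2 - 1) = (\<rho> / 2) powr (- q)"
      by (simp add: q_def algebra_simps flip: powr_add)
    also have "(\<rho> / 2) powr (- q) = 2 powr q * \<rho> powr (- q)"
    proof -
      have "(\<rho> / 2) powr (- q) = \<rho> powr (- q) / 2 powr (- q)" by (rule powr_divide)
      moreover have "2 powr (- q) = 1 / 2 powr q" by (rule powr_minus_divide)
      ultimately show ?thesis by simp
    qed
    finally show ?thesis by (simp only: mult.assoc)
  qed
  have "norm (heat r h (x + y) - heat r h x) \<le> ?c * (r powr (1 - q) / (q - 1)) + e" if e: "e > 0" for e
  proof -
    define K where "K = CARD('n) * norm y * b"
    \<comment> \<open>\<open>R\<close> is so large that the translation bound \<open>K / sqrt R\<close> at time \<open>R\<close> is at most \<open>e\<close>.\<close>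
    define R where "R = r + (K / e)\<^sup>2"
    have K: "K \<ge> 0" using b by (simp add: K_def)
    have R: "r \<le> R" "R > 0" using r by (auto simp: R_def intro: add_pos_nonneg)
    have "K / e \<le> sqrt R" by (rule real_le_rsqrt) (use r in \<open>simp add: R_def\<close>)
    then have KR: "K / sqrt R \<le> e" using e R by (simp add: field_simps)
    have si: "set_integrable lborel {r..R} (\<lambda>\<rho>. heat_lap \<rho> h w)" for w
    proof -
      show ?thesis
      proof (rule set_integrable_bound)
        show "set_integrable lborel {r..R} (\<lambda>\<rho>. P * \<rho> powr (\<beta> / 2 - 1))"
          using r by (intro borel_integrable_atLeastAtMost' continuous_intros) auto
        show "set_borel_measurable lborel {r..R} (\<lambda>\<rho>. heat_lap \<rho> h w)"
          unfolding set_borel_measurable_def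
          by (intro borel_measurable_scaleR measurable_heat_lap[OF h]) auto
        show "AE \<rho> in lborel. \<rho> \<in> {r..R} \<longrightarrow> norm (heat_lap \<rho> h w) \<le> norm (P * \<rho> powr (\<beta> / 2 - 1))"
          using r P dec by (intro AE_I2) auto
      qed
    qed
    have eq: "heat r h (x + y) - heat r h x = (heat R h (x + y) - heat R h x) +
        (LINT \<rho>:{r..R}|lborel. heat_lap \<rho> h (x + y) - heat_lap \<rho> h x)"
      unfolding set_integral_diff(2)[OF si si] heat_difference[OF r R(1) h, symmetric] by simp
    have "norm (LINT \<rho>:{r..R}|lborel. heat_lap \<rho> h (x + y) - heat_lap \<rho> h x) \<le> (LINT \<sigma>|lborel. ?G \<sigma>)"
      unfolding set_lebesgue_integral_def
    proof (rule norm_integral_le[OF G(1)])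
      fix \<sigma> :: real
      show "norm (indicator {r..R} \<sigma> *\<^sub>R (heat_lap \<sigma> h (x + y) - heat_lap \<sigma> h x)) \<le> ?G \<sigma>"
      proof (cases "\<sigma> \<in> {r..R}")
        case True
        then show ?thesis using lap[of \<sigma>] r by simp
      next
        case False
        then show ?thesis using P by simp
      qed
    qed
    moreover have "norm (heat R h (x + y) - heat R h x) \<le> e"
      using norm_heat_translation_le[OF R(2) h b(2), of x y] KR by (simp add: K_def)
    ultimately show ?thesis
      unfolding eq G(2) using norm_triangle_ineq[of "heat R h (x + y) - heat R h x" "LINT \<rho>:{r..R}|lborel. heat_lap \<rho> h (x + y) - heat_lap \<rho> h x"]
      by simp
  qed
  then show ?thesis by (rule field_le_epsilon)
qed

text \<open>
  Compare \<open>h\<close> with \<open>heat (l\<^sup>2) h\<close>, where \<open>l\<close> is the distance of the two points: the approximation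
  error at each point and the variation of \<open>heat (l\<^sup>2) h\<close> between them are both of order \<open>l powr \<beta>\<close>.
\<close>

lemma holder_from_heat_decay:
  fixes h :: "real ^ 'n::finite \<Rightarrow> complex"
  assumes h: "cont_periodic h" and \<beta>: "0 < \<beta>" "\<beta> < 1" and P: "P \<ge> 0"
    and dec: "\<And>\<rho> x. \<rho> > 0 \<Longrightarrow> norm (heat_lap \<rho> h x) \<le> P * \<rho> powr (\<beta> / 2 - 1)"
  shows "norm (h x - h y) \<le> (4 / \<beta> + CARD('n) * 2 powr (3 / 2 - \<beta> / 2) / (1 / 2 - \<beta> / 2)) * P * norm (x - y) powr \<beta>"
proof (cases "x = y")
  case False
  define l where "l = norm (x - y)"
  have l: "l > 0" using False by (simp add: l_def)
  define q where "q = 3 / 2 - \<beta> / 2"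
  have l2: "l\<^sup>2 = l powr 2" using l by simp
  have e1: "(l\<^sup>2) powr (\<beta> / 2) = l powr \<beta>" unfolding l2 powr_powr by simp
  have e2: "l * (l\<^sup>2) powr (1 - q) = l powr \<beta>"
  proof -
    have "l * (l\<^sup>2) powr (1 - q) = l powr 1 * l powr (2 * (1 - q))" unfolding l2 powr_powr using l by simp
    also have "\<dots> = l powr (1 + 2 * (1 - q))" by (simp only: powr_add)
    also have "1 + 2 * (1 - q) = \<beta>" by (simp add: q_def field_simps)
    finally show ?thesis .
  qed
  have 1: "norm (h w - heat (l\<^sup>2) h w) \<le> P * (l powr \<beta> / (\<beta> / 2))" for w
    using heat_error_bound[OF h \<beta> P dec, of "l\<^sup>2" w] l e1 by simp
  have 2: "norm (heat (l\<^sup>2) h x - heat (l\<^sup>2) h y) \<le> CARD('n) * P * 2 powr q / (q - 1) * l powr \<beta>"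
  proof -
    have "norm (heat (l\<^sup>2) h (y + (x - y)) - heat (l\<^sup>2) h y) \<le> CARD('n) * norm (x - y) * P * 2 powr q * ((l\<^sup>2) powr (1 - q) / (q - 1))"
      unfolding q_def by (rule heat_translation_decay[OF h \<beta> P dec]) (use l in auto)
    also have "\<dots> = CARD('n) * P * 2 powr q / (q - 1) * (l * (l\<^sup>2) powr (1 - q))"
      by (simp add: l_def)
    finally show ?thesis unfolding e2 by simp
  qed
  have "norm (h x - h y) = norm ((h x - heat (l\<^sup>2) h x) + (heat (l\<^sup>2) h x - heat (l\<^sup>2) h y) - (h y - heat (l\<^sup>2) h y))" by simp
  also have "\<dots> \<le> norm (h x - heat (l\<^sup>2) h x) + norm (heat (l\<^sup>2) h x - heat (l\<^sup>2) h y) + norm (h y - heat (l\<^sup>2) h y)"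
    by (intro order_trans[OF norm_triangle_ineq4] add_mono norm_triangle_ineq order_refl)
  also have "\<dots> \<le> P * (l powr \<beta> / (\<beta> / 2)) + CARD('n) * P * 2 powr q / (q - 1) * l powr \<beta> + P * (l powr \<beta> / (\<beta> / 2))"
    by (intro add_mono 1 2)
  also have "\<dots> = (4 / \<beta> + CARD('n) * 2 powr q / (q - 1)) * P * l powr \<beta>"
    by (simp add: distrib_left distrib_right mult.commute mult.left_commute)
  also have "q - 1 = 1 / 2 - \<beta> / 2" by (simp add: q_def)
  finally show ?thesis unfolding l_def q_def .
qed simp

section \<open>The a priori estimate\<close>

text \<open>
  If \<open>g\<close> decays with exponent \<open>k\<close>, then its fractional integral of order \<open>1 - s\<close> decays with exponent
  \<open>k + s - 1\<close>; the formulas \<open>heat_lap_gamma\<close> and \<open>heat_frac_gamma\<close> are of this form.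
\<close>

lemma gamma_integral_bound:
  fixes g :: "real \<Rightarrow> complex"
  assumes s: "0 < s" "s < 1" "k \<ge> 0" "k + s > 1" and r: "r > 0" and A: "A \<ge> 0"
    and g: "\<And>\<rho>. \<rho> > 0 \<Longrightarrow> norm (g \<rho>) \<le> A * \<rho> powr (- k)"
    and w: "complex_of_real (gamma_const s) * w = (LINT \<sigma>:{0<..}|lborel. complex_of_real (\<sigma> powr (- s)) * g (r + \<sigma>))"
  shows "norm w \<le> A * ((1 / (1 - s) + 1 / (k + s - 1)) / gamma_const s) * r powr (1 - k - s)"
proof -
  have \<gamma>: "gamma_const s > 0" by (rule gamma_const_pos[OF s(2)])
  note K = powr_kernel_integral[OF r s(3) s(2) s(4)]
  have "gamma_const s * norm w = norm (LINT \<sigma>:{0<..}|lborel. complex_of_real (\<sigma> powr (- s)) * g (r + \<sigma>))"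
    using \<gamma> by (simp add: w[symmetric] norm_mult)
  also have "\<dots> \<le> (LINT \<sigma>:{0<..}|lborel. A * (\<sigma> powr (- s) * (r + \<sigma>) powr (- k)))"
  proof (rule norm_set_integral_le)
    show "set_integrable lborel {0<..} (\<lambda>\<sigma>. A * (\<sigma> powr (- s) * (r + \<sigma>) powr (- k)))"
      by (intro set_integrable_mult_right K(1))
    fix \<sigma> :: real assume "\<sigma> \<in> {0<..}"
    then have "\<sigma> powr (- s) * norm (g (r + \<sigma>)) \<le> \<sigma> powr (- s) * (A * (r + \<sigma>) powr (- k))"
      by (intro mult_left_mono g) (use r in auto)
    then show "norm (complex_of_real (\<sigma> powr (- s)) * g (r + \<sigma>)) \<le> A * (\<sigma> powr (- s) * (r + \<sigma>) powr (- k))"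
      by (simp add: norm_mult mult.left_commute)
  qed
  also have "\<dots> = A * (LINT \<sigma>:{0<..}|lborel. \<sigma> powr (- s) * (r + \<sigma>) powr (- k))"
    by (rule set_integral_mult_right)
  also have "\<dots> \<le> A * ((1 / (1 - s) + 1 / (k + s - 1)) * r powr (1 - k - s))"
    by (rule mult_left_mono[OF K(2) A])
  finally show ?thesis using \<gamma> by (simp add: field_simps)
qed

text \<open>
  The value at a point is the mean of \<open>h x - h y\<close> over the cube, whose diameter is at most \<open>CARD('n)\<close>.
\<close>

lemma norm_le_of_mean_zero:
  fixes h :: "real ^ 'n::finite \<Rightarrow> complex"
  assumes h: "cont_periodic h" and mean: "fcoeff h 0 = 0" and \<beta>: "\<beta> \<ge> 0" and H0: "H \<ge> 0"
    and H: "\<And>x y. norm (h x - h y) \<le> H * norm (x - y) powr \<beta>"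
  shows "norm (h x) \<le> H * CARD('n) powr \<beta>"
proof -
  let ?Q = "cbox 0 1 :: (real ^ 'n) set"
  obtain k where k: "x + freq k \<in> ?Q" by (rule cube_representative)
  define x' where "x' = x + freq k"
  have hx: "h x = h x'"
    using h periodic_shift_freq[of h x k] unfolding cont_periodic_def x'_def by simp
  have int: "h integrable_on ?Q" by (intro integrable_continuous cont_periodic_on_cube h)
  have "integral ?Q h = 0" using mean by (simp add: fcoeff_def)
  moreover have "integral ?Q (\<lambda>y. h x' - h y) = integral ?Q (\<lambda>y. h x') - integral ?Q h"
    by (intro Henstock_Kurzweil_Integration.integral_diff integrable_const int)
  moreover have "integral ?Q (\<lambda>y. h x') = h x'" by (simp add: content_unit_cube)
  ultimately have "h x' = integral ?Q (\<lambda>y. h x' - h y)" by simp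
  also have "norm \<dots> \<le> (H * CARD('n) powr \<beta>) * measure lborel ?Q"
  proof (rule integrable_bound)
    show "(\<lambda>y. h x' - h y) integrable_on ?Q" by (intro Henstock_Kurzweil_Integration.integrable_diff integrable_const int)
    fix y assume y: "y \<in> ?Q"
    have "norm (x' - y) \<le> (\<Sum>i\<in>UNIV. \<bar>(x' - y) $ i\<bar>)" by (rule norm_le_l1_cart)
    also have "\<dots> \<le> (\<Sum>i\<in>(UNIV :: 'n set). 1)"
    proof (rule sum_mono)
      fix i :: 'n
      have "0 \<le> x' $ i" "x' $ i \<le> 1" "0 \<le> y $ i" "y $ i \<le> 1"
        using k y by (auto simp: mem_box_cart x'_def)
      then show "\<bar>(x' - y) $ i\<bar> \<le> 1" by (simp add: abs_le_iff)
    qed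
    finally have "norm (x' - y) \<le> CARD('n)" by simp
    then have "norm (x' - y) powr \<beta> \<le> CARD('n) powr \<beta>" using \<beta> by (intro powr_mono2) auto
    then show "norm (h x' - h y) \<le> H * CARD('n) powr \<beta>"
      using H[of x' y] mult_left_mono[OF _ H0] order_trans by blast
  qed (use H0 in simp)
  finally show ?thesis by (simp add: hx content_unit_cube)
qed

lemma norm_increment_le:
  fixes g :: "real \<Rightarrow> complex"
  assumes g: "\<And>t. t \<in> {0..T} \<Longrightarrow> (g has_vector_derivative g' t) (at t within {0..T})"
    and B: "\<And>t. t \<in> {0..T} \<Longrightarrow> norm (g' t) \<le> B" and t: "t \<in> {0..T}" "t' \<in> {0..T}"
  shows "norm (g t - g t') \<le> B * \<bar>t - t'\<bar>"
proof -
  have "norm (g t - g t') \<le> B * norm (t - t')"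
  proof (rule differentiable_bound[of "{0..T}" g "\<lambda>t h. h *\<^sub>R g' t"])
    show "(g has_derivative (\<lambda>h. h *\<^sub>R g' t)) (at t within {0..T})" if "t \<in> {0..T}" for t
      using g[OF that] by (simp add: has_vector_derivative_def)
    show "onorm (\<lambda>h. h *\<^sub>R g' t) \<le> B" if "t \<in> {0..T}" for t
    proof (rule onorm_le)
      show "norm (h *\<^sub>R g' t) \<le> B * norm h" for h :: real
        using mult_left_mono[OF B[OF that], of "\<bar>h\<bar>"] by (simp add: mult.commute)
    qed
  qed (use t in auto)
  then show ?thesis by simp
qed

text \<open>
  The spatial bounds follow from the decay of \<open>bilap r u\<close>.  For the bound in time let \<open>d = |t - t'|\<close>.  The
  increment of \<open>u\<close> between the two times has Hoelder seminorm at most \<open>C d\<close>, since \<open>\<partial>\<^sub>t u = z + f\<close>; hence the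
  increment of \<open>heat d z\<close> is at most \<open>C d * d powr (\<beta>/2 - s) \<le> C T powr (1-s) * d powr (\<beta>/2)\<close>, and replacing
  \<open>z\<close> by \<open>heat d z\<close> costs \<open>C d powr (\<beta>/2)\<close>.
\<close>

theorem a_priori_estimate:
  fixes s \<beta> T :: real
  assumes s: "1 / 2 < s" "s < 1" and \<beta>: "0 < \<beta>" "\<beta> < 1" and T: "T > 0"
  shows "\<exists>C>0. \<forall>(u :: real ^ 'n::finite \<Rightarrow> real \<Rightarrow> complex) z f N. N \<ge> 0 \<longrightarrow>
    cont_cyl T u \<longrightarrow> cont_cyl T z \<longrightarrow> cont_cyl T f \<longrightarrow>
    (\<forall>t\<in>{0..T}. frac_pair s (\<lambda>x. u x t) (\<lambda>x. z x t)) \<longrightarrow>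
    (\<forall>x. \<forall>t\<in>{0..T}. (u x has_vector_derivative z x t + f x t) (at t within {0..T})) \<longrightarrow>
    (\<forall>t\<in>{0..T}. \<forall>x y. norm (f x t - f y t) \<le> N * norm (x - y) powr \<beta>) \<longrightarrow>
    (\<forall>r>0. \<forall>x. norm (bilap r (\<lambda>x. u x T) x) \<le> N * r powr (- (2 - s - \<beta> / 2))) \<longrightarrow>
    (\<forall>t\<in>{0..T}. \<forall>x. norm (z x t) \<le> C * N \<and>
      (\<forall>y. norm (z x t - z y t) \<le> C * N * norm (x - y) powr \<beta>) \<and>
      (\<forall>t'\<in>{0..T}. norm (z x t - z x t') \<le> C * N * \<bar>t - t'\<bar> powr (\<beta> / 2)))"
proof -
  have s0: "0 < s" using s by simp
  define \<kappa> where "\<kappa> = 2 - s - \<beta> / 2"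
  have \<kappa>: "\<kappa> > 0" "\<kappa> + s > 1" using s \<beta> by (auto simp: \<kappa>_def)
  obtain C1 where C1: "C1 \<ge> 0" "\<And>r (h :: real ^ 'n \<Rightarrow> complex) H x. r > 0 \<Longrightarrow> cont_periodic h \<Longrightarrow>
      (\<forall>x y. norm (h x - h y) \<le> H * norm (x - y) powr \<beta>) \<Longrightarrow> norm (bilap r h x) \<le> C1 * H * r powr (\<beta> / 2 - 2)"
    using bilap_holder_bound[of \<beta>, where 'n = 'n] \<beta> by auto
  obtain C2 where C2: "C2 \<ge> 0" "\<And>r (h :: real ^ 'n \<Rightarrow> complex) H x. r > 0 \<Longrightarrow> cont_periodic h \<Longrightarrow>
      (\<forall>x y. norm (h x - h y) \<le> H * norm (x - y) powr \<beta>) \<Longrightarrow> norm (heat_lap r h x) \<le> C2 * H * r powr (\<beta> / 2 - 1)"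
    using heat_lap_holder_bound[of \<beta>, where 'n = 'n] \<beta> by auto
  define K where "K = (levy_const s * s * C1 + 1) / (1 - 2 powr (- \<kappa>))"
  define P where "P = K * ((1 / (1 - s) + 1 / (\<kappa> + s - 1)) / gamma_const s)"
  define H where "H = (4 / \<beta> + CARD('n) * 2 powr (3 / 2 - \<beta> / 2) / (1 / 2 - \<beta> / 2)) * P"
  define S where "S = H * CARD('n) powr \<beta>"
  define Y where "Y = C2 * (H + 1) * ((1 / (1 - s) + 1 / ((1 - \<beta> / 2) + s - 1)) / gamma_const s) * T powr (1 - s)"
  define C where "C = 1 + H + S + (4 / \<beta> * P + Y)"
  have "2 powr (- \<kappa>) < 1" using \<kappa> by (simp add: powr_less_one)
  then have K: "K \<ge> 0" using levy_const_nonneg[of s] s0 C1 by (simp add: K_def)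
  have \<gamma>: "gamma_const s > 0" using gamma_const_pos s by simp
  have P: "P \<ge> 0" using K \<gamma> s \<kappa> by (simp add: P_def)
  have H: "H \<ge> 0" using P \<beta> by (simp add: H_def)
  have S: "S \<ge> 0" using H by (simp add: S_def)
  have Y: "Y \<ge> 0" using H C2 \<gamma> s \<beta> by (simp add: Y_def)
  have C: "C > 0" "S \<le> C" "H \<le> C" "4 / \<beta> * P + Y \<le> C"
  proof -
    have "4 / \<beta> * P \<ge> 0" using P \<beta> by simp
    then show "C > 0" "S \<le> C" "H \<le> C" "4 / \<beta> * P + Y \<le> C"
      using H S Y unfolding C_def by linarith+
  qed
  show ?thesis
  proof (intro exI[of _ C] conjI allI impI C(1))
    fix u z f :: "real ^ 'n \<Rightarrow> real \<Rightarrow> complex" and N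
    assume N: "N \<ge> 0" and cu: "cont_cyl T u" and cz: "cont_cyl T z" and cf: "cont_cyl T f"
      and pair: "\<forall>t\<in>{0..T}. frac_pair s (\<lambda>x. u x t) (\<lambda>x. z x t)"
      and deriv: "\<forall>x. \<forall>t\<in>{0..T}. (u x has_vector_derivative z x t + f x t) (at t within {0..T})"
      and fH: "\<forall>t\<in>{0..T}. \<forall>x y. norm (f x t - f y t) \<le> N * norm (x - y) powr \<beta>"
      and U: "\<forall>r>0. \<forall>x. norm (bilap r (\<lambda>x. u x T) x) \<le> N * r powr (- (2 - s - \<beta> / 2))"
    have bil: "norm (bilap r (\<lambda>x. u x t) x) \<le> (K * N) * r powr (- \<kappa>)" if t: "t \<in> {0..T}" and r: "r > 0" for t r x
    proof -
      have "norm (bilap r (\<lambda>x. u x t) x) \<le> (levy_const s * s * (C1 * N) + N) / (1 - 2 powr (- \<kappa>)) * r powr (- \<kappa>)"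
      proof (rule bilap_a_priori[OF s0 s(2) \<beta> T \<kappa>_def cu cz cf])
        show "norm (bilap r (\<lambda>x. f x t) x) \<le> C1 * N * r powr (\<beta> / 2 - 2)" if "t \<in> {0..T}" "r > 0" for t r x
          by (rule C1(2)[OF that(2) cont_cyl_slice[OF cf that(1)]]) (use fH that in blast)
      qed (use pair deriv U N C1(1) t r in \<open>auto simp: \<kappa>_def\<close>)
      also have "(levy_const s * s * (C1 * N) + N) / (1 - 2 powr (- \<kappa>)) = K * N"
        by (simp add: K_def algebra_simps)
      finally show ?thesis .
    qed
    have lap: "norm (heat_lap r (\<lambda>x. z x t) x) \<le> (P * N) * r powr (\<beta> / 2 - 1)" if t: "t \<in> {0..T}" and r: "r > 0" for t r x
    proof -
      have "norm (heat_lap r (\<lambda>x. z x t) x) \<le> (K * N) * ((1 / (1 - s) + 1 / (\<kappa> + s - 1)) / gamma_const s) * r powr (1 - \<kappa> - s)"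
        by (rule gamma_integral_bound[OF s0 s(2) less_imp_le[OF \<kappa>(1)] \<kappa>(2) r _ bil[OF t] heat_lap_gamma[OF s0 s(2) r pair[rule_format, OF t]]])
           (use K N in auto)
      also have "1 - \<kappa> - s = \<beta> / 2 - 1" by (simp add: \<kappa>_def)
      also have "(K * N) * ((1 / (1 - s) + 1 / (\<kappa> + s - 1)) / gamma_const s) = P * N" by (simp add: P_def)
      finally show ?thesis .
    qed
    have PN: "P * N \<ge> 0" using P N by simp
    have zH: "norm (z x t - z y t) \<le> (H * N) * norm (x - y) powr \<beta>" if t: "t \<in> {0..T}" for t x y
    proof -
      have "norm (z x t - z y t) \<le> (4 / \<beta> + CARD('n) * 2 powr (3 / 2 - \<beta> / 2) / (1 / 2 - \<beta> / 2)) * (P * N) * norm (x - y) powr \<beta>"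
        by (rule holder_from_heat_decay[OF cont_cyl_slice[OF cz t] \<beta> PN lap[OF t]])
      then show ?thesis by (simp only: H_def mult.assoc)
    qed
    have zS: "norm (z x t) \<le> S * N" if t: "t \<in> {0..T}" for t x
    proof -
      have "fcoeff (\<lambda>x. z x t) 0 = 0" using pair t by (simp add: frac_pair_def)
      then have "norm (z x t) \<le> (H * N) * CARD('n) powr \<beta>"
        by (rule norm_le_of_mean_zero[OF cont_cyl_slice[OF cz t] _ less_imp_le[OF \<beta>(1)] _ zH[OF t]]) (use H N in simp)
      then show ?thesis by (simp add: S_def mult.assoc mult.commute mult.left_commute)
    qed
    have zT: "norm (z x t - z x t') \<le> (4 / \<beta> * P + Y) * N * \<bar>t - t'\<bar> powr (\<beta> / 2)"
      if t: "t \<in> {0..T}" "t' \<in> {0..T}" for x t t'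
    proof (cases "t = t'")
      case False
      define d where "d = \<bar>t - t'\<bar>"
      have d: "d > 0" "d \<le> T" using False t by (auto simp: d_def)
      let ?h = "\<lambda>x. u x t - u x t'"
      have hH: "norm (?h x - ?h y) \<le> (d * (H + 1) * N) * norm (x - y) powr \<beta>" for x y
      proof -
        have "norm ((u x t - u y t) - (u x t' - u y t')) \<le> ((H + 1) * N * norm (x - y) powr \<beta>) * \<bar>t - t'\<bar>"
        proof (rule norm_increment_le[where g = "\<lambda>t. u x t - u y t" and T = T])
          fix t assume t: "t \<in> {0..T}"
          show "((\<lambda>t. u x t - u y t) has_vector_derivative (z x t + f x t) - (z y t + f y t)) (at t within {0..T})"
            by (intro has_vector_derivative_diff deriv[rule_format] t)
          have "norm ((z x t + f x t) - (z y t + f y t)) \<le> norm (z x t - z y t) + norm (f x t - f y t)"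
            using norm_triangle_ineq[of "z x t - z y t" "f x t - f y t"] by (simp add: algebra_simps)
          also have "\<dots> \<le> (H * N) * norm (x - y) powr \<beta> + N * norm (x - y) powr \<beta>"
            by (intro add_mono zH[OF t] fH[rule_format, OF t])
          also have "\<dots> = (H + 1) * N * norm (x - y) powr \<beta>" by (simp add: distrib_right)
          finally show "norm ((z x t + f x t) - (z y t + f y t)) \<le> (H + 1) * N * norm (x - y) powr \<beta>" .
        qed (use t in auto)
        moreover have "?h x - ?h y = (u x t - u y t) - (u x t' - u y t')" by simp
        ultimately show ?thesis by (simp only: d_def mult.assoc mult.commute mult.left_commute)
      qed
      have ch: "cont_periodic ?h" by (intro cont_periodic_diff cont_cyl_slice[OF cu] t)
      have dp: "frac_pair s ?h (\<lambda>x. z x t - z x t')" by (intro frac_pair_diff pair[rule_format] t)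
      have "norm (heat d (\<lambda>x. z x t - z x t') x) \<le>
          (C2 * (d * (H + 1) * N)) * ((1 / (1 - s) + 1 / ((1 - \<beta> / 2) + s - 1)) / gamma_const s) * d powr (1 - (1 - \<beta> / 2) - s)"
      proof (rule gamma_integral_bound[OF s0 s(2) _ _ d(1) _ _ heat_frac_gamma[OF s0 s(2) d(1) dp]])
        show "norm (heat_lap \<rho> ?h x) \<le> C2 * (d * (H + 1) * N) * \<rho> powr (- (1 - \<beta> / 2))" if "\<rho> > 0" for \<rho>
        proof -
          have "norm (heat_lap \<rho> ?h x) \<le> C2 * (d * (H + 1) * N) * \<rho> powr (\<beta> / 2 - 1)"
            by (rule C2(2)[OF that ch]) (use hH in blast)
          then show ?thesis by simp
        qed
      qed (use s \<beta> C2(1) d H N in auto)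
      also have "\<dots> \<le> Y * N * d powr (\<beta> / 2)"
      proof -
        define c where "c = (1 / (1 - s) + 1 / ((1 - \<beta> / 2) + s - 1)) / gamma_const s"
        have c: "c \<ge> 0" using s \<beta> \<gamma> by (simp add: c_def)
        have e: "d * d powr (1 - (1 - \<beta> / 2) - s) = d powr (1 - s) * d powr (\<beta> / 2)"
        proof -
          have "d * d powr (1 - (1 - \<beta> / 2) - s) = d powr 1 * d powr (\<beta> / 2 - s)" using d by simp
          also have "\<dots> = d powr (1 - s) * d powr (\<beta> / 2)" by (simp only: powr_add[symmetric]) (simp add: algebra_simps)
          finally show ?thesis .
        qed
        have "(C2 * (d * (H + 1) * N)) * c * d powr (1 - (1 - \<beta> / 2) - s) =
            (C2 * (H + 1) * c * N) * (d * d powr (1 - (1 - \<beta> / 2) - s))"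
          by (simp only: mult.assoc mult.commute mult.left_commute)
        also have "\<dots> = (C2 * (H + 1) * c * N) * (d powr (1 - s) * d powr (\<beta> / 2))" unfolding e ..
        also have "\<dots> \<le> (C2 * (H + 1) * c * N) * (T powr (1 - s) * d powr (\<beta> / 2))"
          by (intro mult_left_mono mult_right_mono powr_mono2) (use d s C2(1) H c N in auto)
        also have "\<dots> = Y * N * d powr (\<beta> / 2)" by (simp add: Y_def c_def)
        finally show ?thesis unfolding c_def .
      qed
      finally have 1: "norm (heat d (\<lambda>x. z x t - z x t') x) \<le> Y * N * d powr (\<beta> / 2)" .
      have hd: "heat d (\<lambda>x. z x t - z x t') x = heat d (\<lambda>x. z x t) x - heat d (\<lambda>x. z x t') x"
        by (rule bl_functional_diff[OF bl_functional_apply[OF bl_operator_heat]]) (intro cont_cyl_slice[OF cz] t)+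
      have 2: "norm (z x \<tau> - heat d (\<lambda>x. z x \<tau>) x) \<le> P * N * (d powr (\<beta> / 2) / (\<beta> / 2))" if "\<tau> \<in> {0..T}" for \<tau>
        by (rule heat_error_bound[OF cont_cyl_slice[OF cz that] \<beta> PN lap[OF that] d(1)])
      have tri: "norm (a + b - c) \<le> norm a + norm b + norm c" for a b c :: complex
        by (intro order_trans[OF norm_triangle_ineq4] add_mono norm_triangle_ineq order_refl)
      have "z x t - z x t' = (z x t - heat d (\<lambda>x. z x t) x) + heat d (\<lambda>x. z x t - z x t') x - (z x t' - heat d (\<lambda>x. z x t') x)"
        unfolding hd by simp
      then have "norm (z x t - z x t') \<le> norm (z x t - heat d (\<lambda>x. z x t) x) + norm (heat d (\<lambda>x. z x t - z x t') x) + norm (z x t' - heat d (\<lambda>x. z x t') x)"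
        using tri by metis
      also have "\<dots> \<le> P * N * (d powr (\<beta> / 2) / (\<beta> / 2)) + Y * N * d powr (\<beta> / 2) + P * N * (d powr (\<beta> / 2) / (\<beta> / 2))"
        by (intro add_mono 1 2 t)
      also have "\<dots> = (4 / \<beta> * P + Y) * N * d powr (\<beta> / 2)"
        using \<beta> by (simp add: field_simps)
      finally show ?thesis unfolding d_def .
    qed simp
    show "\<forall>t\<in>{0..T}. \<forall>x. norm (z x t) \<le> C * N \<and>
      (\<forall>y. norm (z x t - z y t) \<le> C * N * norm (x - y) powr \<beta>) \<and>
      (\<forall>t'\<in>{0..T}. norm (z x t - z x t') \<le> C * N * \<bar>t - t'\<bar> powr (\<beta> / 2))"
    proof (intro ballI allI conjI)
      fix t x assume t: "t \<in> {0..T}"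
      show "norm (z x t) \<le> C * N" by (rule order_trans[OF zS[OF t] mult_right_mono[OF C(2) N]])
      show "norm (z x t - z y t) \<le> C * N * norm (x - y) powr \<beta>" for y
        by (rule order_trans[OF zH[OF t]]) (intro mult_right_mono C(3) N, simp)
      show "norm (z x t - z x t') \<le> C * N * \<bar>t - t'\<bar> powr (\<beta> / 2)" if "t' \<in> {0..T}" for t'
        by (rule order_trans[OF zT[OF t that]]) (intro mult_right_mono C(4) N, simp)
    qed
  qed
qed

section \<open>Terminal data\<close>

text \<open>
  The weight is even and has mean zero, so \<open>h (x + y)\<close> may be replaced by half of \<open>h (x + y) + h (x - y) - 2 * h x\<close>.  This
  removes the first Taylor polynomial without mentioning derivatives of \<open>h\<close>.
\<close>

lemma heat_lap_second_difference:
  fixes h :: "real ^ 'n::finite \<Rightarrow> complex"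
  assumes h: "cont_periodic h" and r: "r > 0" and p: "0 \<le> p" "p \<le> 2"
    and Q: "\<And>x y. norm (h (x + y) + h (x - y) - 2 * h x) \<le> Q * norm y powr p"
  shows "norm (heat_lap r h x) \<le> Q * r powr (p / 2 - 1) * (2 powr (p / 2) / 2 * (LINT \<zeta>|(gauss :: (real ^ 'n) measure). \<bar>lap_weight \<zeta>\<bar> * norm \<zeta> powr p))"
proof -
  let ?c = "sqrt (2 * r)" and ?I = "LINT \<zeta>|(gauss :: (real ^ 'n) measure). \<bar>lap_weight \<zeta>\<bar> * norm \<zeta> powr p"
  have sym: "gauss_avg lap_weight ?c h x = gauss_avg lap_weight (- ?c) h x"
  proof (rule bl_functional_eqI[OF _ _ _ h])
    show "bl_functional (\<lambda>h. gauss_avg lap_weight c h x)" for c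
      by (intro bl_functional_apply bl_operator_gauss_avg integrable_lap_weight)
    then show "bl_functional (\<lambda>h. gauss_avg lap_weight (- ?c) h x)" .
    show "gauss_avg lap_weight ?c (chr k) x = gauss_avg lap_weight (- ?c) (chr k) x" for k
      unfolding gauss_avg_chr lap_weight_cis by simp
  qed
  have i: "integrable gauss (\<lambda>\<zeta>. complex_of_real (lap_weight \<zeta>) * h (x + c *\<^sub>R \<zeta>))" for c
    by (rule integrable_gauss_avg[OF integrable_lap_weight h])
  have iw: "integrable gauss (\<lambda>\<zeta> :: real ^ 'n. complex_of_real (lap_weight \<zeta>) * (2 * h x))"
    by (intro integrable_mult_left integrable_of_real integrable_lap_weight)
  have w0: "(LINT \<zeta>|(gauss :: (real ^ 'n) measure). complex_of_real (lap_weight \<zeta>) * (2 * h x)) = 0"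
    by (simp add: lap_weight_mean)
  have "2 * gauss_avg lap_weight ?c h x = gauss_avg lap_weight ?c h x + gauss_avg lap_weight (- ?c) h x
      - (LINT \<zeta>|(gauss :: (real ^ 'n) measure). complex_of_real (lap_weight \<zeta>) * (2 * h x))"
    using sym w0 by simp
  also have "\<dots> = (LINT \<zeta>|gauss. complex_of_real (lap_weight \<zeta>) * (h (x + ?c *\<^sub>R \<zeta>) + h (x - ?c *\<^sub>R \<zeta>) - 2 * h x))"
    unfolding gauss_avg_def using i[of ?c] i[of "- ?c"] iw
    by (simp only: right_diff_distrib distrib_left Bochner_Integration.integral_diff Bochner_Integration.integral_add
        Bochner_Integration.integrable_add scaleR_minus_left add_uminus_conv_diff)
  finally have e: "2 * gauss_avg lap_weight ?c h x = \<dots>" .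
  have "norm (2 * gauss_avg lap_weight ?c h x) \<le> (LINT \<zeta>|(gauss :: (real ^ 'n) measure). Q * ?c powr p * (\<bar>lap_weight \<zeta>\<bar> * norm \<zeta> powr p))"
    unfolding e
  proof (rule norm_integral_le)
    show "integrable gauss (\<lambda>\<zeta> :: real ^ 'n. Q * ?c powr p * (\<bar>lap_weight \<zeta>\<bar> * norm \<zeta> powr p))"
      by (intro integrable_mult_right integrable_lap_weight_powr p)
    fix \<zeta> :: "real ^ 'n"
    have "norm (h (x + ?c *\<^sub>R \<zeta>) + h (x - ?c *\<^sub>R \<zeta>) - 2 * h x) \<le> Q * (?c powr p * norm \<zeta> powr p)"
      using Q[of x "?c *\<^sub>R \<zeta>"] r by (simp add: powr_mult)
    then have "\<bar>lap_weight \<zeta>\<bar> * norm (h (x + ?c *\<^sub>R \<zeta>) + h (x - ?c *\<^sub>R \<zeta>) - 2 * h x) \<le> \<bar>lap_weight \<zeta>\<bar> * (Q * (?c powr p * norm \<zeta> powr p))"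
      by (rule mult_left_mono) simp
    then show "norm (complex_of_real (lap_weight \<zeta>) * (h (x + ?c *\<^sub>R \<zeta>) + h (x - ?c *\<^sub>R \<zeta>) - 2 * h x)) \<le>
        Q * ?c powr p * (\<bar>lap_weight \<zeta>\<bar> * norm \<zeta> powr p)"
      by (simp only: norm_mult norm_of_real mult.assoc mult.left_commute)
  qed
  then have "norm (gauss_avg lap_weight ?c h x) \<le> Q * ?c powr p * ?I / 2"
    by (simp add: norm_mult)
  then have "norm (heat_lap r h x) \<le> (Q * ?c powr p * ?I / 2) / r"
    unfolding norm_heat_lap[OF r] by (rule divide_right_mono) (use r in simp)
  also have "?c powr p = 2 powr (p / 2) * r powr (p / 2)"
  proof -
    have "(2 * r) powr (1 / 2) = ?c" by (rule powr_half_sqrt) (use r in simp)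
    then have "?c powr p = (2 * r) powr (p / 2)" using powr_powr[of "2 * r" "1/2" p] by simp
    then show ?thesis using r by (simp add: powr_mult)
  qed
  also have "r powr (p / 2) = r * r powr (p / 2 - 1)" using r by (simp add: powr_diff)
  finally show ?thesis using r by (simp add: mult.assoc mult.commute mult.left_commute)
qed

lemma second_difference_mvt:
  fixes \<phi> :: "real \<Rightarrow> real"
  assumes d: "\<And>\<tau>. (\<phi> has_real_derivative \<phi>' \<tau>) (at \<tau>)"
    and Q: "\<And>a b. \<bar>a - b\<bar> \<le> 2 \<Longrightarrow> \<bar>\<phi>' a - \<phi>' b\<bar> \<le> Q"
  shows "\<bar>\<phi> 1 + \<phi> (- 1) - 2 * \<phi> 0\<bar> \<le> Q"
proof -
  obtain a where a: "0 < a" "a < 1" "\<phi> 1 - \<phi> 0 = (1 - 0) * \<phi>' a"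
    using MVT2[of 0 1 \<phi> \<phi>'] d by auto
  obtain b where b: "-1 < b" "b < 0" "\<phi> 0 - \<phi> (-1) = (0 - (-1)) * \<phi>' b"
    using MVT2[of "-1" 0 \<phi> \<phi>'] d by auto
  have "\<phi> 1 + \<phi> (- 1) - 2 * \<phi> 0 = \<phi>' a - \<phi>' b" using a(3) b(3) by simp
  then show ?thesis using Q[of a b] a b by simp
qed

lemma has_real_derivative_along_line:
  fixes v :: "real ^ 'n::finite \<Rightarrow> real"
  assumes "v differentiable_on UNIV"
  shows "((\<lambda>\<tau>. v (x + \<tau> *\<^sub>R y)) has_real_derivative (\<Sum>i\<in>UNIV. y $ i * partial i v (x + \<tau> *\<^sub>R y))) (at \<tau>)"
proof -
  let ?p = "x + \<tau> *\<^sub>R y"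
  have D: "(v has_derivative frechet_derivative v (at ?p)) (at ?p)"
    using assms by (simp add: differentiable_on_def frechet_derivative_works)
  then interpret bounded_linear "frechet_derivative v (at ?p)" by (rule has_derivative_bounded_linear)
  have "frechet_derivative v (at ?p) y = frechet_derivative v (at ?p) (\<Sum>i\<in>UNIV. y $ i *\<^sub>R axis i 1)"
    using basis_expansion[of y] by (simp add: scalar_mult_eq_scaleR)
  also have "\<dots> = (\<Sum>i\<in>UNIV. y $ i * partial i v ?p)" by (simp add: sum scaleR partial_def)
  finally have e: "frechet_derivative v (at ?p) y = (\<Sum>i\<in>UNIV. y $ i * partial i v ?p)" .
  have "((\<lambda>\<tau>. x + \<tau> *\<^sub>R y) has_derivative (\<lambda>h. h *\<^sub>R y)) (at \<tau>)"
    by (auto intro!: derivative_eq_intros)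
  from has_derivative_compose[OF this D]
  have "((\<lambda>\<tau>. v (x + \<tau> *\<^sub>R y)) has_derivative (\<lambda>h. frechet_derivative v (at ?p) (h *\<^sub>R y))) (at \<tau>)" .
  moreover have "(\<lambda>h. frechet_derivative v (at ?p) (h *\<^sub>R y)) = (*) (\<Sum>i\<in>UNIV. y $ i * partial i v ?p)"
    by (rule ext) (simp add: scaleR e mult.commute)
  ultimately show ?thesis unfolding has_field_derivative_def by simp
qed

lemma abs_sum_components_le:
  fixes y :: "real ^ 'n::finite"
  assumes "\<And>i. \<bar>a i\<bar> \<le> B" "B \<ge> 0"
  shows "\<bar>\<Sum>i\<in>UNIV. y $ i * a i\<bar> \<le> CARD('n) * norm y * B"
proof -
  have "\<bar>\<Sum>i\<in>UNIV. y $ i * a i\<bar> \<le> (\<Sum>i\<in>UNIV. \<bar>y $ i * a i\<bar>)" by (rule sum_abs)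
  also have "\<dots> \<le> (\<Sum>i\<in>(UNIV :: 'n set). norm y * B)"
    by (intro sum_mono) (use assms component_le_norm_cart[of y] in \<open>auto simp: abs_mult intro!: mult_mono\<close>)
  finally show ?thesis by simp
qed

lemma cont_periodic_of_real:
  assumes "periodic u" "u differentiable_on UNIV"
  shows "cont_periodic (\<lambda>x. complex_of_real (u x))"
  using assms differentiable_imp_continuous_on[OF assms(2)]
  unfolding cont_periodic_def periodic_def by (auto intro: continuous_on_of_real)

text \<open>
  Second differences of \<open>u\<close> are of order \<open>1 + \<alpha>\<close>, which gives the decay of the inner factor of \<open>bilap\<close>; the
  outer one costs a factor \<open>1 / r\<close>.
\<close>

lemma bilap_decay_C1:
  fixes \<alpha> :: real
  assumes \<alpha>: "0 < \<alpha>" "\<alpha> < 1"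
  shows "\<exists>C\<ge>0. \<forall>(u :: real ^ 'n::finite \<Rightarrow> real) N. N \<ge> 0 \<longrightarrow> periodic u \<longrightarrow> u differentiable_on UNIV \<longrightarrow>
    (\<forall>i x y. \<bar>partial i u x - partial i u y\<bar> \<le> N * norm (x - y) powr \<alpha>) \<longrightarrow>
    (\<forall>r>0. \<forall>x. norm (bilap r (\<lambda>x. complex_of_real (u x)) x) \<le> C * N * r powr ((1 + \<alpha>) / 2 - 2))"
proof -
  obtain C where C: "C \<ge> 0" "\<And>r (h :: real ^ 'n \<Rightarrow> complex) b x. r > 0 \<Longrightarrow> (\<And>x. norm (h x) \<le> b) \<Longrightarrow> norm (heat_lap r h x) \<le> C / r * b"
    using heat_lap_bound[where 'n = 'n] by blast
  define p where "p = 1 + \<alpha>"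
  define I where "I = 2 powr (p / 2) / 2 * (LINT \<zeta>|(gauss :: (real ^ 'n) measure). \<bar>lap_weight \<zeta>\<bar> * norm \<zeta> powr p)"
  have I: "I \<ge> 0" unfolding I_def by simp
  define D where "D = CARD('n) * 2 powr \<alpha>"
  have D: "D \<ge> 0" by (simp add: D_def)
  let ?k = "2 powr (1 - p / 2)"
  show ?thesis
  proof (intro exI[of _ "2 * C * (D * I) * ?k"] conjI allI impI)
    fix u :: "real ^ 'n \<Rightarrow> real" and N r x
    assume N: "N \<ge> 0" and per: "periodic u" and diff: "u differentiable_on UNIV"
      and hol: "\<forall>i x y. \<bar>partial i u x - partial i u y\<bar> \<le> N * norm (x - y) powr \<alpha>" and r: "(r :: real) > 0"
    let ?h = "\<lambda>x. complex_of_real (u x)"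
    have ch: "cont_periodic ?h" by (rule cont_periodic_of_real[OF per diff])
    have sd: "norm (?h (x + y) + ?h (x - y) - 2 * ?h x) \<le> (D * N) * norm y powr p" for x y
    proof -
      have "\<bar>u (x + 1 *\<^sub>R y) + u (x + (- 1) *\<^sub>R y) - 2 * u (x + 0 *\<^sub>R y)\<bar> \<le> (D * N) * norm y powr p"
      proof (rule second_difference_mvt[OF has_real_derivative_along_line[OF diff]])
        fix a b :: real assume ab: "\<bar>a - b\<bar> \<le> 2"
        have "\<bar>\<Sum>i\<in>UNIV. y $ i * (partial i u (x + a *\<^sub>R y) - partial i u (x + b *\<^sub>R y))\<bar> \<le>
            CARD('n) * norm y * (N * (2 powr \<alpha> * norm y powr \<alpha>))"
        proof (rule abs_sum_components_le)
          fix i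
          have "\<bar>partial i u (x + a *\<^sub>R y) - partial i u (x + b *\<^sub>R y)\<bar> \<le> N * norm ((a - b) *\<^sub>R y) powr \<alpha>"
            using hol[rule_format, of i "x + a *\<^sub>R y" "x + b *\<^sub>R y"] by (simp add: scaleR_left_diff_distrib)
          also have "norm ((a - b) *\<^sub>R y) powr \<alpha> \<le> (2 * norm y) powr \<alpha>"
            using ab \<alpha> by (intro powr_mono2) (auto intro: mult_right_mono)
          also have "(2 * norm y) powr \<alpha> = 2 powr \<alpha> * norm y powr \<alpha>" by (simp add: powr_mult)
          finally show "\<bar>partial i u (x + a *\<^sub>R y) - partial i u (x + b *\<^sub>R y)\<bar> \<le> N * (2 powr \<alpha> * norm y powr \<alpha>)"
            using N by (simp add: mult_left_mono)
        qed (use N in simp)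
        also have "\<dots> = (D * N) * (norm y * norm y powr \<alpha>)" by (simp add: D_def)
        also have "norm y * norm y powr \<alpha> = norm y powr p" unfolding p_def by (rule powr_mult_base) simp
        finally show "\<bar>(\<Sum>i\<in>UNIV. y $ i * partial i u (x + a *\<^sub>R y)) - (\<Sum>i\<in>UNIV. y $ i * partial i u (x + b *\<^sub>R y))\<bar> \<le> (D * N) * norm y powr p"
          by (simp only: right_diff_distrib sum_subtractf)
      qed
      moreover have "?h (x + y) + ?h (x - y) - 2 * ?h x = complex_of_real (u (x + 1 *\<^sub>R y) + u (x + (- 1) *\<^sub>R y) - 2 * u (x + 0 *\<^sub>R y))"
        by simp
      ultimately show ?thesis by (simp only: norm_of_real)
    qed
    have lap: "norm (heat_lap \<rho> ?h x) \<le> (D * N) * \<rho> powr (p / 2 - 1) * I" if "\<rho> > 0" for \<rho> x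
      unfolding I_def by (rule heat_lap_second_difference[OF ch that _ _ sd]) (use \<alpha> in \<open>auto simp: p_def\<close>)
    have "norm (bilap r ?h x) \<le> C / (r / 2) * ((D * N) * (r / 2) powr (p / 2 - 1) * I)"
      unfolding bilap_def by (intro C(2) lap) (use r in auto)
    also have "(r / 2) powr (p / 2 - 1) = r powr (p / 2 - 1) * ?k"
      using powr_minus_divide[of 2 "1 - p / 2"] by (simp add: powr_divide)
    also have "r powr (p / 2 - 1) = r * r powr (p / 2 - 2)"
      using r by (simp add: powr_diff power2_eq_square)
    finally show "norm (bilap r ?h x) \<le> 2 * C * (D * I) * ?k * N * r powr ((1 + \<alpha>) / 2 - 2)"
      using r by (simp add: p_def mult.assoc mult.commute mult.left_commute)
  qed (use C D I in simp)
qed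

lemma heat_lap_shift: "heat_lap r (\<lambda>x. h (x + w)) x = heat_lap r h (x + w)"
  unfolding heat_lap_def gauss_avg_def by (simp only: add.assoc add.commute[of w])

text \<open>
  Second differences cannot exploit more than two derivatives, so the Hoelder modulus is used by the outer factor:
  second differences of an increment \<open>u (x + w) - u x\<close> show that \<open>heat_lap \<rho> u\<close> is \<open>\<alpha>\<close>-Hoelder uniformly
  in \<open>\<rho>\<close>.
\<close>

lemma bilap_decay_C2:
  fixes \<alpha> :: real
  assumes \<alpha>: "0 < \<alpha>" "\<alpha> < 1"
  shows "\<exists>C\<ge>0. \<forall>(u :: real ^ 'n::finite \<Rightarrow> real) N. N \<ge> 0 \<longrightarrow> periodic u \<longrightarrow> u differentiable_on UNIV \<longrightarrow>
    (\<forall>i. partial i u differentiable_on UNIV) \<longrightarrow>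
    (\<forall>i j x y. \<bar>partial j (partial i u) x - partial j (partial i u) y\<bar> \<le> N * norm (x - y) powr \<alpha>) \<longrightarrow>
    (\<forall>r>0. \<forall>x. norm (bilap r (\<lambda>x. complex_of_real (u x)) x) \<le> C * N * r powr ((2 + \<alpha>) / 2 - 2))"
proof -
  obtain C where C: "C \<ge> 0" "\<And>r (h :: real ^ 'n \<Rightarrow> complex) H x. r > 0 \<Longrightarrow> cont_periodic h \<Longrightarrow>
      (\<forall>x y. norm (h x - h y) \<le> H * norm (x - y) powr \<alpha>) \<Longrightarrow> norm (heat_lap r h x) \<le> C * H * r powr (\<alpha> / 2 - 1)"
    using heat_lap_holder_bound[of \<alpha>, where 'n = 'n] \<alpha> by auto
  define I where "I = 2 powr (2 / 2) / 2 * (LINT \<zeta>|(gauss :: (real ^ 'n) measure). \<bar>lap_weight \<zeta>\<bar> * norm \<zeta> powr 2)"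
  have I: "I \<ge> 0" unfolding I_def by simp
  define D where "D = 2 * (real CARD('n) * real CARD('n))"
  have D: "D \<ge> 0" by (simp add: D_def)
  let ?k = "2 powr (1 - \<alpha> / 2)"
  show ?thesis
  proof (intro exI[of _ "C * (D * I) * ?k"] conjI allI impI)
    fix u :: "real ^ 'n \<Rightarrow> real" and N r x
    assume N: "N \<ge> 0" and per: "periodic u" and diff: "u differentiable_on UNIV"
      and diff2: "\<forall>i. partial i u differentiable_on UNIV"
      and hol: "\<forall>i j x y. \<bar>partial j (partial i u) x - partial j (partial i u) y\<bar> \<le> N * norm (x - y) powr \<alpha>"
      and r: "(r :: real) > 0"
    let ?h = "\<lambda>x. complex_of_real (u x)"
    have ch: "cont_periodic ?h" by (rule cont_periodic_of_real[OF per diff])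
    have inc: "norm (heat_lap \<rho> ?h (x + w) - heat_lap \<rho> ?h x) \<le> (D * I * N) * norm w powr \<alpha>" if \<rho>: "\<rho> > 0" for \<rho> x w
    proof -
      let ?g = "\<lambda>x. ?h (x + w) - ?h x"
      have cg: "cont_periodic ?g" by (intro cont_periodic_diff cont_periodic_shift ch)
      have sd: "norm (?g (x + y) + ?g (x - y) - 2 * ?g x) \<le> (D * (N * norm w powr \<alpha>)) * norm y powr 2" for x y
      proof -
        define \<phi> where "\<phi> \<tau> = u ((x + w) + \<tau> *\<^sub>R y) - u (x + \<tau> *\<^sub>R y)" for \<tau>
        define \<phi>' where "\<phi>' \<tau> = (\<Sum>i\<in>UNIV. y $ i * (partial i u ((x + w) + \<tau> *\<^sub>R y) - partial i u (x + \<tau> *\<^sub>R y)))" for \<tau>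
        define \<phi>'' where "\<phi>'' \<tau> = (\<Sum>i\<in>UNIV. y $ i * (\<Sum>j\<in>UNIV. y $ j *
            (partial j (partial i u) ((x + w) + \<tau> *\<^sub>R y) - partial j (partial i u) (x + \<tau> *\<^sub>R y))))" for \<tau>
        define B where "B = CARD('n) * norm y * (CARD('n) * norm y * (N * norm w powr \<alpha>))"
        have d1: "(\<phi> has_real_derivative \<phi>' \<tau>) (at \<tau>)" for \<tau>
          unfolding \<phi>_def[abs_def] \<phi>'_def right_diff_distrib sum_subtractf
          by (intro DERIV_diff has_real_derivative_along_line diff)
        have d2: "(\<phi>' has_real_derivative \<phi>'' \<tau>) (at \<tau>)" for \<tau>
          unfolding \<phi>'_def[abs_def] \<phi>''_def
          by (intro DERIV_sum DERIV_cmult) (simp only: right_diff_distrib sum_subtractf, intro DERIV_diff has_real_derivative_along_line diff2[rule_format])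
        have b2: "norm (\<phi>'' \<tau>) \<le> B" for \<tau>
          unfolding \<phi>''_def B_def real_norm_def
        proof (intro abs_sum_components_le)
          show "\<bar>partial j (partial i u) ((x + w) + \<tau> *\<^sub>R y) - partial j (partial i u) (x + \<tau> *\<^sub>R y)\<bar> \<le> N * norm w powr \<alpha>" for i j
            using hol[rule_format, of j i "(x + w) + \<tau> *\<^sub>R y" "x + \<tau> *\<^sub>R y"] by simp
        qed (use N in auto)
        have B: "B \<ge> 0" using N by (simp add: B_def)
        have "\<bar>\<phi> 1 + \<phi> (- 1) - 2 * \<phi> 0\<bar> \<le> B * 2"
        proof (rule second_difference_mvt[OF d1])
          fix a b :: real assume "\<bar>a - b\<bar> \<le> 2"
          moreover have "norm (\<phi>' a - \<phi>' b) \<le> B * norm (a - b)"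
            by (rule field_differentiable_bound[of UNIV \<phi>' \<phi>'']) (use d2 b2 in auto)
          ultimately show "\<bar>\<phi>' a - \<phi>' b\<bar> \<le> B * 2"
            using mult_left_mono[OF _ B, of "\<bar>a - b\<bar>" 2] by simp
        qed
        also have "B * 2 = (D * (N * norm w powr \<alpha>)) * norm y powr 2"
          by (simp add: B_def D_def power2_eq_square)
        finally have "\<bar>\<phi> 1 + \<phi> (- 1) - 2 * \<phi> 0\<bar> \<le> (D * (N * norm w powr \<alpha>)) * norm y powr 2" .
        moreover have "?g (x + y) + ?g (x - y) - 2 * ?g x = complex_of_real (\<phi> 1 + \<phi> (- 1) - 2 * \<phi> 0)"
          by (simp add: \<phi>_def algebra_simps)
        ultimately show ?thesis by (simp only: norm_of_real)
      qed
      have "norm (heat_lap \<rho> ?g x) \<le> (D * (N * norm w powr \<alpha>)) * \<rho> powr (2 / 2 - 1) * I"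
        unfolding I_def by (rule heat_lap_second_difference[OF cg \<rho> _ _ sd]) auto
      moreover have "heat_lap \<rho> ?g x = heat_lap \<rho> ?h (x + w) - heat_lap \<rho> ?h x"
        using bl_functional_diff[OF bl_functional_apply[OF bl_operator_heat_lap] cont_periodic_shift[OF ch] ch]
        by (simp only: heat_lap_shift[of \<rho> ?h])
      ultimately show ?thesis using \<rho> by (simp add: mult.assoc mult.commute mult.left_commute)
    qed
    have hol': "\<forall>x y. norm (heat_lap (r / 2) ?h x - heat_lap (r / 2) ?h y) \<le> (D * I * N) * norm (x - y) powr \<alpha>"
    proof (intro allI)
      fix x y
      show "norm (heat_lap (r / 2) ?h x - heat_lap (r / 2) ?h y) \<le> (D * I * N) * norm (x - y) powr \<alpha>"
        using inc[of "r / 2" y "x - y"] r by simp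
    qed
    have "norm (bilap r ?h x) \<le> C * (D * I * N) * (r / 2) powr (\<alpha> / 2 - 1)"
      unfolding bilap_def by (rule C(2)[OF _ cont_periodic_heat_lap[OF ch] hol']) (use r in simp)
    also have "(r / 2) powr (\<alpha> / 2 - 1) = r powr (\<alpha> / 2 - 1) * ?k"
      using powr_minus_divide[of 2 "1 - \<alpha> / 2"] by (simp add: powr_divide)
    also have "\<alpha> / 2 - 1 = (2 + \<alpha>) / 2 - 2" by (simp add: field_simps)
    finally show "norm (bilap r ?h x) \<le> C * (D * I) * ?k * N * r powr ((2 + \<alpha>) / 2 - 2)"
      by (simp add: mult.assoc mult.commute mult.left_commute)
  qed (use C D I in simp)
qed

section \<open>Translation to the Hoelder norms\<close>

lemma holder_seminorm_leD:
  assumes "holder_seminorm \<alpha> S v \<le> ennreal N" "N \<ge> 0" "x \<in> S" "y \<in> S"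
  shows "\<bar>v x - v y\<bar> \<le> N * dist x y powr \<alpha>"
proof (cases "x = y")
  case False
  have "ennreal (\<bar>v x - v y\<bar> / dist x y powr \<alpha>) \<le> holder_seminorm \<alpha> S v"
    unfolding holder_seminorm_def
    by (rule SUP_upper2[OF assms(3)], rule SUP_upper2[of y]) (use assms False in auto)
  also have "\<dots> \<le> ennreal N" by (rule assms(1))
  finally have "\<bar>v x - v y\<bar> / dist x y powr \<alpha> \<le> N" using assms(2) by simp
  then show ?thesis using False by (simp add: divide_le_eq)
qed (use assms in simp)

lemma holder_seminorm_leI:
  assumes "N \<ge> 0" "\<And>x y. x \<in> S \<Longrightarrow> y \<in> S \<Longrightarrow> \<bar>v x - v y\<bar> \<le> N * dist x y powr \<alpha>"
  shows "holder_seminorm \<alpha> S v \<le> ennreal N"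
  unfolding holder_seminorm_def
proof (intro SUP_least)
  fix x y assume xy: "x \<in> S" "y \<in> S - {x}"
  then have "\<bar>v x - v y\<bar> / dist x y powr \<alpha> \<le> N" using assms(1) assms(2)[of x y] by (simp add: divide_le_eq)
  then show "ennreal (\<bar>v x - v y\<bar> / dist x y powr \<alpha>) \<le> ennreal N" by (rule ennreal_leI)
qed

lemma par_holder_norm_leI:
  assumes B: "B \<ge> 0"
    and v: "\<And>x t. t \<in> {0..T} \<Longrightarrow> \<bar>v x t\<bar> \<le> B"
    and vx: "\<And>x y t. t \<in> {0..T} \<Longrightarrow> \<bar>v x t - v y t\<bar> \<le> B * norm (x - y) powr \<alpha>"
    and vt: "\<And>x t t'. t \<in> {0..T} \<Longrightarrow> t' \<in> {0..T} \<Longrightarrow> \<bar>v x t - v x t'\<bar> \<le> B * \<bar>t - t'\<bar> powr \<gamma>"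
  shows "par_holder_norm \<alpha> \<gamma> T v \<le> ennreal (3 * B)"
proof -
  have "sup_norm (UNIV \<times> {0..T}) (\<lambda>(x, t). v x t) \<le> ennreal B"
    unfolding sup_norm_def by (intro SUP_least) (use v in \<open>auto intro!: ennreal_leI\<close>)
  moreover have "(SUP t\<in>{0..T}. holder_seminorm \<alpha> UNIV (\<lambda>x. v x t)) \<le> ennreal B"
    by (intro SUP_least holder_seminorm_leI B) (use vx in \<open>auto simp: dist_norm\<close>)
  moreover have "(SUP x. holder_seminorm \<gamma> {0..T} (v x)) \<le> ennreal B"
    by (intro SUP_least holder_seminorm_leI B) (use vt in \<open>auto simp: dist_real_def\<close>)
  ultimately have "par_holder_norm \<alpha> \<gamma> T v \<le> ennreal B + (ennreal B + ennreal B)"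
    unfolding par_holder_norm_def par_holder_seminorm_def by (intro add_mono)
  also have "\<dots> = ennreal (3 * B)" using B by (simp flip: ennreal_plus)
  finally show ?thesis .
qed

text \<open>
  The integer part of \<open>2 s + \<beta>\<close> is \<open>1\<close> or \<open>2\<close>, and in both cases half of the total order of smoothness is
  \<open>s + \<beta>/2\<close>.
\<close>

lemma bilap_decay_holder_space:
  fixes s \<beta> :: real
  assumes s: "1 / 2 < s" "s < 1" and \<beta>: "0 < \<beta>" "\<beta> < 1" and ni: "2 * s + \<beta> \<notin> \<int>"
  shows "\<exists>C\<ge>0. \<forall>(u :: real ^ 'n::finite \<Rightarrow> real) N. N \<ge> 0 \<longrightarrow>
    u \<in> holder_space (nat \<lfloor>2 * s + \<beta>\<rfloor>) (frac (2 * s + \<beta>)) \<longrightarrow>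
    holder_norm (nat \<lfloor>2 * s + \<beta>\<rfloor>) (frac (2 * s + \<beta>)) u \<le> ennreal N \<longrightarrow>
    (\<forall>r>0. \<forall>x. norm (bilap r (\<lambda>x. complex_of_real (u x)) x) \<le> C * N * r powr (- (2 - s - \<beta> / 2)))"
proof -
  define \<alpha> where "\<alpha> = frac (2 * s + \<beta>)"
  have \<alpha>: "0 < \<alpha>" "\<alpha> < 1" using ni frac_lt_1 frac_gt_0_iff by (auto simp: \<alpha>_def)
  have sum: "2 * s + \<beta> = of_int \<lfloor>2 * s + \<beta>\<rfloor> + \<alpha>" by (simp add: \<alpha>_def frac_def)
  have top: "holder_seminorm \<alpha> UNIV (partials is u) \<le> ennreal N"
    if "holder_norm k \<alpha> u \<le> ennreal N" "length is = k" for k "is" N and u :: "real ^ 'n \<Rightarrow> real"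
  proof -
    have "holder_seminorm \<alpha> UNIV (partials is u) \<le> (SUP is\<in>{is. length is = k}. holder_seminorm \<alpha> UNIV (partials is u))"
      by (rule SUP_upper) (use that in simp)
    also have "\<dots> \<le> holder_norm k \<alpha> u" unfolding holder_norm_def by simp
    finally show ?thesis using that(1) by (rule order_trans)
  qed
  have "\<lfloor>2 * s + \<beta>\<rfloor> \<ge> 1" "\<lfloor>2 * s + \<beta>\<rfloor> < 3" using s \<beta> by (auto simp: le_floor_iff floor_less_iff)
  then consider "\<lfloor>2 * s + \<beta>\<rfloor> = 1" | "\<lfloor>2 * s + \<beta>\<rfloor> = 2" by linarith
  then show ?thesis
  proof cases
    case 1
    then have e: "(1 + \<alpha>) / 2 - 2 = - (2 - s - \<beta> / 2)" using sum by simp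
    obtain C where C: "C \<ge> 0" "\<And>(u :: real ^ 'n \<Rightarrow> real) N r x. N \<ge> 0 \<Longrightarrow> periodic u \<Longrightarrow> u differentiable_on UNIV \<Longrightarrow>
        \<forall>i x y. \<bar>partial i u x - partial i u y\<bar> \<le> N * norm (x - y) powr \<alpha> \<Longrightarrow> r > 0 \<Longrightarrow>
        norm (bilap r (\<lambda>x. complex_of_real (u x)) x) \<le> C * N * r powr ((1 + \<alpha>) / 2 - 2)"
      using bilap_decay_C1[OF \<alpha>, where 'n = 'n] by blast
    show ?thesis
    proof (intro exI[of _ C] conjI allI impI C(1))
      fix u :: "real ^ 'n \<Rightarrow> real" and N r x
      assume N: "N \<ge> 0" and u: "u \<in> holder_space (nat \<lfloor>2 * s + \<beta>\<rfloor>) (frac (2 * s + \<beta>))"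
        and le: "holder_norm (nat \<lfloor>2 * s + \<beta>\<rfloor>) (frac (2 * s + \<beta>)) u \<le> ennreal N" and r: "(r :: real) > 0"
      have le': "holder_norm (Suc 0) \<alpha> u \<le> ennreal N" using le 1 by (simp add: \<alpha>_def)
      have "periodic u" "u differentiable_on UNIV" using u 1 by (auto simp: holder_space_def)
      moreover have "\<forall>i x y. \<bar>partial i u x - partial i u y\<bar> \<le> N * norm (x - y) powr \<alpha>"
      proof (intro allI)
        fix i x y
        show "\<bar>partial i u x - partial i u y\<bar> \<le> N * norm (x - y) powr \<alpha>"
          using holder_seminorm_leD[OF top[OF le', of "[i]"] N, of x y] by (simp add: partials_def dist_norm)
      qed
      ultimately show "norm (bilap r (\<lambda>x. complex_of_real (u x)) x) \<le> C * N * r powr (- (2 - s - \<beta> / 2))"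
        using C(2)[OF N _ _ _ r] unfolding e by blast
    qed
  next
    case 2
    then have e: "(2 + \<alpha>) / 2 - 2 = - (2 - s - \<beta> / 2)" using sum by simp
    obtain C where C: "C \<ge> 0" "\<And>(u :: real ^ 'n \<Rightarrow> real) N r x. N \<ge> 0 \<Longrightarrow> periodic u \<Longrightarrow> u differentiable_on UNIV \<Longrightarrow>
        \<forall>i. partial i u differentiable_on UNIV \<Longrightarrow>
        \<forall>i j x y. \<bar>partial j (partial i u) x - partial j (partial i u) y\<bar> \<le> N * norm (x - y) powr \<alpha> \<Longrightarrow> r > 0 \<Longrightarrow>
        norm (bilap r (\<lambda>x. complex_of_real (u x)) x) \<le> C * N * r powr ((2 + \<alpha>) / 2 - 2)"
      using bilap_decay_C2[OF \<alpha>, where 'n = 'n] by blast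
    show ?thesis
    proof (intro exI[of _ C] conjI allI impI C(1))
      fix u :: "real ^ 'n \<Rightarrow> real" and N r x
      assume N: "N \<ge> 0" and u: "u \<in> holder_space (nat \<lfloor>2 * s + \<beta>\<rfloor>) (frac (2 * s + \<beta>))"
        and le: "holder_norm (nat \<lfloor>2 * s + \<beta>\<rfloor>) (frac (2 * s + \<beta>)) u \<le> ennreal N" and r: "(r :: real) > 0"
      have le': "holder_norm (Suc (Suc 0)) \<alpha> u \<le> ennreal N" using le 2 by (simp add: \<alpha>_def numeral_2_eq_2)
      have "periodic u" "u differentiable_on UNIV" "\<forall>i. partial i u differentiable_on UNIV"
        using u 2 by (auto simp: holder_space_def numeral_2_eq_2)
      moreover have "\<forall>i j x y. \<bar>partial j (partial i u) x - partial j (partial i u) y\<bar> \<le> N * norm (x - y) powr \<alpha>"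
      proof (intro allI)
        fix i j x y
        show "\<bar>partial j (partial i u) x - partial j (partial i u) y\<bar> \<le> N * norm (x - y) powr \<alpha>"
          using holder_seminorm_leD[OF top[OF le', of "[j, i]"] N, of x y] by (simp add: partials_def dist_norm)
      qed
      ultimately show "norm (bilap r (\<lambda>x. complex_of_real (u x)) x) \<le> C * N * r powr (- (2 - s - \<beta> / 2))"
        using C(2)[OF N _ _ _ _ r] unfolding e by blast
    qed
  qed
qed

section \<open>The regularity estimate\<close>

lemma cont_cyl_of_real: "cont_QT T v \<Longrightarrow> cont_cyl T (\<lambda>x t. complex_of_real (v x t))"
  unfolding cont_QT_def cont_cyl_def periodic_def case_prod_beta by (auto intro: continuous_on_of_real)

theorem lemma2p4:
  fixes \<beta> s T :: real
  assumes "0 < \<beta>" and "\<beta> < 1" and "1 / 2 < s" and "s < 1"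
    and "2 * s + \<beta> \<notin> \<int>" and "0 < T"
  shows "\<exists>C>0. \<forall>(f :: real ^ 'n::finite \<Rightarrow> real \<Rightarrow> real) u\<^sub>T u.
     f \<in> par_holder_space \<beta> (\<beta> / 2) T \<longrightarrow>
     u\<^sub>T \<in> holder_space (nat \<lfloor>2 * s + \<beta>\<rfloor>) (frac (2 * s + \<beta>)) \<longrightarrow>
     is_solution s T f u\<^sub>T u \<longrightarrow>
     par_holder_norm \<beta> (\<beta> / 2) T (time_deriv T u) +
     par_holder_norm \<beta> (\<beta> / 2) T (frac_laplacian_x s u)
       \<le> ennreal C * (holder_norm (nat \<lfloor>2 * s + \<beta>\<rfloor>) (frac (2 * s + \<beta>)) u\<^sub>T +
                      par_holder_norm \<beta> (\<beta> / 2) T f)"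
proof -
  note \<beta> = assms(1,2) and s = assms(3,4) and ni = assms(5) and T = assms(6)
  let ?hn = "holder_norm (nat \<lfloor>2 * s + \<beta>\<rfloor>) (frac (2 * s + \<beta>)) :: (real ^ 'n \<Rightarrow> real) \<Rightarrow> ennreal"
  let ?pn = "par_holder_norm \<beta> (\<beta> / 2) T :: (real ^ 'n \<Rightarrow> real \<Rightarrow> real) \<Rightarrow> ennreal"
  obtain D where D: "D \<ge> 0" "\<forall>(u :: real ^ 'n \<Rightarrow> real) N. N \<ge> 0 \<longrightarrow>
    u \<in> holder_space (nat \<lfloor>2 * s + \<beta>\<rfloor>) (frac (2 * s + \<beta>)) \<longrightarrow> ?hn u \<le> ennreal N \<longrightarrow>
    (\<forall>r>0. \<forall>x. norm (bilap r (\<lambda>x. complex_of_real (u x)) x) \<le> D * N * r powr (- (2 - s - \<beta> / 2)))"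
    using bilap_decay_holder_space[OF s \<beta> ni, where 'n = 'n] by blast
  obtain C where C: "C > 0" and est: "\<forall>(u :: real ^ 'n \<Rightarrow> real \<Rightarrow> complex) z f N. N \<ge> 0 \<longrightarrow>
    cont_cyl T u \<longrightarrow> cont_cyl T z \<longrightarrow> cont_cyl T f \<longrightarrow>
    (\<forall>t\<in>{0..T}. frac_pair s (\<lambda>x. u x t) (\<lambda>x. z x t)) \<longrightarrow>
    (\<forall>x. \<forall>t\<in>{0..T}. (u x has_vector_derivative z x t + f x t) (at t within {0..T})) \<longrightarrow>
    (\<forall>t\<in>{0..T}. \<forall>x y. norm (f x t - f y t) \<le> N * norm (x - y) powr \<beta>) \<longrightarrow>
    (\<forall>r>0. \<forall>x. norm (bilap r (\<lambda>x. u x T) x) \<le> N * r powr (- (2 - s - \<beta> / 2))) \<longrightarrow>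
    (\<forall>t\<in>{0..T}. \<forall>x. norm (z x t) \<le> C * N \<and>
      (\<forall>y. norm (z x t - z y t) \<le> C * N * norm (x - y) powr \<beta>) \<and>
      (\<forall>t'\<in>{0..T}. norm (z x t - z x t') \<le> C * N * \<bar>t - t'\<bar> powr (\<beta> / 2)))"
    using a_priori_estimate[OF s \<beta> T, where 'n = 'n] by blast
  \<comment> \<open>Both norms are sums of three terms; those of \<open>z\<close> are at most \<open>C (1 + D) N\<close>, and \<open>f\<close> adds \<open>3 N\<close>.\<close>
  define E where "E = 6 * (C * (1 + D)) + 3"
  have E: "E > 0" using C D by (auto simp: E_def intro!: add_nonneg_pos)
  show ?thesis
  proof (intro exI[of _ E] conjI allI impI E)
    fix f :: "real ^ 'n \<Rightarrow> real \<Rightarrow> real" and u\<^sub>T u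
    assume f: "f \<in> par_holder_space \<beta> (\<beta> / 2) T"
      and uT: "u\<^sub>T \<in> holder_space (nat \<lfloor>2 * s + \<beta>\<rfloor>) (frac (2 * s + \<beta>))"
      and sol: "is_solution s T f u\<^sub>T u"
    show "?pn (time_deriv T u) + ?pn (frac_laplacian_x s u) \<le> ennreal E * (?hn u\<^sub>T + ?pn f)"
    proof (cases "?hn u\<^sub>T + ?pn f")
      case top
      then have "?hn u\<^sub>T + ?pn f = top" by simp
      then show ?thesis using E by (simp only: ennreal_mult_top) simp
    next
      case (real N)
      have N: "N \<ge> 0" and tot: "?hn u\<^sub>T + ?pn f = ennreal N" using real by auto
      have hT: "?hn u\<^sub>T \<le> ennreal N" and hf: "?pn f \<le> ennreal N"
        unfolding tot[symmetric] by simp_all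
      define z where "z = frac_laplacian_x s u"
      let ?u = "\<lambda>x t. complex_of_real (u x t)" and ?z = "\<lambda>x t. complex_of_real (z x t)" and ?f = "\<lambda>x t. complex_of_real (f x t)"
      have cu: "cont_QT T u" and cz: "cont_QT T z" and cf: "cont_QT T f"
        using sol f by (auto simp: is_solution_def z_def par_holder_space_def)
      have eq: "time_deriv T u x t = z x t + f x t" if "t \<in> {0..T}" for x t
      proof -
        have "- time_deriv T u x t + z x t + f x t = 0" using sol that by (simp add: is_solution_def z_def)
        then show ?thesis by simp
      qed
      have fsup: "\<bar>f x t\<bar> \<le> N" if t: "t \<in> {0..T}" for x t
      proof -
        have "ennreal \<bar>f x t\<bar> \<le> sup_norm (UNIV \<times> {0..T}) (\<lambda>(x, t). f x t)"
          unfolding sup_norm_def by (rule SUP_upper2[of "(x, t)"]) (use t in auto)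
        also have "\<dots> \<le> ?pn f" unfolding par_holder_norm_def by simp
        finally show ?thesis using hf N by (metis ennreal_le_iff order_trans)
      qed
      have fx: "\<bar>f x t - f y t\<bar> \<le> N * norm (x - y) powr \<beta>" if t: "t \<in> {0..T}" for x y t
      proof -
        have "holder_seminorm \<beta> UNIV (\<lambda>x. f x t) \<le> (SUP t\<in>{0..T}. holder_seminorm \<beta> UNIV (\<lambda>x. f x t))"
          by (rule SUP_upper[OF t])
        also have "\<dots> \<le> ?pn f" unfolding par_holder_norm_def par_holder_seminorm_def by (simp add: add_increasing add_increasing2)
        also have "\<dots> \<le> ennreal N" by (rule hf)
        finally show ?thesis using holder_seminorm_leD[of \<beta> UNIV "\<lambda>x. f x t" N x y] N by (simp add: dist_norm)
      qed
      have ft: "\<bar>f x t - f x t'\<bar> \<le> N * \<bar>t - t'\<bar> powr (\<beta> / 2)" if t: "t \<in> {0..T}" "t' \<in> {0..T}" for x t t'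
      proof -
        have "holder_seminorm (\<beta> / 2) {0..T} (f x) \<le> (SUP x. holder_seminorm (\<beta> / 2) {0..T} (f x))"
          by (rule SUP_upper) simp
        also have "\<dots> \<le> ?pn f" unfolding par_holder_norm_def par_holder_seminorm_def by (simp add: add_increasing add_increasing2)
        also have "\<dots> \<le> ennreal N" by (rule hf)
        finally show ?thesis using holder_seminorm_leD[of "\<beta> / 2" "{0..T}" "f x" N t t'] N t by (simp add: dist_real_def)
      qed
      \<comment> \<open>one constant that bounds both the seminorm of \<open>f\<close> and the decay of the terminal data\<close>
      define N' where "N' = (1 + D) * N"
      have N': "N' \<ge> 0" "N \<le> N'" "D * N \<le> N'" using N D(1) by (auto simp: N'_def algebra_simps)
      have pair: "\<forall>t\<in>{0..T}. frac_pair s (\<lambda>x. ?u x t) (\<lambda>x. ?z x t)"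
      proof
        fix t assume t: "t \<in> {0..T}"
        obtain g where g: "has_frac_laplacian s (\<lambda>x. u x t) g" using sol t unfolding is_solution_def by blast
        have zg: "z x t = g x" for x
          unfolding z_def frac_laplacian_x_def frac_laplacian_eq[OF g] ..
        show "frac_pair s (\<lambda>x. ?u x t) (\<lambda>x. ?z x t)"
          unfolding frac_pair_def
          using cont_cyl_slice[OF cont_cyl_of_real[OF cu] t] cont_cyl_slice[OF cont_cyl_of_real[OF cz] t]
            fcoeff_frac_laplacian[OF g]
          by (simp add: zg fourier_coeff_eq)
      qed
      have deriv: "\<forall>x. \<forall>t\<in>{0..T}. (?u x has_vector_derivative ?z x t + ?f x t) (at t within {0..T})"
      proof (intro allI ballI)
        fix x t assume t: "t \<in> {0..T}"
        have "u x differentiable (at t within {0..T})" using sol t by (simp add: is_solution_def)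
        then have "(u x has_vector_derivative time_deriv T u x t) (at t within {0..T})"
          unfolding time_deriv_def by (simp add: vector_derivative_works)
        then have "(?u x has_vector_derivative complex_of_real (time_deriv T u x t)) (at t within {0..T})"
          by (rule bounded_linear.has_vector_derivative[OF bounded_linear_of_real])
        then show "(?u x has_vector_derivative ?z x t + ?f x t) (at t within {0..T})"
          using eq[OF t] by simp
      qed
      have fH: "\<forall>t\<in>{0..T}. \<forall>x y. norm (?f x t - ?f y t) \<le> N' * norm (x - y) powr \<beta>"
      proof (intro ballI allI)
        fix t x y assume t: "t \<in> {0..T}"
        have "norm (?f x t - ?f y t) = \<bar>f x t - f y t\<bar>" by (simp flip: of_real_diff)
        also have "\<dots> \<le> N' * norm (x - y) powr \<beta>"
          by (rule order_trans[OF fx[OF t]]) (intro mult_right_mono N', simp)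
        finally show "norm (?f x t - ?f y t) \<le> N' * norm (x - y) powr \<beta>" .
      qed
      have U: "\<forall>r>0. \<forall>x. norm (bilap r (\<lambda>x. ?u x T) x) \<le> N' * r powr (- (2 - s - \<beta> / 2))"
      proof (intro allI impI)
        fix r :: real and x assume r: "r > 0"
        have "(\<lambda>x. u x T) = u\<^sub>T" using sol by (auto simp: is_solution_def)
        then have "(\<lambda>x. ?u x T) = (\<lambda>x. complex_of_real (u\<^sub>T x))" by (auto dest: fun_cong)
        then have "norm (bilap r (\<lambda>x. ?u x T) x) \<le> D * N * r powr (- (2 - s - \<beta> / 2))"
          using D(2) N uT hT r by simp
        also have "\<dots> \<le> N' * r powr (- (2 - s - \<beta> / 2))" by (intro mult_right_mono N') simp
        finally show "norm (bilap r (\<lambda>x. ?u x T) x) \<le> N' * r powr (- (2 - s - \<beta> / 2))" .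
      qed
      have core: "\<forall>t\<in>{0..T}. \<forall>x. norm (?z x t) \<le> C * N' \<and>
          (\<forall>y. norm (?z x t - ?z y t) \<le> C * N' * norm (x - y) powr \<beta>) \<and>
          (\<forall>t'\<in>{0..T}. norm (?z x t - ?z x t') \<le> C * N' * \<bar>t - t'\<bar> powr (\<beta> / 2))"
        by (rule est[THEN spec[of _ ?u], THEN spec[of _ ?z], THEN spec[of _ ?f], THEN spec[of _ N'],
            THEN mp, OF N'(1), THEN mp, OF cont_cyl_of_real[OF cu], THEN mp, OF cont_cyl_of_real[OF cz],
            THEN mp, OF cont_cyl_of_real[OF cf], THEN mp, OF pair, THEN mp, OF deriv, THEN mp, OF fH, THEN mp, OF U])
      define B where "B = C * N'"
      have B: "B \<ge> 0" using C N' by (simp add: B_def)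
      have z0: "\<bar>z x t\<bar> \<le> B" and zx: "\<bar>z x t - z y t\<bar> \<le> B * norm (x - y) powr \<beta>" if "t \<in> {0..T}" for x y t
        using core that unfolding B_def by (auto simp flip: of_real_diff)
      have zt: "\<bar>z x t - z x t'\<bar> \<le> B * \<bar>t - t'\<bar> powr (\<beta> / 2)" if "t \<in> {0..T}" "t' \<in> {0..T}" for x t t'
        using core that unfolding B_def by (auto simp flip: of_real_diff)
      have 1: "?pn z \<le> ennreal (3 * B)"
        by (rule par_holder_norm_leI[OF B z0 zx zt])
      have 2: "?pn (time_deriv T u) \<le> ennreal (3 * (B + N))"
      proof (rule par_holder_norm_leI)
        fix t x y assume t: "t \<in> {0..T}"
        show "\<bar>time_deriv T u x t\<bar> \<le> B + N" unfolding eq[OF t] using z0[OF t, of x] fsup[OF t, of x] by linarith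
        show "\<bar>time_deriv T u x t - time_deriv T u y t\<bar> \<le> (B + N) * norm (x - y) powr \<beta>"
          unfolding eq[OF t] distrib_right using zx[OF t, of x y] fx[OF t, of x y] by linarith
      next
        fix t t' x assume t: "t \<in> {0..T}" "t' \<in> {0..T}"
        show "\<bar>time_deriv T u x t - time_deriv T u x t'\<bar> \<le> (B + N) * \<bar>t - t'\<bar> powr (\<beta> / 2)"
          unfolding eq[OF t(1)] eq[OF t(2)] distrib_right using zt[OF t, of x] ft[OF t, of x] by linarith
      qed (use B N in simp)
      have "?pn (time_deriv T u) + ?pn z \<le> ennreal (3 * (B + N)) + ennreal (3 * B)"
        by (rule add_mono[OF 2 1])
      also have "\<dots> = ennreal (E * N)"
        using B N by (simp add: B_def N'_def E_def algebra_simps flip: ennreal_plus)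
      also have "\<dots> = ennreal E * (?hn u\<^sub>T + ?pn f)"
        unfolding tot using E N by (simp add: ennreal_mult)
      finally show ?thesis unfolding z_def .
    qed
  qed
qed

end
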